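(* Let $f\in\Lambda_p$, $1<p<\infty$, $\beta_1,\beta_2,r_1,r_2>0$, $\delta_1,\delta_2\in(0,\frac12)$, and suppose $f$ has a Weyl derivative $f^{(r_1,r_2)}\in L_p(\mathbb{T}^2)$. Then $$\omega_{\beta_1,\beta_2}(f^{(r_1,r_2)},\delta_1,\delta_2)_{L_p(\mathbb{T}^2)}\asymp\Big\{\int_0^{\delta_1}\int_0^{\delta_2}t_1^{-2r_1-1}t_2^{-2r_2-1}\,\omega^2_{r_1+\beta_1,r_2+\beta_2}(f,t_1,t_2)_{L_p(\mathbb{T}^2)}\,dt_2\,dt_1\Big\}^{1/2}$$ (with $t_i\in(0,\delta_i)$).
   Context: $L_p(\mathbb{T}^2)$, $1<p<\infty$, is the space of measurable functions $f(x,y)$ that are $2\pi$-periodic in each variable with $\|f\|_{L_p(\mathbb{T}^2)}=\big(\int_0^{2\pi}\int_0^{2\pi}|f(x,y)|^p\,dx\,dy\big)^{1/p}<\infty$; $L_p^0(\mathbb{T}^2)$ is the set of $f\in L_p(\mathbb{T}^2)$ with $\int_0^{2\pi}f(x,y)\,dy=0$ for a.e. $x$ and $\int_0^{2\pi}f(x,y)\,dx=0$ for a.e. $y$. The class $\Lambda_p$, $1<p<\infty$, is the set of $f\in L_p^0(\mathbb{T}^2)$ whose Fourier series is $\sum_{\mu_1=0}^\infty\sum_{\mu_2=0}^\infty\lambda_{\mu_1,\mu_2}\cos2^{\mu_1}x\cos2^{\mu_2}y$ with $\lambda_{\mu_1,\mu_2}\in\mathbb{R}$. For $\alpha_1,\alpha_2>0$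 the (fractional) differences are $\Delta_{h_1}^{\alpha_1}(f)=\sum_{\nu=0}^\infty(-1)^\nu\binom{\alpha_1}{\nu}f(x+(\alpha_1-\nu)h_1,y)$ and $\Delta_{h_2}^{\alpha_2}(f)=\sum_{\nu=0}^\infty(-1)^\nu\binom{\alpha_2}{\nu}f(x,y+(\alpha_2-\nu)h_2)$, where $\binom{\alpha}{0}=1$, $\binom{\alpha}{\nu}=\frac{\alpha(\alpha-1)\cdots(\alpha-\nu+1)}{\nu!}$ for $\nu\ge1$. The mixed modulus of smoothness is $\omega_{\alpha_1,\alpha_2}(f,\delta_1,\delta_2)_{L_p(\mathbb{T}^2)}=\sup_{|h_i|\le\delta_i,\,i=1,2}\|\Delta_{h_1}^{\alpha_1}(\Delta_{h_2}^{\alpha_2}(f))\|_{L_p(\mathbb{T}^2)}$, and $\omega^s$ denotes its $s$-th power. Weyl derivative: for $f$ with zero mean in each variable and Fourier series $\sum_{n_1,n_2\ne0}c_{n_1,n_2}e^{i(n_1x+n_2y)}$, and $\rho_1,\rho_2\ge0$, $f^{(\rho_1,\rho_2)}$ (order $\rho_1$ in $x$, $\rho_2$ in $y$) is the function with Fourier series $\sum_{n_1,n_2\neq0}(in_1)^{\rho_1}(in_2)^{\rho_2}c_{n_1,n_2}e^{i(n_1x+n_2y)}$, where $(in)^{\rho}=|n|^\rho e^{i\pi\rho\,\mathrm{sign}(n)/2}$. $A\asymp B$ means $C^{-1}B\le A\le CB$ with a constant $C>0$ independent of $f,\delta_1,\delta_2$ ($C$ may depend on $p,\beta_i,r_i$).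 *)

theory Defs
  imports "HOL-Analysis.Analysis"
begin

text \<open>Real powers on the extended nonnegative reals, used only with positive exponents,
  for which the value at infinity is infinity.\<close>

definition ennreal_powr :: "ennreal \<Rightarrow> real \<Rightarrow> ennreal" where
  "ennreal_powr x a = (if x = \<infinity> then \<infinity> else ennreal (enn2real x powr a))"

definition torus_cell :: "(real \<times> real) set" where
  "torus_cell = {0..2 * pi} \<times> {0..2 * pi}"

definition biperiodic :: "(real \<times> real \<Rightarrow> complex) \<Rightarrow> bool" where
  "biperiodic f \<longleftrightarrow> (\<forall>x y. f (x + 2 * pi, y) = f (x, y) \<and> f (x, y + 2 * pi) = f (x, y))"

definition Lp_norm :: "real \<Rightarrow> (real \<times> real \<Rightarrow> complex) \<Rightarrow> ennreal" where
  "Lp_norm p f =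
     ennreal_powr (\<integral>\<^sup>+z\<in>torus_cell. ennreal (norm (f z) powr p) \<partial>lebesgue) (1 / p)"

definition Lp :: "real \<Rightarrow> (real \<times> real \<Rightarrow> complex) set" where
  "Lp p = {f. f \<in> borel_measurable lebesgue \<and> biperiodic f \<and> Lp_norm p f < \<infinity>}"

definition Lp0 :: "real \<Rightarrow> (real \<times> real \<Rightarrow> complex) set" where
  "Lp0 p = {f \<in> Lp p.
     (AE x in lebesgue. (LINT y|lebesgue_on {0..2 * pi}. f (x, y)) = 0) \<and>
     (AE y in lebesgue. (LINT x|lebesgue_on {0..2 * pi}. f (x, y)) = 0)}"

definition fourier_coeff :: "(real \<times> real \<Rightarrow> complex) \<Rightarrow> int \<Rightarrow> int \<Rightarrow> complex" where
  "fourier_coeff f m n =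
     (LINT (x, y)|lebesgue_on torus_cell. f (x, y) * cis (- (of_int m * x + of_int n * y)))
       / (4 * pi\<^sup>2)"

text \<open>Since \<open>cos a * cos b\<close> is one quarter of the sum of the four exponentials
  \<open>cis (\<plusminus> a \<plusminus> b)\<close>, the series
  \<open>\<Sum>\<^sub>\<mu>\<^sub>1 \<Sum>\<^sub>\<mu>\<^sub>2 \<lambda> \<mu>\<^sub>1 \<mu>\<^sub>2 * cos (2 ^ \<mu>\<^sub>1 * x) * cos (2 ^ \<mu>\<^sub>2 * y)\<close> has the
  exponential coefficient \<open>\<lambda> \<mu>\<^sub>1 \<mu>\<^sub>2 / 4\<close> at each of the four frequencies
  \<open>(\<plusminus> 2 ^ \<mu>\<^sub>1, \<plusminus> 2 ^ \<mu>\<^sub>2)\<close>, and coefficient zero at every other frequency.\<close>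

definition has_lacunary_cosine_series ::
    "(real \<times> real \<Rightarrow> complex) \<Rightarrow> (nat \<Rightarrow> nat \<Rightarrow> real) \<Rightarrow> bool" where
  "has_lacunary_cosine_series f l \<longleftrightarrow>
     (\<forall>m n j k. \<bar>m\<bar> = 2 ^ j \<and> \<bar>n\<bar> = 2 ^ k \<longrightarrow>
        fourier_coeff f m n = complex_of_real (l j k / 4)) \<and>
     (\<forall>m n. \<not> (\<exists>j k. \<bar>m\<bar> = 2 ^ j \<and> \<bar>n\<bar> = 2 ^ k) \<longrightarrow> fourier_coeff f m n = 0)"

definition Lambda_class :: "real \<Rightarrow> (real \<times> real \<Rightarrow> complex) set" where
  "Lambda_class p = {f \<in> Lp0 p. \<exists>l. has_lacunary_cosine_series f l}"

text \<open>For \<open>f \<in> Lp p\<close> and \<open>\<alpha> > 0\<close> the series below converge absolutely for almost every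
  \<open>(x, y)\<close>; on the exceptional null set the value of the infinite sum is immaterial.\<close>

definition diff_x ::
    "real \<Rightarrow> real \<Rightarrow> (real \<times> real \<Rightarrow> complex) \<Rightarrow> real \<times> real \<Rightarrow> complex" where
  "diff_x \<alpha> h f = (\<lambda>(x, y). \<Sum>\<nu>.
     (- 1) ^ \<nu> * complex_of_real (\<alpha> gchoose \<nu>) * f (x + (\<alpha> - real \<nu>) * h, y))"

definition diff_y ::
    "real \<Rightarrow> real \<Rightarrow> (real \<times> real \<Rightarrow> complex) \<Rightarrow> real \<times> real \<Rightarrow> complex" where
  "diff_y \<alpha> h f = (\<lambda>(x, y). \<Sum>\<nu>.
     (- 1) ^ \<nu> * complex_of_real (\<alpha> gchoose \<nu>) * f (x, y + (\<alpha> - real \<nu>) * h))"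

definition mixed_modulus ::
    "real \<Rightarrow> real \<Rightarrow> real \<Rightarrow> (real \<times> real \<Rightarrow> complex) \<Rightarrow> real \<Rightarrow> real \<Rightarrow> ennreal" where
  "mixed_modulus p \<alpha>1 \<alpha>2 f \<delta>1 \<delta>2 =
     (SUP (h1, h2) \<in> {(h1, h2). \<bar>h1\<bar> \<le> \<delta>1 \<and> \<bar>h2\<bar> \<le> \<delta>2}.
        Lp_norm p (diff_x \<alpha>1 h1 (diff_y \<alpha>2 h2 f)))"

definition weyl_factor :: "int \<Rightarrow> real \<Rightarrow> complex" where
  "weyl_factor n \<rho> =
     complex_of_real (\<bar>real_of_int n\<bar> powr \<rho>) * cis (pi * \<rho> * sgn (real_of_int n) / 2)"

text \<open>\<open>g\<close> is a Weyl derivative of \<open>f\<close> of order \<open>\<rho>1\<close> in the first and \<open>\<rho>2\<close> in the second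
  variable. It is a relation because \<open>g\<close> is determined only up to a null set.\<close>

definition is_weyl_derivative ::
    "real \<Rightarrow> real \<Rightarrow> (real \<times> real \<Rightarrow> complex) \<Rightarrow> (real \<times> real \<Rightarrow> complex) \<Rightarrow> bool" where
  "is_weyl_derivative \<rho>1 \<rho>2 f g \<longleftrightarrow> g \<in> Lp 1 \<and>
     (\<forall>m n. fourier_coeff g m n =
        (if m = 0 \<or> n = 0 then 0
         else weyl_factor m \<rho>1 * weyl_factor n \<rho>2 * fourier_coeff f m n))"

end

theory Submission
  imports Defs
begin

text \<open>
  Both sides of the equivalence are, up to constants, square roots of one and the same double
  series in the Fourier coefficients of \<open>f\<close>.

  The bridge between \<open>L\<^sub>p\<close> norms and coefficients is the two-dimensional lacunary inequality
  (\<open>Lp_norm_energy_equiv\<close>): a function whose spectrum lies in the frequencies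
  \<open>(\<plusminus> 2 ^ j, \<plusminus> 2 ^ k)\<close> has \<open>L\<^sub>p\<close> norm comparable to the \<open>l\<^sub>2\<close> norm of its coefficients. For even
  exponents and polynomials with frequencies in one quadrant this is combinatorial: the \<open>m\<close>-th power
  of the polynomial has few coincidences among its frequencies, because a number is a sum of
  \<open>m\<close> powers of two in a bounded number of ways (\<open>card_power2_tuples_le\<close>, \<open>lacunary_even_moment_le\<close>).
  Pairing a function in \<open>L\<^sub>p\<close> with such polynomials gives the lower bound for its norm
  (\<open>dyadic_coeffs_bounded\<close>). The upper bound passes from the partial sums to the function itself
  (\<open>Lp_integral_bounded_of_dyadic_coeffs\<close>) and needs the fact that an integrable function on
  the torus is determined by its Fourier coefficients (\<open>fourier_uniqueness\<close>, from the
  Stone--Weierstrass theorem on the product of two circles).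

  A fractional difference of order \<open>\<alpha>\<close> and step \<open>h\<close> multiplies the coefficient at frequency \<open>n\<close> by a
  number of modulus \<open>\<bar>2 * sin (n * h / 2)\<bar> powr \<alpha>\<close> (\<open>norm_difference_symbol\<close>). Bounding
  the sine from above, and averaging over \<open>h\<close> for a bound from below, the square of the mixed modulus
  is comparable to the sum of the squared coefficients at \<open>(\<plusminus> 2 ^ j, \<plusminus> 2 ^ k)\<close> with weights
  \<open>min 1 (2 ^ j * \<delta>1) powr (2 * \<alpha>1) * min 1 (2 ^ k * \<delta>2) powr (2 * \<alpha>2)\<close> (\<open>mixed_modulus_equiv\<close>).

  The Weyl derivative multiplies the moduli of the coefficients by
  \<open>2 ^ (j * r1) * 2 ^ (k * r2)\<close>, and the integral on the right-hand side acts on each term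
  separately. So the theorem reduces to the comparison of
  \<open>\<integral> t powr (- 2 * r - 1) * min 1 (N * t) powr (2 * (r + \<beta>)) dt\<close> over \<open>{0<..<\<delta>}\<close> with
  \<open>N powr (2 * r) * min 1 (N * \<delta>) powr (2 * \<beta>)\<close>
  (\<open>weight_integral_ge\<close>, \<open>weight_integral_le\<close>).
\<close>


section \<open>Integration on the torus\<close>

text \<open>Lebesgue measure on one closed period cell; it is not normalized and has total mass \<open>4 * pi\<^sup>2\<close>.\<close>

abbreviation torus :: "(real \<times> real) measure" where
  "torus \<equiv> lebesgue_on torus_cell"

text \<open>The character of the torus at the frequency \<open>(m, n)\<close>.\<close>

definition torus_char :: "int \<Rightarrow> int \<Rightarrow> real \<times> real \<Rightarrow> complex" where
  "torus_char m n = (\<lambda>z. cis (of_int m * fst z + of_int n * snd z))"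

lemma torus_cell_eq_cbox: "torus_cell = cbox (0, 0) (2 * pi, 2 * pi)"
  by (auto simp: torus_cell_def cbox_Pair_eq)

lemma torus_cell_lebesgue [measurable]: "torus_cell \<in> sets lebesgue"
  by (simp add: torus_cell_eq_cbox)

lemma measure_torus_cell: "measure lebesgue torus_cell = 4 * pi\<^sup>2"
proof -
  have "measure lborel (cbox (0, 0) (2 * pi, 2 * pi) :: (real \<times> real) set) = 4 * pi\<^sup>2"
    by (simp add: content_Pair power2_eq_square)
  then show ?thesis by (simp add: torus_cell_eq_cbox)
qed

lemma emeasure_torus_cell: "emeasure lebesgue torus_cell = ennreal (4 * pi\<^sup>2)"
proof -
  have "emeasure lebesgue torus_cell < \<infinity>"
    using emeasure_lborel_cbox_finite[of "(0, 0) :: real \<times> real" "(2 * pi, 2 * pi)"]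
    by (simp add: torus_cell_eq_cbox)
  then show ?thesis
    by (simp add: emeasure_eq_ennreal_measure measure_torus_cell top.not_eq_extremum)
qed

lemma space_torus [simp]: "space torus = torus_cell"
  by simp

lemma emeasure_torus_space: "emeasure torus torus_cell = ennreal (4 * pi\<^sup>2)"
  by (simp add: emeasure_restrict_space emeasure_torus_cell)

lemma finite_measure_torus: "finite_measure torus"
  by (rule finite_measureI) (simp add: emeasure_torus_space)

lemma nn_integral_torus:
  "(\<integral>\<^sup>+z\<in>torus_cell. f z \<partial>lebesgue) = (\<integral>\<^sup>+z. f z \<partial>torus)"
  by (simp add: nn_integral_restrict_space)

lemma measurable_torus [measurable_dest]: "f \<in> borel_measurable lebesgue \<Longrightarrow> f \<in> borel_measurable torus"
  by (rule measurable_restrict_space1)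

lemma continuous_borel_measurable_lebesgue:
  "continuous_on UNIV f \<Longrightarrow> f \<in> borel_measurable lebesgue"
  for f :: "'a::euclidean_space \<Rightarrow> 'b::topological_space"
  using borel_measurable_continuous_onI[of f] by (simp add: measurable_completion)

lemma shift_measurable_lebesgue: "(\<lambda>z. z + w) \<in> lebesgue \<rightarrow>\<^sub>M lebesgue"
  for w :: "'a::euclidean_space"
  using lebesgue_affine_measurable[of "\<lambda>_. 1" w] by (simp add: euclidean_representation add.commute)

lemma nn_integral_lebesgue_shift:
  fixes F :: "'a::euclidean_space \<Rightarrow> ennreal"
  assumes F: "F \<in> borel_measurable lebesgue"
  shows "(\<integral>\<^sup>+z. F (z + w) \<partial>lebesgue) = (\<integral>\<^sup>+z. F z \<partial>lebesgue)"
proof -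
  have "lebesgue = distr lebesgue lebesgue (\<lambda>z::'a. z + w)"
    using lebesgue_affine_euclidean[of "\<lambda>_. 1" w] 
    by (simp add: euclidean_representation add.commute density_1)
  then have "(\<integral>\<^sup>+z. F z \<partial>lebesgue) = (\<integral>\<^sup>+z. F z \<partial>distr lebesgue lebesgue (\<lambda>z::'a. z + w))"
    by simp
  also have "\<dots> = (\<integral>\<^sup>+z. F (z + w) \<partial>lebesgue)"
    by (rule nn_integral_distr[OF shift_measurable_lebesgue]) (use F in simp)
  finally show ?thesis by simp
qed

lemma periodic_int:
  assumes per: "\<And>x y. F (x + 2 * pi, y) = F (x, y) \<and> F (x, y + 2 * pi) = F (x, y)"
  shows "F (x + 2 * pi * of_int k, y + 2 * pi * of_int l) = F (x, y)"
proof -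
  have nat1: "F (x + 2 * pi * real n, y) = F (x, y)" for x y n
  proof (induction n)
    case (Suc n)
    then show ?case using per[of "x + 2 * pi * real n" y] by (simp add: algebra_simps)
  qed simp
  have nat2: "F (x, y + 2 * pi * real n) = F (x, y)" for x y n
  proof (induction n)
    case (Suc n)
    then show ?case using per[of x "y + 2 * pi * real n"] by (simp add: algebra_simps)
  qed simp
  have int1: "F (x + 2 * pi * of_int k, y) = F (x, y)" for x y k
    using nat1[of x "nat k" y] nat1[of "x + 2 * pi * of_int k" "nat (- k)" y]
    by (cases "k \<ge> 0") (auto simp: algebra_simps)
  have int2: "F (x, y + 2 * pi * of_int k) = F (x, y)" for x y k
    using nat2[of x y "nat k"] nat2[of x "y + 2 * pi * of_int k" "nat (- k)"]
    by (cases "k \<ge> 0") (auto simp: algebra_simps)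
  show ?thesis by (simp add: int1 int2)
qed

text \<open>The cell without its upper and right edges: unlike the closed cell, its translates by the
  period lattice are disjoint.\<close>

definition half_open_cell :: "(real \<times> real) set" where
  "half_open_cell = {0..<2 * pi} \<times> {0..<2 * pi}"

lemma half_open_cell_borel [measurable]: "half_open_cell \<in> sets borel"
  unfolding half_open_cell_def by (auto intro!: borel_Times)

lemma half_open_cell_lebesgue [measurable]: "half_open_cell \<in> sets lebesgue"
  using half_open_cell_borel by (metis sets_completionI_sets sets_lborel)

lemma nn_integral_torus_half_open:
  "(\<integral>\<^sup>+z. F z \<partial>torus) = (\<integral>\<^sup>+z. F z * indicator half_open_cell z \<partial>lebesgue)"
proof -
  have "torus_cell - half_open_cell \<subseteq> torus_cell - box (0,0) (2*pi, 2*pi)"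
    by (auto simp: torus_cell_def half_open_cell_def box_def Basis_prod_def)
  also have "negligible \<dots>"
    unfolding torus_cell_eq_cbox
    by (metis negligible_frontier_interval)
  finally (negligible_subset[rotated]) have "negligible (torus_cell - half_open_cell)" .
  then have "AE z in lebesgue. z \<notin> torus_cell - half_open_cell"
    by (metis AE_not_in negligible_iff_null_sets)
  moreover have "half_open_cell \<subseteq> torus_cell"
    by (auto simp: torus_cell_def half_open_cell_def)
  ultimately show ?thesis
    unfolding nn_integral_torus[symmetric]
    by (intro nn_integral_cong_AE) (auto elim!: eventually_mono simp: indicator_def)
qed

text \<open>The translates of the half-open cell by the period lattice tile the plane.\<close>

lemma half_open_cell_tiling:
  "(\<integral>\<^sup>+k. indicator half_open_cell (z + (2 * pi * of_int (fst k), 2 * pi * of_int (snd k)))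
      \<partial>count_space (UNIV :: (int \<times> int) set)) = 1"
proof -
  have 1: "(x + 2 * pi * of_int i \<in> {0..<2 * pi}) \<longleftrightarrow> i = - \<lfloor>x / (2 * pi)\<rfloor>" for x :: real and i :: int
  proof -
    have "(x + 2 * pi * of_int i \<in> {0..<2 * pi}) \<longleftrightarrow>
        of_int (- i) \<le> x / (2 * pi) \<and> x / (2 * pi) < of_int (- i) + 1"
      by (auto simp: field_simps)
    also have "\<dots> \<longleftrightarrow> \<lfloor>x / (2 * pi)\<rfloor> = - i"
      by (simp add: floor_eq_iff)
    finally show ?thesis by auto
  qed
  have "indicator half_open_cell (z + (2 * pi * of_int (fst k), 2 * pi * of_int (snd k))) =
      (indicator {(- \<lfloor>fst z / (2 * pi)\<rfloor>, - \<lfloor>snd z / (2 * pi)\<rfloor>)} k :: ennreal)" for k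
    using 1[of "fst z" "fst k"] 1[of "snd z" "snd k"]
    by (cases z; cases k) (auto simp: half_open_cell_def indicator_def)
  then show ?thesis by simp
qed

text \<open>The mean of a periodic function is translation invariant: cut the translated cell by the
  tiling and move each piece back into the cell.\<close>

lemma nn_integral_torus_shift:
  fixes F :: "real \<times> real \<Rightarrow> ennreal"
  assumes F [measurable]: "F \<in> borel_measurable lebesgue"
    and per: "\<And>x y. F (x + 2 * pi, y) = F (x, y) \<and> F (x, y + 2 * pi) = F (x, y)"
  shows "(\<integral>\<^sup>+z. F (z + w) \<partial>torus) = (\<integral>\<^sup>+z. F z \<partial>torus)"
proof -
  define P :: "int \<times> int \<Rightarrow> real \<times> real" where
    "P k = (2 * pi * of_int (fst k), 2 * pi * of_int (snd k))" for k
  define Q :: "real \<times> real \<Rightarrow> ennreal" where "Q = indicator half_open_cell"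
  have FP: "F (z - P k) = F z" for z k
    using periodic_int[OF per, of "fst z" "- fst k" "snd z" "- snd k"]
    by (cases z) (simp add: P_def)
  have tile: "(\<integral>\<^sup>+k. Q (z + P k) \<partial>count_space UNIV) = 1" for z
    using half_open_cell_tiling by (simp add: P_def Q_def)
  have tile': "(\<integral>\<^sup>+k. Q (z - P k) \<partial>count_space UNIV) = 1" for z
  proof -
    have "bij_betw (\<lambda>k. - k) (UNIV :: (int \<times> int) set) UNIV"
      by (rule bij_betw_byWitness[where f' = uminus]) auto
    then have "(\<integral>\<^sup>+k. Q (z + P (- k)) \<partial>count_space UNIV) = (\<integral>\<^sup>+k. Q (z + P k) \<partial>count_space UNIV)"
      by (rule nn_integral_bij_count_space)
    moreover have "P (- k) = - P k" for k by (simp add: P_def)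
    ultimately show ?thesis by (simp add: tile)
  qed
  have Qm [measurable]: "Q \<in> borel_measurable lebesgue" by (simp add: Q_def)
  have sh [measurable]: "G \<in> borel_measurable lebesgue \<Longrightarrow> (\<lambda>z. G (z + w)) \<in> borel_measurable lebesgue" 
    for G :: "real \<times> real \<Rightarrow> ennreal" and w
    by (rule measurable_compose[OF shift_measurable_lebesgue])
  have sh' [measurable]: "G \<in> borel_measurable lebesgue \<Longrightarrow> (\<lambda>z. G (z - w)) \<in> borel_measurable lebesgue" 
    for G :: "real \<times> real \<Rightarrow> ennreal" and w using sh[of G "- w"] by simp
  have "(\<integral>\<^sup>+z. F (z + w) \<partial>torus) = (\<integral>\<^sup>+z. F (z + w) * Q z \<partial>lebesgue)"
    by (simp add: nn_integral_torus_half_open Q_def)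
  also have "\<dots> = (\<integral>\<^sup>+z. F z * Q (z - w) \<partial>lebesgue)"
    using nn_integral_lebesgue_shift[of "\<lambda>z. F z * Q (z - w)" w] by simp
  also have "\<dots> = (\<integral>\<^sup>+z. (\<integral>\<^sup>+k. F z * Q (z - w) * Q (z + P k) \<partial>count_space UNIV) \<partial>lebesgue)"
    by (simp add: nn_integral_cmult tile)
  also have "\<dots> = (\<integral>\<^sup>+k. (\<integral>\<^sup>+z. F z * Q (z - w) * Q (z + P k) \<partial>lebesgue) \<partial>count_space UNIV)"
    by (rule nn_integral_count_space_nn_integral) (simp, measurable)
  also have "\<dots> = (\<integral>\<^sup>+k. (\<integral>\<^sup>+z. F z * Q z * Q (z - w - P k) \<partial>lebesgue) \<partial>count_space UNIV)"
  proof (rule nn_integral_cong)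
    fix k
    have "(\<integral>\<^sup>+z. F z * Q (z - w) * Q (z + P k) \<partial>lebesgue) =
        (\<integral>\<^sup>+z. F (z - P k) * Q (z - P k - w) * Q z \<partial>lebesgue)"
      using nn_integral_lebesgue_shift[of "\<lambda>z. F z * Q (z - w) * Q (z + P k)" "- P k"] by simp
    then show "(\<integral>\<^sup>+z. F z * Q (z - w) * Q (z + P k) \<partial>lebesgue) =
        (\<integral>\<^sup>+z. F z * Q z * Q (z - w - P k) \<partial>lebesgue)"
      by (simp add: FP algebra_simps)
  qed
  also have "\<dots> = (\<integral>\<^sup>+z. (\<integral>\<^sup>+k. F z * Q z * Q (z - w - P k) \<partial>count_space UNIV) \<partial>lebesgue)"
    by (rule nn_integral_count_space_nn_integral[symmetric]) (simp, measurable)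
  also have "\<dots> = (\<integral>\<^sup>+z. F z \<partial>torus)"
    by (simp add: nn_integral_cmult tile') (simp add: nn_integral_torus_half_open Q_def)
  finally show ?thesis .
qed

lemma torus_char_shift: "torus_char m n (z + w) = torus_char m n z * torus_char m n w"
  by (simp add: torus_char_def cis_mult algebra_simps)

lemma norm_torus_char [simp]: "norm (torus_char m n z) = 1"
  by (simp add: torus_char_def)

lemma torus_char_mult: "torus_char m n z * torus_char k l z = torus_char (m + k) (n + l) z"
  by (simp add: torus_char_def cis_mult algebra_simps)

lemma cnj_torus_char: "cnj (torus_char m n z) = torus_char (- m) (- n) z"
  by (simp add: torus_char_def cis_cnj)

lemma continuous_torus_char: "continuous_on A (torus_char m n)"
  unfolding torus_char_def cis_conv_exp by (intro continuous_intros)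

lemma measurable_torus_char [measurable]: "torus_char m n \<in> borel_measurable lebesgue"
  by (intro continuous_borel_measurable_lebesgue continuous_torus_char)

lemma biperiodic_torus_char: "biperiodic (torus_char m n)"
proof -
  have "cis (a + 2 * pi * of_int k) = cis a" for a k
    by (simp add: cis_multiple_2pi flip: cis_mult)
  from this[of "of_int m * x + of_int n * y" m for x y] this[of "of_int m * x + of_int n * y" n for x y]
  show ?thesis by (simp add: biperiodic_def torus_char_def algebra_simps)
qed

lemma biperiodicD: "biperiodic F \<Longrightarrow> F (x + 2 * pi, y) = F (x, y)" "biperiodic F \<Longrightarrow> F (x, y + 2 * pi) = F (x, y)"
  by (auto simp: biperiodic_def)

lemma biperiodic_mult: "biperiodic F \<Longrightarrow> biperiodic G \<Longrightarrow> biperiodic (\<lambda>z. F z * G z)"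
  by (simp add: biperiodic_def)

lemma biperiodic_shift: "biperiodic F \<Longrightarrow> biperiodic (\<lambda>z. F (z + w))"
proof (cases w)
  case (Pair a b)
  assume F: "biperiodic F"
  show ?thesis unfolding biperiodic_def 
    using biperiodicD[OF F, of "_ + a" "_ + b"] Pair by (simp add: algebra_simps)
qed

lemma measurable_shift:
  assumes "F \<in> borel_measurable lebesgue"
  shows "(\<lambda>z. F (z + w)) \<in> borel_measurable lebesgue"
  by (rule measurable_compose[OF shift_measurable_lebesgue assms])

lemma integral_complex_parts:
  fixes F :: "'a \<Rightarrow> complex"
  assumes "integrable M F"
  shows "(LINT z|M. F z) = Complex
     (enn2real (\<integral>\<^sup>+z. ennreal (Re (F z)) \<partial>M) - enn2real (\<integral>\<^sup>+z. ennreal (- Re (F z)) \<partial>M))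
     (enn2real (\<integral>\<^sup>+z. ennreal (Im (F z)) \<partial>M) - enn2real (\<integral>\<^sup>+z. ennreal (- Im (F z)) \<partial>M))"
  using assms by (simp add: complex_eq_iff flip: real_lebesgue_integral_def)

lemma integral_torus_shift:
  assumes F [measurable]: "F \<in> borel_measurable lebesgue" and per: "biperiodic F"
    and int: "integrable torus F"
  shows "integrable torus (\<lambda>z. F (z + w))" "(LINT z|torus. F (z + w)) = (LINT z|torus. F z)"
proof -
  have [measurable]: "(\<lambda>z. F (z + w)) \<in> borel_measurable lebesgue"
    by (rule measurable_shift) fact
  have sh: "(\<integral>\<^sup>+z. ennreal (h (F (z + w))) \<partial>torus) = (\<integral>\<^sup>+z. ennreal (h (F z)) \<partial>torus)"
    if [measurable]: "h \<in> borel_measurable borel" for h :: "complex \<Rightarrow> real"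
    by (rule nn_integral_torus_shift[where F = "\<lambda>z. ennreal (h (F z))"]) 
       (simp_all add: biperiodicD[OF per])
  show 1: "integrable torus (\<lambda>z. F (z + w))"
  proof (rule integrableI_bounded)
    show "(\<integral>\<^sup>+z. ennreal (norm (F (z + w))) \<partial>torus) < \<infinity>"
      using int sh[of norm] by (simp add: integrable_iff_bounded)
  qed measurable
  show "(LINT z|torus. F (z + w)) = (LINT z|torus. F z)"
    unfolding integral_complex_parts[OF 1] integral_complex_parts[OF int]
    using sh[of Re] sh[of Im] sh[of "\<lambda>z. - Re z"] sh[of "\<lambda>z. - Im z"] by simp
qed

lemma integrable_torus_bounded:
  fixes F :: "real \<times> real \<Rightarrow> 'a::{banach, second_countable_topology}"
  assumes "F \<in> borel_measurable torus" "\<And>z. norm (F z) \<le> B"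
  shows "integrable torus F"
  by (rule finite_measure.integrable_const_bound[OF finite_measure_torus, of F B]) (use assms in auto)

lemma integrable_torus_char: "integrable torus (torus_char m n)"
  by (rule integrable_torus_bounded[where B = 1]) auto

text \<open>Translation invariance alone shows that a nontrivial character integrates to zero.\<close>

lemma integral_torus_char:
  "(LINT z|torus. torus_char m n z) = (if m = 0 \<and> n = 0 then 4 * pi\<^sup>2 else 0)"
proof (cases "m = 0 \<and> n = 0")
  case True
  then show ?thesis
    using measure_torus_cell by (simp add: torus_char_def measure_restrict_space scaleR_conv_of_real)
next
  case False
  \<comment> \<open>A translation under which the character changes sign.\<close>
  define w where "w = (if m \<noteq> 0 then (pi / of_int m, 0) else (0, pi / of_int n))"
  have w: "torus_char m n w = - 1"
    using False by (auto simp: torus_char_def w_def)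
  have "(LINT z|torus. torus_char m n z) = (LINT z|torus. torus_char m n (z + w))"
    by (rule integral_torus_shift(2)[symmetric]) 
      (auto intro: integrable_torus_char biperiodic_torus_char)
  also have "\<dots> = - (LINT z|torus. torus_char m n z)"
    by (simp add: torus_char_shift w)
  finally show ?thesis using False by (simp add: eq_neg_iff_add_eq_0 flip: mult_2)
qed

lemma fourier_coeff_eq:
  "fourier_coeff f m n = (LINT z|torus. f z * torus_char (- m) (- n) z) / (4 * pi\<^sup>2)"
  by (simp add: fourier_coeff_def torus_char_def case_prod_beta')


section \<open>Uniqueness of Fourier coefficients\<close>

text \<open>Trigonometric polynomials on the torus: finite linear combinations of characters.\<close>

inductive_set trig_polys :: "(real \<times> real \<Rightarrow> complex) set" where
  trig_monom: "(\<lambda>z. c * torus_char m n z) \<in> trig_polys"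
| trig_add: "F \<in> trig_polys \<Longrightarrow> G \<in> trig_polys \<Longrightarrow> (\<lambda>z. F z + G z) \<in> trig_polys"

lemma trig_polys_mult:
  assumes "F \<in> trig_polys" "G \<in> trig_polys"
  shows "(\<lambda>z. F z * G z) \<in> trig_polys"
  using assms
proof (induction)
  case (trig_monom c m n)
  then show ?case
  proof (induction)
    case (trig_monom d k l)
    then show ?case
      using trig_polys.trig_monom[of "c * d" "m + k" "n + l"]
      by (simp add: mult_ac flip: torus_char_mult)
  next
    case (trig_add F G)
    then show ?case using trig_polys.trig_add[OF trig_add.IH] by (simp add: distrib_left)
  qed
next
  case (trig_add F H)
  then show ?case
    using trig_polys.trig_add[OF trig_add.IH] by (simp add: distrib_right)
qed

text \<open>The real-valued trigonometric polynomials seen as functions on the product of two unit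
  circles, to which the Stone--Weierstrass theorem applies. Their values off the two circles are
  immaterial, except that the functions are required to be continuous everywhere.\<close>

definition circle_trig_polys :: "(complex \<times> complex \<Rightarrow> real) set" where
  "circle_trig_polys = {\<phi>. continuous_on UNIV \<phi> \<and>
     (\<lambda>z. complex_of_real (\<phi> (cis (fst z), cis (snd z)))) \<in> trig_polys}"

lemma circle_trig_polys_coordinates:
  "(\<lambda>z. Re (fst z)) \<in> circle_trig_polys" "(\<lambda>z. Im (fst z)) \<in> circle_trig_polys"
  "(\<lambda>z. Re (snd z)) \<in> circle_trig_polys" "(\<lambda>z. Im (snd z)) \<in> circle_trig_polys"
proof -
  have Re: "complex_of_real (cos x) = 1 / 2 * cis x + 1 / 2 * cis (- x)" for x
    by (simp add: complex_eq_iff)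
  have Im: "complex_of_real (sin x) = (- \<i> / 2) * cis x + (\<i> / 2) * cis (- x)" for x
    by (simp add: complex_eq_iff)
  note T = trig_add[OF trig_monom trig_monom]
  show "(\<lambda>z. Re (fst z)) \<in> circle_trig_polys"
    using T[of "1/2" 1 0 "1/2" "-1" 0]
    by (auto simp: circle_trig_polys_def Re torus_char_def intro!: continuous_intros)
  show "(\<lambda>z. Im (fst z)) \<in> circle_trig_polys"
    using T[of "- \<i> / 2" 1 0 "\<i> / 2" "-1" 0]
    by (auto simp: circle_trig_polys_def Im torus_char_def intro!: continuous_intros)
  show "(\<lambda>z. Re (snd z)) \<in> circle_trig_polys"
    using T[of "1/2" 0 1 "1/2" 0 "-1"]
    by (auto simp: circle_trig_polys_def Re torus_char_def intro!: continuous_intros)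
  show "(\<lambda>z. Im (snd z)) \<in> circle_trig_polys"
    using T[of "- \<i> / 2" 0 1 "\<i> / 2" 0 "-1"]
    by (auto simp: circle_trig_polys_def Im torus_char_def intro!: continuous_intros)
qed

lemma function_ring_circle_trig_polys:
  "function_ring_on circle_trig_polys (sphere 0 1 \<times> sphere 0 1)"
proof
  show "compact (sphere 0 1 \<times> sphere 0 1 :: (complex \<times> complex) set)"
    by (intro compact_Times compact_sphere)
next
  fix f :: "complex \<times> complex \<Rightarrow> real" assume "f \<in> circle_trig_polys"
  then show "continuous_on (sphere 0 1 \<times> sphere 0 1) f"
    by (auto simp: circle_trig_polys_def intro: continuous_on_subset)
next
  fix f g :: "complex \<times> complex \<Rightarrow> real" assume "f \<in> circle_trig_polys" "g \<in> circle_trig_polys"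
  then show "(\<lambda>x. f x + g x) \<in> circle_trig_polys" "(\<lambda>x. f x * g x) \<in> circle_trig_polys"
    by (auto simp: circle_trig_polys_def intro!: continuous_intros dest: trig_add trig_polys_mult)
next
  fix c :: real
  show "(\<lambda>_. c) \<in> circle_trig_polys"
    using trig_monom[of c 0 0] by (auto simp: circle_trig_polys_def torus_char_def)
next
  fix x y :: "complex \<times> complex" assume "x \<noteq> y"
  then have "Re (fst x) \<noteq> Re (fst y) \<or> Im (fst x) \<noteq> Im (fst y) \<or>
      Re (snd x) \<noteq> Re (snd y) \<or> Im (snd x) \<noteq> Im (snd y)"
    by (auto simp: prod_eq_iff complex_eq_iff)
  then show "\<exists>f\<in>circle_trig_polys. f x \<noteq> f y"
    by (elim disjE) (rule bexI[OF _ circle_trig_polys_coordinates(1)], assumption,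
      rule bexI[OF _ circle_trig_polys_coordinates(2)], assumption,
      rule bexI[OF _ circle_trig_polys_coordinates(3)], assumption,
      rule bexI[OF _ circle_trig_polys_coordinates(4)], assumption)
qed

lemma trig_polys_orthogonal:
  assumes u: "integrable torus u" and zero: "\<And>m n. fourier_coeff u m n = 0"
    and "T \<in> trig_polys"
  shows "integrable torus (\<lambda>z. u z * T z) \<and> (LINT z|torus. u z * T z) = 0"
  using assms(3)
proof induction
  case (trig_monom c m n)
  have "integrable torus (\<lambda>z. u z * torus_char m n z)"
    by (rule Bochner_Integration.integrable_bound[OF u]) (use u in \<open>auto simp: norm_mult\<close>)
  moreover have "(LINT z|torus. u z * torus_char m n z) = 0"
    using zero[of "- m" "- n"] by (simp add: fourier_coeff_eq)
  ultimately show ?case by (simp add: mult.left_commute)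
next
  case (trig_add F G)
  then show ?case by (simp add: distrib_left)
qed

lemma continuous_on_circles_orthogonal:
  fixes \<phi> :: "complex \<times> complex \<Rightarrow> real"
  assumes u: "integrable torus u" and zero: "\<And>m n. fourier_coeff u m n = 0"
    and \<phi>: "continuous_on UNIV \<phi>"
  shows "(LINT z|torus. u z * of_real (\<phi> (cis (fst z), cis (snd z)))) = 0"
proof -
  interpret function_ring_on circle_trig_polys "sphere 0 1 \<times> sphere 0 1"
    by (rule function_ring_circle_trig_polys)
  have um [measurable]: "u \<in> borel_measurable torus" using u by simp
  have cisc: "continuous_on UNIV (\<lambda>z::real \<times> real. (cis (fst z), cis (snd z)))"
    unfolding cis_conv_exp by (intro continuous_intros)
  let ?J = "\<lambda>\<psi> :: complex \<times> complex \<Rightarrow> real. \<lambda>z. of_real (\<psi> (cis (fst z), cis (snd z))) :: complex"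
  have meas: "?J \<psi> \<in> borel_measurable torus" if "continuous_on UNIV \<psi>" for \<psi>
    by (intro measurable_torus continuous_borel_measurable_lebesgue continuous_intros
          continuous_on_compose2[OF that cisc]) auto
  have *: "norm (LINT z|torus. u z * ?J \<phi> z) \<le> e * (LINT z|torus. norm (u z))" if e: "e > 0" for e
  proof -
    obtain g where g: "g \<in> circle_trig_polys"
      and close: "\<And>x. x \<in> sphere 0 1 \<times> sphere 0 1 \<Longrightarrow> \<bar>\<phi> x - g x\<bar> < e"
      using Stone_Weierstrass_basic[OF continuous_on_subset[OF \<phi>] e] by auto
    have gc: "continuous_on UNIV g" using g by (simp add: circle_trig_polys_def)
    have g0: "integrable torus (\<lambda>z. u z * ?J g z)" "(LINT z|torus. u z * ?J g z) = 0"
      using trig_polys_orthogonal[OF u zero, of "?J g"] g by (auto simp: circle_trig_polys_def)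
    have b: "norm (u z * ?J \<phi> z - u z * ?J g z) \<le> e * norm (u z)" for z
    proof -
      have "norm (u z * ?J \<phi> z - u z * ?J g z) = 
          norm (u z) * \<bar>\<phi> (cis (fst z), cis (snd z)) - g (cis (fst z), cis (snd z))\<bar>"
        by (metis norm_mult norm_of_real of_real_diff right_diff_distrib)
      also have "\<dots> \<le> norm (u z) * e"
        by (intro mult_left_mono less_imp_le[OF close]) auto
      finally show ?thesis by (simp add: mult.commute)
    qed
    have d: "integrable torus (\<lambda>z. u z * ?J \<phi> z - u z * ?J g z)"
      by (rule Bochner_Integration.integrable_bound[where f = "\<lambda>z. e * norm (u z)"])
        (use u b e meas[OF \<phi>] meas[OF gc] in auto)
    have "integrable torus (\<lambda>z. u z * ?J \<phi> z)"
      using Bochner_Integration.integrable_add[OF d g0(1)] by simp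
    then have "(LINT z|torus. u z * ?J \<phi> z) = (LINT z|torus. u z * ?J \<phi> z - u z * ?J g z)"
      using g0 by simp
    also have "norm \<dots> \<le> (LINT z|torus. norm (u z * ?J \<phi> z - u z * ?J g z))"
      by (rule integral_norm_bound)
    also have "\<dots> \<le> (LINT z|torus. e * norm (u z))"
      by (rule integral_mono) (use d u b in auto)
    finally show ?thesis by simp
  qed
  have "norm (LINT z|torus. u z * ?J \<phi> z) \<le> 0"
  proof (rule field_le_epsilon)
    fix e :: real assume e: "e > 0"
    define K where "K = (LINT z|torus. norm (u z))"
    have K: "K \<ge> 0" by (simp add: K_def)
    have "norm (LINT z|torus. u z * ?J \<phi> z) \<le> e / (K + 1) * K"
      unfolding K_def[symmetric] by (rule *[of "e / (K + 1)", folded K_def]) (use e K in simp)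
    also have "\<dots> \<le> e" using e K by (simp add: field_simps)
    finally show "norm (LINT z|torus. u z * ?J \<phi> z) \<le> 0 + e" by simp
  qed
  then show ?thesis by simp
qed

text \<open>The indicator of an open set is the pointwise limit of the continuous functions
  \<open>min 1 (n * infdist x (- U))\<close>.\<close>

lemma open_on_circles_orthogonal:
  fixes U :: "(complex \<times> complex) set"
  assumes u: "integrable torus u" and zero: "\<And>m n. fourier_coeff u m n = 0"
    and U: "open U" "U \<noteq> UNIV"
  shows "(LINT z|torus. u z * indicator U (cis (fst z), cis (snd z))) = 0"
proof -
  define \<phi> where "\<phi> n x = min 1 (real n * infdist x (- U))" for n x
  have \<phi>c: "continuous_on UNIV (\<phi> n)" for n
    unfolding \<phi>_def by (intro continuous_intros)
  have \<phi>lim: "(\<lambda>n. \<phi> n x) \<longlonglongrightarrow> indicator U x" for x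
  proof (cases "x \<in> U")
    case True
    have "infdist x (- U) > 0"
      using True U by (intro infdist_pos_not_in_closed) auto
    then obtain N where N: "real N * infdist x (- U) > 1"
      using reals_Archimedean3 by blast
    have "\<phi> n x = 1" if "n \<ge> N" for n
    proof -
      have "real N * infdist x (- U) \<le> real n * infdist x (- U)"
        using that by (intro mult_right_mono) (auto simp: infdist_nonneg)
      then show ?thesis using N by (simp add: \<phi>_def)
    qed
    then have "\<forall>\<^sub>F n in sequentially. \<phi> n x = 1"
      by (auto simp: eventually_sequentially)
    then show ?thesis using True by (simp add: tendsto_eventually)
  next
    case False
    then show ?thesis by (simp add: \<phi>_def)
  qed
  have cisc: "continuous_on UNIV (\<lambda>z::real \<times> real. (cis (fst z), cis (snd z)))"
    unfolding cis_conv_exp by (intro continuous_intros)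
  have \<phi>m: "(\<lambda>z. complex_of_real (\<phi> n (cis (fst z), cis (snd z)))) \<in> borel_measurable torus" for n
    by (intro measurable_torus continuous_borel_measurable_lebesgue continuous_intros
          continuous_on_compose2[OF \<phi>c cisc]) auto
  have \<phi>b: "\<bar>\<phi> n x\<bar> \<le> 1" for n x
  proof -
    have "0 \<le> real n * infdist x (- U)" by (simp add: infdist_nonneg)
    then show ?thesis unfolding \<phi>_def by (auto simp: abs_if)
  qed
  have [measurable]: "u \<in> borel_measurable torus" using u by simp
  have "(\<lambda>n. (LINT z|torus. u z * of_real (\<phi> n (cis (fst z), cis (snd z)))))
     \<longlonglongrightarrow> (LINT z|torus. u z * of_real (indicator U (cis (fst z), cis (snd z))))"
  proof (rule integral_dominated_convergence[where w = "\<lambda>z. norm (u z)"])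
    show lim: "AE z in torus. (\<lambda>n. u z * of_real (\<phi> n (cis (fst z), cis (snd z))))
        \<longlonglongrightarrow> u z * of_real (indicator U (cis (fst z), cis (snd z)))"
      by (intro AE_I2 tendsto_intros \<phi>lim)
    show "(\<lambda>z. u z * of_real (indicator U (cis (fst z), cis (snd z)))) \<in> borel_measurable torus"
      by (rule borel_measurable_LIMSEQ_metric[OF _ tendsto_mult[OF tendsto_const tendsto_of_real[OF \<phi>lim]]])
        (use \<phi>m in measurable)
    show "AE z in torus. norm (u z * of_real (\<phi> n (cis (fst z), cis (snd z)))) \<le> norm (u z)" for n
      using \<phi>b by (auto simp: norm_mult mult_left_le)
  qed (use u \<phi>m in auto)
  then have "(\<lambda>n. 0) \<longlonglongrightarrow> (LINT z|torus. u z * of_real (indicator U (cis (fst z), cis (snd z))))"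
    by (simp add: continuous_on_circles_orthogonal[OF u zero \<phi>c])
  then show ?thesis
    using LIMSEQ_unique[OF tendsto_const] by (fastforce simp: of_real_indicator)
qed

text \<open>An open rectangle in the period cell corresponds to an open subset of the product of two
  circles, by means of the argument function, which is continuous off the nonnegative reals.\<close>

lemma box_orthogonal:
  assumes u: "integrable torus u" and zero: "\<And>m n. fourier_coeff u m n = 0"
    and ab: "0 \<le> a" "b \<le> 2 * pi" "0 \<le> c" "d \<le> 2 * pi"
  shows "(LINT z|torus. u z * indicator ({a<..<b} \<times> {c<..<d}) z) = 0"
proof -
  define S :: "complex set" where "S = UNIV - \<real>\<^sub>\<ge>\<^sub>0"
  have So: "open S" unfolding S_def using closed_nonneg_Reals_complex by blast
  have cA: "continuous_on S Arg2pi"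
    unfolding S_def by (intro continuous_at_imp_continuous_on ballI continuous_at_Arg2pi) auto
  define V where "V a b = S \<inter> Arg2pi -` {a<..<b}" for a b
  have Vo: "open (V a b)" for a b
    unfolding V_def by (rule continuous_open_preimage[OF cA So]) auto
  have V: "cis x \<in> V a b \<longleftrightarrow> x \<in> {a<..<b}" if x: "x \<in> {0..2 * pi}" and "0 \<le> a" "b \<le> 2 * pi" for x a b
  proof (cases "0 < x \<and> x < 2 * pi")
    case True
    then have "Arg2pi (cis x) = x"
      by (intro Arg2pi_unique[of 1]) (auto simp: cis_conv_exp)
    moreover have "cis x \<in> S"
      using True \<open>Arg2pi (cis x) = x\<close> Arg2pi_eq_0 [of "cis x"] by (auto simp: S_def complex_nonneg_Reals_iff complex_is_Real_iff)
    ultimately show ?thesis by (auto simp: V_def)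
  next
    case False
    then have "x = 0 \<or> x = 2 * pi" using x by auto
    then have "cis x = 1" by auto
    moreover have "(1::complex) \<notin> S" by (simp add: S_def)
    ultimately show ?thesis using False that by (auto simp: V_def)
  qed
  have "(LINT z|torus. u z * indicator (V a b \<times> V c d) (cis (fst z), cis (snd z))) = 0"
  proof (rule open_on_circles_orthogonal[OF u zero])
    show "open (V a b \<times> V c d)" by (intro open_Times Vo)
    have "(1, 1) \<notin> V a b \<times> V c d" by (simp add: V_def S_def)
    then show "V a b \<times> V c d \<noteq> UNIV" by blast
  qed
  also have "(LINT z|torus. u z * indicator (V a b \<times> V c d) (cis (fst z), cis (snd z))) =
      (LINT z|torus. u z * indicator ({a<..<b} \<times> {c<..<d}) z)"
    using V ab by (intro Bochner_Integration.integral_cong) (auto simp: torus_cell_def indicator_def)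
  finally show ?thesis .
qed

text \<open>By Lebesgue differentiation, a function whose integrals over all small squares vanish is zero
  almost everywhere.\<close>

theorem fourier_uniqueness:
  assumes u: "integrable torus u" and zero: "\<And>m n. fourier_coeff u m n = 0"
  shows "AE z in torus. u z = 0"
proof -
  define v where "v z = indicator torus_cell z *\<^sub>R u z" for z
  have v: "integrable lebesgue v"
    using u unfolding v_def by (subst (asm) integrable_restrict_space) auto
  have vs: "integrable (lebesgue_on S) v" if "S \<in> sets lebesgue" for S
    using integrable_restrict_UNIV v that integrable_mult_indicator[OF that v]
    by (simp add: integrable_restrict_space)
  have vhk: "v integrable_on cbox a b" for a b
    using integrable_on_lebesgue_on[OF vs] by simp
  obtain N where N: "negligible N"
    and NB: "\<And>x e. \<lbrakk>x \<notin> N; 0 < e\<rbrakk> \<Longrightarrow> \<exists>d>0. \<forall>h. 0 < h \<and> h < d \<longrightarrow>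
       norm(integral (cbox x (x + h *\<^sub>R One)) v /\<^sub>R h ^ DIM(real \<times> real) - v x) < e"
    using integrable_ccontinuous_explicit[OF vhk] by blast
  have v0: "integral (cbox x (x + h *\<^sub>R One)) v = 0"
    if x: "x \<in> box (0,0) (2*pi, 2*pi)" and h: "h > 0" "fst x + h < 2 * pi" "snd x + h < 2 * pi" for x h
  proof -
    obtain s t where st: "x = (s, t)" by force
    have one: "x + h *\<^sub>R One = (s + h, t + h)" by (simp add: st sum_Basis_prod_eq)
    have x': "0 < s" "0 < t" using x by (auto simp: st box_def Basis_prod_def)
    have "integral (cbox x (x + h *\<^sub>R One)) v = (LINT z|lebesgue_on (cbox x (x + h *\<^sub>R One)). v z)"
      by (rule lebesgue_integral_eq_integral[symmetric]) (auto intro: vs)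
    also have "\<dots> = (LINT z|lebesgue. indicator (cbox x (x + h *\<^sub>R One)) z *\<^sub>R v z)"
      by (subst integral_restrict_space) auto
    also have "\<dots> = (LINT z|lebesgue. indicator (box x (x + h *\<^sub>R One)) z *\<^sub>R v z)"
    proof (rule integral_cong_AE)
      have "AE z in lebesgue. z \<notin> cbox x (x + h *\<^sub>R One) - box x (x + h *\<^sub>R One)"
        by (metis AE_not_in negligible_iff_null_sets negligible_frontier_interval)
      then show "AE z in lebesgue. indicator (cbox x (x + h *\<^sub>R One)) z *\<^sub>R v z =
          indicator (box x (x + h *\<^sub>R One)) z *\<^sub>R v z"
        using box_subset_cbox[of x "x + h *\<^sub>R One"] by (auto elim!: eventually_mono simp: indicator_def)
    qed (use borel_measurable_integrable[OF v] in
        \<open>auto intro!: borel_measurable_scaleR borel_measurable_indicator\<close>)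
    also have "\<dots> = (LINT z|lebesgue. indicator torus_cell z *\<^sub>R (u z * indicator ({s<..<s+h} \<times> {t<..<t+h}) z))"
      unfolding one unfolding st
      by (intro Bochner_Integration.integral_cong refl)
        (auto simp: v_def box_def Basis_prod_def indicator_def)
    also have "\<dots> = (LINT z|torus. u z * indicator ({s<..<s+h} \<times> {t<..<t+h}) z)"
      by (subst integral_restrict_space) auto
    also have "\<dots> = 0"
      by (rule box_orthogonal[OF u zero]) (use x' h st in auto)
    finally show ?thesis .
  qed
  have "v x = 0" if x: "x \<in> box (0,0) (2*pi, 2*pi)" "x \<notin> N" for x
  proof (rule ccontr)
    assume "v x \<noteq> 0"
    then obtain d where d: "d > 0" "\<And>h. 0 < h \<Longrightarrow> h < d \<Longrightarrow>
       norm(integral (cbox x (x + h *\<^sub>R One)) v /\<^sub>R h ^ DIM(real \<times> real) - v x) < norm (v x)"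
      using NB[OF x(2), of "norm (v x)"] by auto
    \<comment> \<open>A square at \<open>x\<close> small enough for the differentiation theorem and contained in the cell.\<close>
    define h where "h = min d (min (2 * pi - fst x) (2 * pi - snd x)) / 2"
    have "fst x < 2 * pi" "snd x < 2 * pi" using x by (cases x; auto simp: box_def Basis_prod_def)+
    then have "h > 0" "h < d" "fst x + h < 2 * pi" "snd x + h < 2 * pi"
      using d(1) by (auto simp: h_def min_def field_simps)
    then show False using d(2)[of h] v0[OF x(1), of h] by simp
  qed
  then have "AE z in lebesgue. z \<in> torus_cell \<longrightarrow> z \<notin> N \<longrightarrow> z \<notin> torus_cell - box (0,0) (2*pi, 2*pi) \<longrightarrow> u z = 0"
  proof (intro AE_I2 impI)
    fix z assume z: "z \<in> torus_cell" "z \<notin> N" "z \<notin> torus_cell - box (0,0) (2*pi, 2*pi)"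
    then have "v z = 0" using \<open>\<And>x. x \<in> box (0,0) (2*pi, 2*pi) \<Longrightarrow> x \<notin> N \<Longrightarrow> v x = 0\<close>[of z] by blast
    then show "u z = 0" using z by (simp add: v_def)
  qed
  moreover have "AE z in lebesgue. z \<notin> N" "AE z in lebesgue. z \<notin> torus_cell - box (0,0) (2*pi, 2*pi)"
    using N negligible_frontier_interval unfolding torus_cell_eq_cbox
    by (metis AE_not_in negligible_iff_null_sets)+
  ultimately have "AE z in lebesgue. z \<in> torus_cell \<longrightarrow> u z = 0"
    by eventually_elim auto
  then show ?thesis by (subst AE_restrict_space_iff) auto
qed


section \<open>Lacunary trigonometric polynomials\<close>

text \<open>The representations of \<open>n\<close> as an ordered sum of \<open>m\<close> powers of two, given by the lists of exponents.\<close>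

definition power2_tuples :: "nat \<Rightarrow> nat \<Rightarrow> nat list set" where
  "power2_tuples m n = {l. length l = m \<and> (\<Sum>i\<leftarrow>l. 2 ^ i) = n}"

lemma large_power2_in_tuple:
  assumes "l \<in> power2_tuples (Suc m) n"
  shows "\<exists>j\<in>set l. n \<le> Suc m * 2 ^ j"
proof (rule ccontr)
  have *: "k * (\<Sum>i\<leftarrow>l. 2 ^ i) < length l * n" if "l \<noteq> []" "\<forall>j\<in>set l. k * 2 ^ j < n" for k :: nat and l
    using that
  proof (induction l)
    case (Cons a l)
    show ?case
    proof (cases "l = []")
      case False
      then have "k * (\<Sum>i\<leftarrow>l. 2 ^ i) < length l * n" using Cons by auto
      moreover have "k * 2 ^ a < n" using Cons.prems by simp
      ultimately show ?thesis by (simp add: distrib_left)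
    qed (use Cons.prems in simp)
  qed simp
  assume "\<not> (\<exists>j\<in>set l. n \<le> Suc m * 2 ^ j)"
  then have "Suc m * (\<Sum>i\<leftarrow>l. 2 ^ i) < length l * n"
    using assms by (intro *) (auto simp: power2_tuples_def not_le)
  then show False using assms by (simp add: power2_tuples_def)
qed

text \<open>A number has a bounded number of representations as an ordered sum of \<open>m\<close> powers of two:
  the largest summand is at least \<open>n / m\<close>, which leaves boundedly many choices for it.\<close>

lemma card_power2_tuples_le:
  "\<exists>C. \<forall>n. finite (power2_tuples m n) \<and> card (power2_tuples m n) \<le> C"
proof (induction m)
  case 0
  have "power2_tuples 0 n \<subseteq> {[]}" for n by (auto simp: power2_tuples_def)
  then have "finite (power2_tuples 0 n) \<and> card (power2_tuples 0 n) \<le> 1" for n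
    using card_mono[of "{[]}" "power2_tuples 0 n"] finite_subset[of "power2_tuples 0 n" "{[]}"] by auto
  then show ?case by blast
next
  case (Suc m)
  then obtain C where C: "\<And>n. finite (power2_tuples m n)" "\<And>n. card (power2_tuples m n) \<le> C" by blast
  have "finite (power2_tuples (Suc m) n) \<and> card (power2_tuples (Suc m) n) \<le> Suc m * (Suc m * C)" for n
  proof -
    define J where "J = {j. 2 ^ j \<le> n \<and> n \<le> Suc m * 2 ^ j}"
    define X where "X = (\<Union>i\<in>{..m}. \<Union>j\<in>J. (\<lambda>l. take i l @ j # drop i l) ` power2_tuples m (n - 2 ^ j))"
    have "j < n" if "j \<in> J" for j using that less_le_trans[OF less_exp, of j n] by (simp add: J_def)
    then have finJ: "finite J" by (meson finite_nat_iff_bounded lessThan_iff subsetI)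
    have cardJ: "card J \<le> Suc m"
    proof (cases "J = {}")
      case False
      define j0 where "j0 = Min J"
      have j0: "j0 \<in> J" "\<And>j. j \<in> J \<Longrightarrow> j0 \<le> j" using False finJ by (auto simp: j0_def)
      have "J \<subseteq> {j0..<j0 + Suc m}"
      proof
        fix j assume j: "j \<in> J"
        have "2 ^ (j - j0) * 2 ^ j0 = (2::nat) ^ j" using j0(2)[OF j] by (simp flip: power_add)
        also have "\<dots> \<le> Suc m * 2 ^ j0" using j j0(1) by (simp add: J_def)
        finally have "2 ^ (j - j0) \<le> Suc m" by (simp only: mult_le_cancel2) simp
        then have "j - j0 < Suc m" using less_exp[of "j - j0"] by linarith
        then show "j \<in> {j0..<j0 + Suc m}" using j0(2)[OF j] by auto
      qed
      then show ?thesis using card_mono[of "{j0..<j0 + Suc m}" J] by simp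
    qed simp
    have finX: "finite X" unfolding X_def using finJ C(1) by auto
    have "card X \<le> (\<Sum>i\<in>{..m}. \<Sum>j\<in>J. C)"
      unfolding X_def
      by (intro card_UN_le[THEN order_trans] sum_mono finJ finite_atMost
          card_image_le[OF C(1), THEN order_trans] C(2))
    also have "\<dots> \<le> Suc m * (Suc m * C)"
      using mult_le_mono2[OF mult_le_mono1[OF cardJ, of C], of "Suc m"] by simp
    finally have cardX: "card X \<le> Suc m * (Suc m * C)" .
    have sub: "power2_tuples (Suc m) n \<subseteq> X"
    proof
      fix l assume l: "l \<in> power2_tuples (Suc m) n"
      then obtain j where j: "j \<in> set l" "n \<le> Suc m * 2 ^ j" using large_power2_in_tuple by blast
      then obtain xs ys where xs: "l = xs @ j # ys" by (meson split_list)
      have len: "length (xs @ ys) = m" and n: "n = (\<Sum>i\<leftarrow>xs. 2 ^ i) + 2 ^ j + (\<Sum>i\<leftarrow>ys. 2 ^ i)" 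
        using l xs by (auto simp: power2_tuples_def)
      have "l = take (length xs) (xs @ ys) @ j # drop (length xs) (xs @ ys)" using xs by simp
      moreover have "xs @ ys \<in> power2_tuples m (n - 2 ^ j)" using len n by (simp add: power2_tuples_def)
      moreover have "j \<in> J" using j n by (simp add: J_def)
      moreover have "length xs \<in> {..m}" using len by simp
      ultimately show "l \<in> X" unfolding X_def by blast
    qed
    show ?thesis using finite_subset[OF sub finX] card_mono[OF finX sub] cardX by linarith
  qed
  then show ?case by blast
qed

lemma card_power2_pair_tuples_le:
  "\<exists>C. \<forall>n k. finite {l :: (nat \<times> nat) list. map fst l \<in> power2_tuples m n \<and> map snd l \<in> power2_tuples m k} \<and>
     card {l :: (nat \<times> nat) list. map fst l \<in> power2_tuples m n \<and> map snd l \<in> power2_tuples m k} \<le> C"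
proof -
  obtain C where C: "\<And>n. finite (power2_tuples m n)" "\<And>n. card (power2_tuples m n) \<le> C"
    using card_power2_tuples_le by blast
  have "finite {l :: (nat \<times> nat) list. map fst l \<in> power2_tuples m n \<and> map snd l \<in> power2_tuples m k} \<and>
     card {l :: (nat \<times> nat) list. map fst l \<in> power2_tuples m n \<and> map snd l \<in> power2_tuples m k} \<le> C * C" 
    (is "finite ?X \<and> _") for n k
  proof -
    have inj: "inj_on (\<lambda>l. (map fst l, map snd l)) ?X"
      by (rule inj_onI) (metis Pair_inject zip_map_fst_snd)
    have sub: "(\<lambda>l. (map fst l, map snd l)) ` ?X \<subseteq> power2_tuples m n \<times> power2_tuples m k" by auto
    have "card ?X \<le> card (power2_tuples m n \<times> power2_tuples m k)"
      by (rule card_inj_on_le[OF inj sub]) (simp add: C)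
    also have "\<dots> \<le> C * C" by (simp add: card_cartesian_product C mult_mono)
    finally show ?thesis using inj_on_finite[OF inj sub] C by simp
  qed
  then show ?thesis by blast
qed

lemma sum_power_lists:
  fixes x :: "'a \<Rightarrow> 'b::comm_semiring_1"
  assumes "finite A"
  shows "(\<Sum>a\<in>A. x a) ^ m = (\<Sum>l\<in>{l. set l \<subseteq> A \<and> length l = m}. \<Prod>a\<leftarrow>l. x a)"
proof (induction m)
  case 0
  have "{l. set l \<subseteq> A \<and> length l = 0} = {[]}" by auto
  then show ?case by simp
next
  case (Suc m)
  let ?L = "{l. set l \<subseteq> A \<and> length l = m}"
  have eq: "{l. set l \<subseteq> A \<and> length l = Suc m} = (\<lambda>(a, l). a # l) ` (A \<times> ?L)"
    by (auto simp: length_Suc_conv)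
  have inj: "inj_on (\<lambda>(a, l). a # l) (A \<times> ?L)" by (auto simp: inj_on_def)
  have "(\<Sum>a\<in>A. x a) ^ Suc m = (\<Sum>(a, l)\<in>A \<times> ?L. x a * (\<Prod>b\<leftarrow>l. x b))"
    by (simp add: Suc sum_product sum.cartesian_product)
  also have "\<dots> = (\<Sum>l\<in>{l. set l \<subseteq> A \<and> length l = Suc m}. \<Prod>a\<leftarrow>l. x a)"
    unfolding eq by (subst sum.reindex[OF inj]) (simp add: case_prod_beta')
  finally show ?case .
qed

text \<open>A form of Parseval's identity that allows each frequency to occur up to \<open>R\<close> times in the sum.\<close>

lemma integral_trig_sum_square_le:
  assumes "finite I"
    and R: "\<And>i. i \<in> I \<Longrightarrow> card {j \<in> I. k j = k i \<and> l j = l i} \<le> R"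
  shows "(LINT z|torus. (norm (\<Sum>i\<in>I. c i * torus_char (k i) (l i) z))\<^sup>2)
     \<le> 4 * pi\<^sup>2 * R * (\<Sum>i\<in>I. (norm (c i))\<^sup>2)"
proof -
  let ?S = "\<lambda>z. \<Sum>i\<in>I. c i * torus_char (k i) (l i) z"
  let ?e = "\<lambda>i j. k j = k i \<and> l j = l i"
  have "complex_of_real (LINT z|torus. (norm (?S z))\<^sup>2) = (LINT z|torus. complex_of_real ((norm (?S z))\<^sup>2))"
    by (rule integral_complex_of_real[symmetric])
  also have "\<dots> = (LINT z|torus. (\<Sum>i\<in>I. \<Sum>j\<in>I. c i * cnj (c j) * torus_char (k i - k j) (l i - l j) z))"
  proof (intro Bochner_Integration.integral_cong refl)
    fix z
    have "complex_of_real ((norm (?S z))\<^sup>2) = ?S z * cnj (?S z)"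
      by (simp only: complex_norm_square)
    also have "\<dots> = (\<Sum>i\<in>I. \<Sum>j\<in>I. c i * cnj (c j) * (torus_char (k i) (l i) z * cnj (torus_char (k j) (l j) z)))"
      by (simp add: cnj_sum sum_product mult_ac)
    finally show "complex_of_real ((norm (?S z))\<^sup>2) =
        (\<Sum>i\<in>I. \<Sum>j\<in>I. c i * cnj (c j) * torus_char (k i - k j) (l i - l j) z)"
      by (simp add: cnj_torus_char torus_char_mult)
  qed
  also have "\<dots> = (\<Sum>i\<in>I. \<Sum>j\<in>I. c i * cnj (c j) * (if ?e i j then 4 * pi\<^sup>2 else 0))"
    by (subst Bochner_Integration.integral_sum, force intro!: integrable_torus_char, intro sum.cong refl,
        subst Bochner_Integration.integral_sum, force intro!: integrable_torus_char)
      (auto simp: integral_torus_char intro!: sum.cong)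
  finally have eq: "complex_of_real (LINT z|torus. (norm (?S z))\<^sup>2) =
      (\<Sum>i\<in>I. \<Sum>j\<in>I. c i * cnj (c j) * (if ?e i j then 4 * pi\<^sup>2 else 0))" .
  have "(LINT z|torus. (norm (?S z))\<^sup>2) \<le> norm (complex_of_real (LINT z|torus. (norm (?S z))\<^sup>2))"
    by simp
  also have "\<dots> \<le> (\<Sum>i\<in>I. \<Sum>j\<in>I. norm (c i * cnj (c j) * (if ?e i j then 4 * pi\<^sup>2 else 0)))"
    unfolding eq by (intro order_trans[OF norm_sum] sum_mono norm_sum)
  also have "\<dots> \<le> (\<Sum>i\<in>I. \<Sum>j\<in>I. 2 * pi\<^sup>2 * (if ?e i j then (norm (c i))\<^sup>2 else 0) + 
      2 * pi\<^sup>2 * (if ?e j i then (norm (c j))\<^sup>2 else 0))"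
  proof (intro sum_mono)
    fix i j
    have "norm (c i) * norm (c j) * 2 \<le> (norm (c i))\<^sup>2 + (norm (c j))\<^sup>2"
      using sum_squares_bound[of "norm (c i)" "norm (c j)"] by (simp add: mult_ac)
    then have "pi\<^sup>2 * 2 * (norm (c i) * norm (c j) * 2) \<le> pi\<^sup>2 * 2 * ((norm (c i))\<^sup>2 + (norm (c j))\<^sup>2)"
      by (intro mult_left_mono) auto
    then show "norm (c i * cnj (c j) * (if ?e i j then 4 * pi\<^sup>2 else 0)) \<le>
        2 * pi\<^sup>2 * (if ?e i j then (norm (c i))\<^sup>2 else 0) + 2 * pi\<^sup>2 * (if ?e j i then (norm (c j))\<^sup>2 else 0)"
      by (auto simp: norm_mult norm_power algebra_simps)
  qed
  also have "\<dots> = 2 * pi\<^sup>2 * (\<Sum>i\<in>I. \<Sum>j\<in>I. if ?e i j then (norm (c i))\<^sup>2 else 0) +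
      2 * pi\<^sup>2 * (\<Sum>j\<in>I. \<Sum>i\<in>I. if ?e j i then (norm (c j))\<^sup>2 else 0)"
    by (subst (2) sum.swap) (simp only: sum.distrib sum_distrib_left)
  also have "\<dots> = 4 * pi\<^sup>2 * (\<Sum>i\<in>I. \<Sum>j\<in>I. if ?e i j then (norm (c i))\<^sup>2 else 0)" by simp
  also have "(\<Sum>i\<in>I. \<Sum>j\<in>I. if ?e i j then (norm (c i))\<^sup>2 else 0) =
      (\<Sum>i\<in>I. real (card {j \<in> I. ?e i j}) * (norm (c i))\<^sup>2)"
    using \<open>finite I\<close> by (simp add: sum.If_cases Int_def)
  also have "\<dots> \<le> (\<Sum>i\<in>I. R * (norm (c i))\<^sup>2)"
    by (intro sum_mono mult_right_mono) (use R in auto)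
  finally show ?thesis by (simp add: sum_distrib_left mult_ac)
qed

text \<open>The \<open>m\<close>-th power of the polynomial is a sum over \<open>m\<close>-tuples in which each frequency occurs a
  bounded number of times, so its \<open>L\<^sub>2\<close> norm is controlled by the sum of the squares of its coefficients. The
  fixed signs \<open>\<epsilon>1\<close>, \<open>\<epsilon>2\<close> matter: with mixed signs, zero would have unboundedly many representations as soon as \<open>m \<ge> 2\<close>.\<close>

lemma lacunary_even_moment_le:
  "\<exists>K. \<forall>A c \<epsilon>1 \<epsilon>2. finite A \<longrightarrow> \<epsilon>1 \<noteq> 0 \<longrightarrow> \<epsilon>2 \<noteq> 0 \<longrightarrow>
     (LINT z|torus. norm (\<Sum>(j, k)\<in>A. c j k * torus_char (\<epsilon>1 * 2 ^ j) (\<epsilon>2 * 2 ^ k) z) ^ (2 * m))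
       \<le> K * (\<Sum>(j, k)\<in>A. (norm (c j k))\<^sup>2) ^ m"
proof -
  obtain C where C: "\<And>n k. finite {l :: (nat \<times> nat) list. map fst l \<in> power2_tuples m n \<and> map snd l \<in> power2_tuples m k}"
     "\<And>n k. card {l :: (nat \<times> nat) list. map fst l \<in> power2_tuples m n \<and> map snd l \<in> power2_tuples m k} \<le> C"
    using card_power2_pair_tuples_le by blast
  have "(LINT z|torus. norm (\<Sum>(j, k)\<in>A. c j k * torus_char (\<epsilon>1 * 2 ^ j) (\<epsilon>2 * 2 ^ k) z) ^ (2 * m))
       \<le> 4 * pi\<^sup>2 * C * (\<Sum>(j, k)\<in>A. (norm (c j k))\<^sup>2) ^ m"
    if A: "finite A" and \<epsilon>: "\<epsilon>1 \<noteq> 0" "\<epsilon>2 \<noteq> 0" for A c \<epsilon>1 \<epsilon>2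
  proof -
    define L where "L = {l. set l \<subseteq> A \<and> length l = m}"
    have finL: "finite L" unfolding L_def by (rule finite_lists_length_eq[OF A])
    let ?x = "\<lambda>z (j, k). c j k * torus_char (\<epsilon>1 * 2 ^ j) (\<epsilon>2 * 2 ^ k) z"
    define s1 :: "(nat \<times> nat) list \<Rightarrow> nat" where "s1 l = (\<Sum>i\<leftarrow>map fst l. 2 ^ i)" for l
    define s2 :: "(nat \<times> nat) list \<Rightarrow> nat" where "s2 l = (\<Sum>i\<leftarrow>map snd l. 2 ^ i)" for l
    define d where "d l = (\<Prod>(j, k)\<leftarrow>l. c j k)" for l
    have prod: "(\<Prod>a\<leftarrow>l. ?x z a) = d l * torus_char (\<epsilon>1 * int (s1 l)) (\<epsilon>2 * int (s2 l)) z" for l z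
    proof (induction l)
      case Nil
      then show ?case by (simp add: d_def s1_def s2_def torus_char_def)
    next
      case (Cons a l)
      have "torus_char (\<epsilon>1 * int (s1 (a # l))) (\<epsilon>2 * int (s2 (a # l))) z =
         torus_char (\<epsilon>1 * 2 ^ fst a) (\<epsilon>2 * 2 ^ snd a) z * torus_char (\<epsilon>1 * int (s1 l)) (\<epsilon>2 * int (s2 l)) z"
        by (simp add: torus_char_mult s1_def s2_def distrib_left)
      then show ?case using Cons by (simp add: d_def case_prod_beta' mult_ac)
    qed
    have "(LINT z|torus. norm (\<Sum>a\<in>A. ?x z a) ^ (2 * m)) = 
        (LINT z|torus. (norm (\<Sum>l\<in>L. d l * torus_char (\<epsilon>1 * int (s1 l)) (\<epsilon>2 * int (s2 l)) z))\<^sup>2)"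
    proof (intro Bochner_Integration.integral_cong refl)
      fix z
      have "norm (\<Sum>a\<in>A. ?x z a) ^ (2 * m) = (norm ((\<Sum>a\<in>A. ?x z a) ^ m))\<^sup>2"
        by (simp add: norm_power mult.commute flip: power_mult)
      also have "(\<Sum>a\<in>A. ?x z a) ^ m = (\<Sum>l\<in>L. d l * torus_char (\<epsilon>1 * int (s1 l)) (\<epsilon>2 * int (s2 l)) z)"
        by (simp only: sum_power_lists[OF A] prod L_def)
      finally show "norm (\<Sum>a\<in>A. ?x z a) ^ (2 * m) = 
          (norm (\<Sum>l\<in>L. d l * torus_char (\<epsilon>1 * int (s1 l)) (\<epsilon>2 * int (s2 l)) z))\<^sup>2" .
    qed
    also have "\<dots> \<le> 4 * pi\<^sup>2 * C * (\<Sum>l\<in>L. (norm (d l))\<^sup>2)"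
    proof (rule integral_trig_sum_square_le[OF finL])
      fix i assume i: "i \<in> L"
      have "{j \<in> L. \<epsilon>1 * int (s1 j) = \<epsilon>1 * int (s1 i) \<and> \<epsilon>2 * int (s2 j) = \<epsilon>2 * int (s2 i)} \<subseteq>
          {l. map fst l \<in> power2_tuples m (s1 i) \<and> map snd l \<in> power2_tuples m (s2 i)}"
        using \<epsilon> by (auto simp: L_def power2_tuples_def s1_def s2_def)
      then show "card {j \<in> L. \<epsilon>1 * int (s1 j) = \<epsilon>1 * int (s1 i) \<and> \<epsilon>2 * int (s2 j) = \<epsilon>2 * int (s2 i)} \<le> C"
        using C by (meson card_mono order_trans)
    qed
    also have "(\<Sum>l\<in>L. (norm (d l))\<^sup>2) = (\<Sum>l\<in>L. \<Prod>(j, k)\<leftarrow>l. (norm (c j k))\<^sup>2)"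
    proof (intro sum.cong refl)
      fix l show "(norm (d l))\<^sup>2 = (\<Prod>(j, k)\<leftarrow>l. (norm (c j k))\<^sup>2)"
        unfolding d_def by (induction l) (auto simp: norm_mult power_mult_distrib)
    qed
    also have "\<dots> = (\<Sum>(j, k)\<in>A. (norm (c j k))\<^sup>2) ^ m"
      by (simp only: sum_power_lists[OF A] L_def)
    finally show ?thesis .
  qed
  then show ?thesis by blast
qed


section \<open>Equivalence of the Lp norm and the energy of the coefficients\<close>

text \<open>The frequencies \<open>(\<plusminus> 2 ^ j, \<plusminus> 2 ^ k)\<close> with \<open>j, k < N\<close>.\<close>

definition dyadic_freqs :: "nat \<Rightarrow> (int \<times> int) set" where
  "dyadic_freqs N = {(m, n). \<exists>j<N. \<exists>k<N. \<bar>m\<bar> = 2 ^ j \<and> \<bar>n\<bar> = 2 ^ k}"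

lemma sum_dyadic_freqs:
  "(\<Sum>(m, n)\<in>dyadic_freqs N. h m n) =
    (\<Sum>(e1, e2)\<in>{1, -1} \<times> {1, -1}. \<Sum>(j, k)\<in>{..<N} \<times> {..<N}. h (e1 * 2 ^ j) (e2 * 2 ^ k))"
  and finite_dyadic_freqs: "finite (dyadic_freqs N)"
proof -
  let ?g = "\<lambda>((e1, e2), (j, k)). (e1 * 2 ^ j, e2 * 2 ^ k) :: int \<times> int"
  let ?A = "({1, -1} \<times> {1, -1}) \<times> ({..<N} \<times> {..<N})"
  have eq: "dyadic_freqs N = ?g ` ?A"
  proof (intro equalityI subsetI)
    fix x assume "x \<in> dyadic_freqs N"
    then obtain m n j k where x: "x = (m, n)" and jk: "j < N" "k < N" "\<bar>m\<bar> = 2 ^ j" "\<bar>n\<bar> = 2 ^ k"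
      by (auto simp: dyadic_freqs_def)
    have "x = ?g ((sgn m, sgn n), (j, k))"
      unfolding x by (simp flip: jk(3,4)) (simp add: sgn_mult_abs)
    moreover have "sgn m \<in> {1, -1}" "sgn n \<in> {1, -1}"
      using jk(3,4) by (auto simp: sgn_if)
    ultimately show "x \<in> ?g ` ?A" using jk(1,2) by blast
  next
    fix x assume "x \<in> ?g ` ?A"
    then show "x \<in> dyadic_freqs N" by (auto simp: dyadic_freqs_def abs_mult)
  qed
  show "finite (dyadic_freqs N)" unfolding eq by auto
  have inj: "inj_on ?g ?A"
  proof (rule inj_onI)
    have 1: "e = e' \<and> i = i'" if "e * 2 ^ i = e' * 2 ^ i'" "e \<in> {1, -1}" "e' \<in> {1, -1}" for e e' :: int and i i' :: nat
    proof -
      have "\<bar>e * 2 ^ i\<bar> = \<bar>e' * 2 ^ i'\<bar>" using that by simp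
      then have "i = i'" using that(2,3) by (auto simp: abs_mult)
      then show ?thesis using that by auto
    qed
    fix x y assume "x \<in> ?A" "y \<in> ?A" "?g x = ?g y"
    then show "x = y" 
      using 1[of "fst (fst x)" "fst (snd x)" "fst (fst y)" "fst (snd y)"] 
        1[of "snd (fst x)" "snd (snd x)" "snd (fst y)" "snd (snd y)"]
      by (cases x; cases y) (auto simp only: split: prod.splits, auto)
  qed
  show "(\<Sum>(m, n)\<in>dyadic_freqs N. h m n) =
    (\<Sum>(e1, e2)\<in>{1, -1} \<times> {1, -1}. \<Sum>(j, k)\<in>{..<N} \<times> {..<N}. h (e1 * 2 ^ j) (e2 * 2 ^ k))"
    unfolding eq by (subst sum.reindex[OF inj]) (simp add: sum.cartesian_product case_prod_beta')
qed

lemma dyadic_freqs_mono: "M \<le> N \<Longrightarrow> dyadic_freqs M \<subseteq> dyadic_freqs N"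
  by (fastforce simp: dyadic_freqs_def)

text \<open>A substitute for Young's inequality with an integer power that is at least the conjugate exponent.\<close>

lemma mult_le_powr_plus_power:
  fixes a b p :: real
  assumes "1 < p" "0 \<le> a" "0 \<le> b" and m: "1 + 1 / (p - 1) \<le> real m"
  shows "a * b \<le> a powr p + (1 + b ^ m)"
proof (cases "b \<le> a powr (p - 1)")
  case True
  have "a * b \<le> a * a powr (p - 1)" using True assms by (intro mult_left_mono)
  also have "\<dots> = a powr p"
    using assms by (cases "a = 0") (simp_all add: powr_mult_base)
  finally show ?thesis using assms by (simp add: add_increasing2)
next
  case False
  then have b: "b > 0" using powr_ge_zero[of a "p - 1"] by linarith
  have "(a powr (p - 1)) powr (1 / (p - 1)) \<le> b powr (1 / (p - 1))"
    using False assms by (intro powr_mono2) auto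
  then have "a \<le> b powr (1 / (p - 1))" using assms by (simp add: powr_powr)
  then have "a * b \<le> b powr (1 / (p - 1)) * b" using b by (intro mult_right_mono) auto
  also have "\<dots> = b powr (1 + 1 / (p - 1))" using b by (simp add: powr_add)
  also have "\<dots> \<le> 1 + b ^ m"
  proof (cases "b \<le> 1")
    case True
    then have "b powr (1 + 1 / (p - 1)) \<le> 1" using b assms by (intro powr_le1) auto
    then show ?thesis using b by (simp add: add_increasing2)
  next
    case False
    then have "b powr (1 + 1 / (p - 1)) \<le> b powr real m" using m by (intro powr_mono) auto
    then show ?thesis using b by (simp add: powr_realpow)
  qed
  finally show ?thesis using assms by (simp add: add_increasing)
qed

lemma powr_le_one_plus_power:
  fixes a p :: real
  assumes "0 \<le> p" "0 \<le> a" "p \<le> real m"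
  shows "a powr p \<le> 1 + a ^ m"
proof (cases "a \<le> 1")
  case True
  then have "a powr p \<le> 1" using assms by (intro powr_le1) auto
  then show ?thesis using assms by (simp add: add_increasing2)
next
  case False
  then have "a powr p \<le> a powr real m" using assms by (intro powr_mono) auto
  then show ?thesis using False by (simp add: powr_realpow)
qed

lemma measurable_cnj [measurable]: "cnj \<in> borel_measurable borel"
  by (intro borel_measurable_continuous_onI continuous_intros)

lemma integrable_torus_of_Lp:
  fixes u :: "real \<times> real \<Rightarrow> complex"
  assumes [measurable]: "u \<in> borel_measurable torus" and "1 < p" 
    and fin: "(\<integral>\<^sup>+z. ennreal (norm (u z) powr p) \<partial>torus) < \<infinity>"
  shows "integrable torus u"
proof (rule integrableI_bounded)
  have "(\<integral>\<^sup>+z. ennreal (norm (u z)) \<partial>torus) \<le> (\<integral>\<^sup>+z. ennreal (norm (u z) powr p) + 1 \<partial>torus)"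
  proof (rule nn_integral_mono)
    fix z
    have "norm (u z) \<le> norm (u z) powr p + 1"
    proof (cases "norm (u z) \<le> 1")
      case False
      then have "norm (u z) powr 1 \<le> norm (u z) powr p" using \<open>1 < p\<close> by (intro powr_mono) auto
      then show ?thesis using False by simp
    qed (simp add: add_increasing)
    then show "ennreal (norm (u z)) \<le> ennreal (norm (u z) powr p) + 1"
      by (metis ennreal_1 ennreal_leI ennreal_plus powr_ge_zero zero_le_one)
  qed
  also have "\<dots> = (\<integral>\<^sup>+z. ennreal (norm (u z) powr p) \<partial>torus) + emeasure torus torus_cell"
    by (subst nn_integral_add) auto
  also have "\<dots> < \<infinity>" using fin by (simp add: emeasure_torus_space)
  finally show "(\<integral>\<^sup>+z. ennreal (norm (u z)) \<partial>torus) < \<infinity>" .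
qed simp

lemma integrable_continuous_torus:
  fixes g :: "real \<times> real \<Rightarrow> 'a::euclidean_space"
  assumes "continuous_on UNIV g"
  shows "integrable torus g"
proof -
  have "compact torus_cell" by (simp add: torus_cell_eq_cbox)
  then have "bounded (g ` torus_cell)"
    using assms by (meson compact_continuous_image compact_imp_bounded continuous_on_subset subset_UNIV)
  then obtain B where "\<And>z. z \<in> torus_cell \<Longrightarrow> norm (g z) \<le> B" by (auto simp: bounded_iff)
  then show ?thesis
    using assms by (intro finite_measure.integrable_const_bound[OF finite_measure_torus, of g B])
      (auto intro: measurable_torus continuous_borel_measurable_lebesgue)
qed

text \<open>The coefficients of a function in \<open>L\<^sub>p\<close>, \<open>p > 1\<close>, at positive dyadic frequencies are
  controlled by pairing the function with the lacunary polynomial built from them.\<close>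

lemma dyadic_coeffs_bounded:
  assumes p: "1 < p"
  shows "\<exists>K::real. \<forall>u N. u \<in> borel_measurable torus \<longrightarrow>
    (\<integral>\<^sup>+z. ennreal (norm (u z) powr p) \<partial>torus) \<le> 1 \<longrightarrow>
    (\<Sum>(j, k)\<in>{..<N} \<times> {..<N}. (norm (fourier_coeff u (2 ^ j) (2 ^ k)))\<^sup>2) \<le> K"
proof -
  obtain m :: nat where m: "1 + 1 / (p - 1) \<le> real (2 * m)"
    using real_arch_simple[of "1 + 1 / (p - 1)"] by (metis le_trans mult_2 of_nat_add add_increasing2 of_nat_0_le_iff)
  obtain K where K: "\<And>A c \<epsilon>1 \<epsilon>2. finite A \<Longrightarrow> \<epsilon>1 \<noteq> 0 \<Longrightarrow> \<epsilon>2 \<noteq> 0 \<Longrightarrow>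
     (LINT z|torus. norm (\<Sum>(j, k)\<in>A. c j k * torus_char (\<epsilon>1 * 2 ^ j) (\<epsilon>2 * 2 ^ k) z) ^ (2 * m))
       \<le> K * (\<Sum>(j, k)\<in>A. (norm (c j k))\<^sup>2) ^ m"
    using lacunary_even_moment_le by blast
  define K' where "K' = (1 + 4 * pi\<^sup>2 + K) / (4 * pi\<^sup>2)"
  have "(\<Sum>(j, k)\<in>{..<N} \<times> {..<N}. (norm (fourier_coeff u (2 ^ j) (2 ^ k)))\<^sup>2) \<le> K'\<^sup>2"
    if um [measurable]: "u \<in> borel_measurable torus" 
      and up: "(\<integral>\<^sup>+z. ennreal (norm (u z) powr p) \<partial>torus) \<le> 1" for u N
  proof -
    define c where "c j k = fourier_coeff u (2 ^ j) (2 ^ k)" for j k :: nat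
    define A where "A = {..<N} \<times> {..<N}"
    define s where "s = sqrt (\<Sum>(j, k)\<in>A. (norm (c j k))\<^sup>2)"
    have s2: "s\<^sup>2 = (\<Sum>(j, k)\<in>A. (norm (c j k))\<^sup>2)"
      unfolding s_def by (intro real_sqrt_pow2 sum_nonneg) auto
    have s0: "s \<ge> 0" unfolding s_def by (intro real_sqrt_ge_zero sum_nonneg) auto
    have finA: "finite A" by (simp add: A_def)
    have u: "integrable torus u"
      using up p by (intro integrable_torus_of_Lp[where p = p]) (auto simp: le_less_trans[OF _ ennreal_one_less_top])
    have uP: "integrable torus (\<lambda>z. norm (u z) powr p)"
      using up by (intro integrableI_bounded) (auto simp: le_less_trans[OF _ ennreal_one_less_top])
    have uP1: "(LINT z|torus. norm (u z) powr p) \<le> 1"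
      using up nn_integral_eq_integral[OF uP] by (simp add: ennreal_le_1)
    have "s \<le> K'" if "s > 0"
    proof -
      \<comment> \<open>The lacunary polynomial with the coefficients of \<open>u\<close>, scaled to have unit \<open>l\<^sub>2\<close> norm.\<close>
      define Q where "Q z = (\<Sum>(j, k)\<in>A. (c j k / s) * torus_char (1 * 2 ^ j) (1 * 2 ^ k) z)" for z
      have Qc: "continuous_on UNIV Q"
        unfolding Q_def case_prod_beta' by (intro continuous_intros continuous_torus_char)
      have Qm [measurable]: "Q \<in> borel_measurable torus"
        by (intro measurable_torus continuous_borel_measurable_lebesgue Qc)
      have "(\<Sum>(j, k)\<in>A. (norm (c j k / s))\<^sup>2) = (\<Sum>(j, k)\<in>A. (norm (c j k))\<^sup>2) / s\<^sup>2"
        using that by (simp add: norm_divide power_divide sum_divide_distrib case_prod_beta')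
      also have "\<dots> = 1" using that by (simp flip: s2)
      finally have QK: "(LINT z|torus. norm (Q z) ^ (2 * m)) \<le> K"
        using K[OF finA, of 1 1 "\<lambda>j k. c j k / s"] by (simp add: Q_def)
      have Qi: "integrable torus (\<lambda>z. norm (Q z) ^ (2 * m))"
        by (intro integrable_continuous_torus continuous_intros Qc)
      have uQi: "integrable torus (\<lambda>z. norm (u z) powr p + (1 + norm (Q z) ^ (2 * m)))"
        using uP Qi finite_measure.integrable_const[OF finite_measure_torus, of 1] 
        by (intro Bochner_Integration.integrable_add) auto
      have uQ: "norm (u z * cnj (Q z)) \<le> norm (u z) powr p + (1 + norm (Q z) ^ (2 * m))" for z
        using mult_le_powr_plus_power[OF p _ _ m, of "norm (u z)" "norm (Q z)"] by (simp add: norm_mult)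
      have uQint: "integrable torus (\<lambda>z. u z * cnj (Q z))"
        by (rule Bochner_Integration.integrable_bound[OF uQi]) (use uQ in auto)
      have term_int: "integrable torus (\<lambda>z. u z * torus_char k l z)" for k l
        by (rule Bochner_Integration.integrable_bound[OF u]) (auto simp: norm_mult)
      have "(LINT z|torus. u z * cnj (Q z)) = 
          (LINT z|torus. (\<Sum>(j, k)\<in>A. cnj (c j k) / s * (u z * torus_char (- (2 ^ j)) (- (2 ^ k)) z)))"
        by (intro Bochner_Integration.integral_cong refl)
           (simp add: Q_def case_prod_beta' cnj_sum cnj_torus_char sum_distrib_left mult_ac)
      also have "\<dots> = (\<Sum>(j, k)\<in>A. cnj (c j k) / s * (LINT z|torus. u z * torus_char (- (2 ^ j)) (- (2 ^ k)) z))"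
        unfolding case_prod_beta'
        by (subst Bochner_Integration.integral_sum) (use term_int in auto)
      also have "\<dots> = (\<Sum>(j, k)\<in>A. cnj (c j k) / s * (4 * pi\<^sup>2 * c j k))"
        by (simp add: c_def fourier_coeff_eq)
      also have "\<dots> = (\<Sum>(j, k)\<in>A. complex_of_real (4 * pi\<^sup>2 / s * (norm (c j k))\<^sup>2))"
      proof (intro sum.cong refl, clarify)
        fix j k
        have "cnj (c j k) / s * (4 * pi\<^sup>2 * c j k) = of_real (4 * pi\<^sup>2 / s) * (c j k * cnj (c j k))" by simp
        then show "cnj (c j k) / s * (4 * pi\<^sup>2 * c j k) = complex_of_real (4 * pi\<^sup>2 / s * (norm (c j k))\<^sup>2)"
          by (simp only: of_real_mult complex_norm_square)
      qed
      also have "\<dots> = complex_of_real (4 * pi\<^sup>2 / s * s\<^sup>2)"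
        by (simp add: s2 case_prod_beta' sum_distrib_left)
      also have "\<dots> = complex_of_real (4 * pi\<^sup>2 * s)" using that by (simp add: power2_eq_square)
      finally have "4 * pi\<^sup>2 * s = norm (LINT z|torus. u z * cnj (Q z))"
        using that by (simp add: norm_mult norm_power)
      also have "\<dots> \<le> (LINT z|torus. norm (u z * cnj (Q z)))" by (rule integral_norm_bound)
      also have "\<dots> \<le> (LINT z|torus. norm (u z) powr p + (1 + norm (Q z) ^ (2 * m)))"
        using uQint uQi uQ by (intro integral_mono) auto
      also have "\<dots> = (LINT z|torus. norm (u z) powr p) + (4 * pi\<^sup>2 + (LINT z|torus. norm (Q z) ^ (2 * m)))"
        using uP Qi finite_measure.integrable_const[OF finite_measure_torus, of "1::real"] measure_torus_cell
        by (simp add: measure_restrict_space)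
      also have "\<dots> \<le> 1 + 4 * pi\<^sup>2 + K" using uP1 QK by simp
      finally show "s \<le> K'" by (simp add: K'_def field_simps)
    qed
    then have "s\<^sup>2 \<le> K'\<^sup>2"
      using s0 by (cases "s = 0") (auto intro!: power_mono)
    then show ?thesis by (simp add: s2 A_def c_def)
  qed
  then show ?thesis by blast
qed

lemma integrable_mult_torus_char:
  assumes u: "integrable torus u"
  shows "integrable torus (\<lambda>z. u z * torus_char k l z)"
  by (rule Bochner_Integration.integrable_bound[OF u]) (use u in \<open>auto simp: norm_mult\<close>)

lemma fourier_coeff_diff:
  assumes "integrable torus u" "integrable torus v"
  shows "fourier_coeff (\<lambda>z. u z - v z) m n = fourier_coeff u m n - fourier_coeff v m n"
  using integrable_mult_torus_char[OF assms(1)] integrable_mult_torus_char[OF assms(2)]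
  by (simp add: fourier_coeff_eq left_diff_distrib diff_divide_distrib)

lemma fourier_coeff_trig_sum:
  assumes "finite B"
  shows "fourier_coeff (\<lambda>z. \<Sum>(k, l)\<in>B. c k l * torus_char k l z) m n = (if (m, n) \<in> B then c m n else 0)"
proof -
  have "(LINT z|torus. (\<Sum>(k, l)\<in>B. c k l * torus_char k l z) * torus_char (- m) (- n) z) =
      (LINT z|torus. (\<Sum>(k, l)\<in>B. c k l * torus_char (k - m) (l - n) z))"
    by (simp add: sum_distrib_right case_prod_beta' mult.assoc torus_char_mult)
  also have "\<dots> = (\<Sum>(k, l)\<in>B. c k l * (if (k, l) = (m, n) then 4 * pi\<^sup>2 else 0))"
    unfolding case_prod_beta'
  proof (subst Bochner_Integration.integral_sum)
    show "(\<Sum>x\<in>B. LINT z|torus. c (fst x) (snd x) * torus_char (fst x - m) (snd x - n) z) =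
        (\<Sum>x\<in>B. c (fst x) (snd x) * complex_of_real (if (fst x, snd x) = (m, n) then 4 * pi\<^sup>2 else 0))"
    proof (intro sum.cong refl)
      fix x
      show "(LINT z|torus. c (fst x) (snd x) * torus_char (fst x - m) (snd x - n) z) =
        c (fst x) (snd x) * complex_of_real (if (fst x, snd x) = (m, n) then 4 * pi\<^sup>2 else 0)"
        by (cases "x = (m, n)") (auto simp: integral_torus_char prod_eq_iff)
    qed
  qed (auto intro: integrable_torus_char)
  also have "\<dots> = (if (m, n) \<in> B then c m n * (4 * pi\<^sup>2) else 0)"
  proof -
    have "(\<Sum>(k, l)\<in>B. c k l * (if (k, l) = (m, n) then 4 * pi\<^sup>2 else 0)) =
        (\<Sum>x\<in>B. if x = (m, n) then c m n * (4 * pi\<^sup>2) else 0)"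
    proof (intro sum.cong refl)
      fix x
      show "(case x of (k, l) \<Rightarrow> c k l * complex_of_real (if (k, l) = (m, n) then 4 * pi\<^sup>2 else 0)) =
          (if x = (m, n) then c m n * (4 * pi\<^sup>2) else 0)"
        by (cases x; cases "x = (m, n)") auto
    qed
    then show ?thesis using assms by simp
  qed
  finally show ?thesis by (simp add: fourier_coeff_eq)
qed

text \<open>A sum over all dyadic frequencies splits into its four quadrants, each of which satisfies the
  lacunary inequality.\<close>

lemma integral_lacunary_sum_le:
  assumes m: "\<And>A c \<epsilon>1 \<epsilon>2. finite A \<Longrightarrow> \<epsilon>1 \<noteq> 0 \<Longrightarrow> \<epsilon>2 \<noteq> 0 \<Longrightarrow>
     (LINT z|torus. norm (\<Sum>(j, k)\<in>A. c j k * torus_char (\<epsilon>1 * 2 ^ j) (\<epsilon>2 * 2 ^ k) z) ^ (2 * m))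
       \<le> K * (\<Sum>(j, k)\<in>A. (norm (c j k))\<^sup>2) ^ m"
    and "0 \<le> K"
    and a: "\<And>e1 e2. e1 \<in> {1, -1} \<Longrightarrow> e2 \<in> {1, -1} \<Longrightarrow> 
      (\<Sum>(j, k)\<in>{..<N} \<times> {..<N}. (norm (c (e1 * 2 ^ j) (e2 * 2 ^ k)))\<^sup>2) \<le> 1"
  shows "(LINT z|torus. norm (\<Sum>(k, l)\<in>dyadic_freqs N. c k l * torus_char k l z) ^ (2 * m)) \<le> 4 ^ (2 * m) * (4 * K)"
proof -
  define E :: "(int \<times> int) set" where "E = {1, -1} \<times> {1, -1}"
  have finE: "finite E" and cE: "card E = 4" by (simp_all add: E_def card_cartesian_product)
  define S where "S e z = (\<Sum>(j, k)\<in>{..<N} \<times> {..<N}. c (fst e * 2 ^ j) (snd e * 2 ^ k) * torus_char (fst e * 2 ^ j) (snd e * 2 ^ k) z)" for e z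
  have Si: "integrable torus (\<lambda>z. norm (S e z) ^ (2 * m))" for e
    unfolding S_def case_prod_beta' by (intro integrable_continuous_torus continuous_intros continuous_torus_char)
  have eq: "(\<Sum>(k, l)\<in>dyadic_freqs N. c k l * torus_char k l z) = (\<Sum>e\<in>E. S e z)" for z
    unfolding sum_dyadic_freqs E_def S_def by (simp add: case_prod_beta')
  have b: "norm (\<Sum>e\<in>E. S e z) ^ (2 * m) \<le> (\<Sum>e\<in>E. 4 ^ (2 * m) * norm (S e z) ^ (2 * m))" for z
  proof -
    have "E \<noteq> {}" by (simp add: E_def)
    then obtain e where e: "e \<in> E" "\<And>e'. e' \<in> E \<Longrightarrow> norm (S e' z) \<le> norm (S e z)"
      using obtains_MAX[OF finE, of "\<lambda>e. norm (S e z)"] finE by (metis Max_ge finite_imageI imageI)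
    have "norm (\<Sum>e\<in>E. S e z) \<le> (\<Sum>e'\<in>E. norm (S e z))"
      by (intro order_trans[OF norm_sum] sum_mono e)
    also have "\<dots> = 4 * norm (S e z)" by (simp add: cE)
    finally have "norm (\<Sum>e\<in>E. S e z) ^ (2 * m) \<le> (4 * norm (S e z)) ^ (2 * m)"
      by (intro power_mono) auto
    also have "\<dots> = 4 ^ (2 * m) * norm (S e z) ^ (2 * m)" by (simp add: power_mult_distrib)
    also have "\<dots> \<le> (\<Sum>e\<in>E. 4 ^ (2 * m) * norm (S e z) ^ (2 * m))"
      using e finE by (intro member_le_sum) auto
    finally show ?thesis .
  qed
  have "(LINT z|torus. norm (\<Sum>e\<in>E. S e z) ^ (2 * m)) \<le> (LINT z|torus. (\<Sum>e\<in>E. 4 ^ (2 * m) * norm (S e z) ^ (2 * m)))"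
  proof (rule integral_mono)
    show "integrable torus (\<lambda>z. norm (\<Sum>e\<in>E. S e z) ^ (2 * m))"
      unfolding S_def case_prod_beta' by (intro integrable_continuous_torus continuous_intros continuous_torus_char)
  qed (use b Si in auto)
  also have "\<dots> = (\<Sum>e\<in>E. 4 ^ (2 * m) * (LINT z|torus. norm (S e z) ^ (2 * m)))"
    using Si by (subst Bochner_Integration.integral_sum) auto
  also have "\<dots> \<le> (\<Sum>e\<in>E. 4 ^ (2 * m) * K)"
  proof (intro sum_mono mult_left_mono)
    fix e assume e: "e \<in> E"
    define w where "w = (\<Sum>(j, k)\<in>{..<N} \<times> {..<N}. (norm (c (fst e * 2 ^ j) (snd e * 2 ^ k)))\<^sup>2)"
    have "(LINT z|torus. norm (S e z) ^ (2 * m)) \<le> K * w ^ m"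
      unfolding S_def w_def using e by (intro m) (auto simp: E_def)
    also have "\<dots> \<le> K * 1"
    proof (intro mult_left_mono power_le_one)
      show "0 \<le> w" unfolding w_def by (intro sum_nonneg) auto
      show "w \<le> 1" unfolding w_def using e by (intro a) (auto simp: E_def)
    qed fact
    finally show "(LINT z|torus. norm (S e z) ^ (2 * m)) \<le> K" by simp
  qed auto
  finally show ?thesis by (simp add: eq cE)
qed

text \<open>The Fourier coefficients of \<open>u\<close> have modulus \<open>a j k\<close> at all four frequencies
  \<open>(\<plusminus> 2 ^ j, \<plusminus> 2 ^ k)\<close> and vanish at all others. Only the moduli matter below, and the operations considered
  keep them equal on the four frequencies.\<close>

definition dyadic_spectrum :: "(real \<times> real \<Rightarrow> complex) \<Rightarrow> (nat \<Rightarrow> nat \<Rightarrow> real) \<Rightarrow> bool" where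
  "dyadic_spectrum u a \<longleftrightarrow>
     (\<forall>m n j k. \<bar>m\<bar> = 2 ^ j \<and> \<bar>n\<bar> = 2 ^ k \<longrightarrow> norm (fourier_coeff u m n) = a j k) \<and>
     (\<forall>m n. \<not> (\<exists>j k. \<bar>m\<bar> = 2 ^ j \<and> \<bar>n\<bar> = 2 ^ k) \<longrightarrow> fourier_coeff u m n = 0)"

lemma strict_mono_fast_convergence:
  assumes "W \<longlonglongrightarrow> (L::real)" "\<And>k::nat. 0 < \<epsilon> k"
  obtains r :: "nat \<Rightarrow> nat" where "strict_mono r" "\<And>k. \<bar>W (r k) - L\<bar> < \<epsilon> k"
proof -
  have ev: "\<forall>\<^sub>F n in sequentially. \<bar>W n - L\<bar> < \<epsilon> k" for k
    using tendstoD[OF assms(1) assms(2)[of k]] by (simp add: dist_real_def)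
  have "\<exists>r. \<forall>k. \<bar>W (r k) - L\<bar> < \<epsilon> k \<and> r k < r (Suc k)"
  proof (rule dependent_nat_choice)
    show "\<exists>n. \<bar>W n - L\<bar> < \<epsilon> 0" using ev[of 0] eventually_happens'[OF sequentially_bot] by blast
    fix x k
    have "\<forall>\<^sub>F n in sequentially. \<bar>W n - L\<bar> < \<epsilon> (Suc k) \<and> x < n"
      using ev[of "Suc k"] eventually_gt_at_top[of x] by eventually_elim auto
    then show "\<exists>n. \<bar>W n - L\<bar> < \<epsilon> (Suc k) \<and> x < n"
      using eventually_happens'[OF sequentially_bot] by blast
  qed
  then show ?thesis using that by (auto simp: strict_mono_Suc_iff)
qed

text \<open>The dyadic partial sums converge in \<open>L\<^sub>1\<close>, fast along a subsequence and hence almost everywhere.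
  Uniqueness identifies the limit, and Fatou's lemma transfers the uniform moment bound to it.\<close>

lemma Lp_integral_bounded_of_dyadic_coeffs:
  assumes p: "1 < p"
  shows "\<exists>K::real. 1 \<le> K \<and> (\<forall>u a. integrable torus u \<longrightarrow> dyadic_spectrum u a \<longrightarrow>
    (\<forall>N. (\<Sum>(j, k)\<in>{..<N} \<times> {..<N}. (a j k)\<^sup>2) \<le> 1) \<longrightarrow>
    (\<integral>\<^sup>+z. ennreal (norm (u z) powr p) \<partial>torus) \<le> ennreal K)"
proof -
  obtain m :: nat where m: "p \<le> real (2 * m)"
    using real_arch_simple[of p] by (metis mult_2 of_nat_add add_increasing2 of_nat_0_le_iff)
  obtain K0 where K0: "\<And>A c \<epsilon>1 \<epsilon>2. finite A \<Longrightarrow> \<epsilon>1 \<noteq> 0 \<Longrightarrow> \<epsilon>2 \<noteq> 0 \<Longrightarrow>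
     (LINT z|torus. norm (\<Sum>(j, k)\<in>A. c j k * torus_char (\<epsilon>1 * 2 ^ j) (\<epsilon>2 * 2 ^ k) z) ^ (2 * m))
       \<le> K0 * (\<Sum>(j, k)\<in>A. (norm (c j k))\<^sup>2) ^ m"
    using lacunary_even_moment_le by blast
  define K where "K = max 0 K0"
  have K: "(LINT z|torus. norm (\<Sum>(j, k)\<in>A. c j k * torus_char (\<epsilon>1 * 2 ^ j) (\<epsilon>2 * 2 ^ k) z) ^ (2 * m))
       \<le> K * (\<Sum>(j, k)\<in>A. (norm (c j k))\<^sup>2) ^ m" if "finite A" "\<epsilon>1 \<noteq> 0" "\<epsilon>2 \<noteq> 0" for A c \<epsilon>1 \<epsilon>2
  proof -
    have "K0 * (\<Sum>(j, k)\<in>A. (norm (c j k))\<^sup>2) ^ m \<le> K * (\<Sum>(j, k)\<in>A. (norm (c j k))\<^sup>2) ^ m"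
      by (intro mult_right_mono zero_le_power sum_nonneg) (auto simp: K_def)
    then show ?thesis using K0[OF that, of c] by linarith
  qed
  have Kpos: "0 \<le> K" by (simp add: K_def)
  define B where "B = 4 * pi\<^sup>2 + 4 ^ (2 * m) * (4 * K) + 1"
  have B1: "1 \<le> B" using Kpos by (simp add: B_def)
  have "(\<integral>\<^sup>+z. ennreal (norm (u z) powr p) \<partial>torus) \<le> ennreal B"
    if u: "integrable torus u" and spec: "dyadic_spectrum u a"
      and a: "\<And>N. (\<Sum>(j, k)\<in>{..<N} \<times> {..<N}. (a j k)\<^sup>2) \<le> 1" for u a
  proof -
    define c where "c = fourier_coeff u"
    have c0: "c k l = 0" if "\<And>N. (k, l) \<notin> dyadic_freqs N" for k l
    proof -
      have "\<not> (\<exists>i j. \<bar>k\<bar> = 2 ^ i \<and> \<bar>l\<bar> = 2 ^ j)"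
      proof
        assume "\<exists>i j. \<bar>k\<bar> = 2 ^ i \<and> \<bar>l\<bar> = 2 ^ j"
        then obtain i j where "\<bar>k\<bar> = 2 ^ i" "\<bar>l\<bar> = 2 ^ j" by blast
        then have "(k, l) \<in> dyadic_freqs (Suc (max i j))" 
          by (auto simp: dyadic_freqs_def intro!: exI[of _ i] exI[of _ j])
        then show False using that by blast
      qed
      then show ?thesis using spec by (auto simp: dyadic_spectrum_def c_def)
    qed
    have ca: "norm (c (e1 * 2 ^ j) (e2 * 2 ^ k)) = a j k" if "e1 \<in> {1, -1}" "e2 \<in> {1, -1}" for e1 e2 j k
      using spec that unfolding dyadic_spectrum_def c_def by (auto simp: abs_mult)
    have ca1: "(\<Sum>(j, k)\<in>{..<N} \<times> {..<N}. (norm (c (e1 * 2 ^ j) (e2 * 2 ^ k)))\<^sup>2) \<le> 1" 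
      if "e1 \<in> {1, -1}" "e2 \<in> {1, -1}" for e1 e2 N
      using a[of N] by (simp add: ca[OF that])
    define S where "S N z = (\<Sum>(k, l)\<in>dyadic_freqs N. c k l * torus_char k l z)" for N z
    define W where "W N = (\<Sum>(k, l)\<in>dyadic_freqs N. (norm (c k l))\<^sup>2)" for N
    have Sc: "continuous_on UNIV (S N)" for N
      unfolding S_def case_prod_beta' by (intro continuous_intros continuous_torus_char)
    have Si: "integrable torus (S N)" for N by (rule integrable_continuous_torus[OF Sc])
    have Sm [measurable]: "S N \<in> borel_measurable torus" for N using Si by simp
    have Scoeff: "fourier_coeff (S N) k l = (if (k, l) \<in> dyadic_freqs N then c k l else 0)" for N k l
      unfolding S_def by (rule fourier_coeff_trig_sum[OF finite_dyadic_freqs])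
    have W4: "W N \<le> 4" for N
    proof -
      have "W N \<le> (\<Sum>(e1, e2)\<in>{1, -1 :: int} \<times> {1, -1 :: int}. 1)"
        unfolding W_def sum_dyadic_freqs by (intro sum_mono) (use ca1 in \<open>auto split: prod.splits\<close>)
      then show ?thesis by (simp add: card_cartesian_product case_prod_beta')
    qed
    have Wdiff: "W N - W M = (\<Sum>(k, l)\<in>dyadic_freqs N - dyadic_freqs M. (norm (c k l))\<^sup>2)" if "M \<le> N" for M N
      unfolding W_def by (rule sum_diff[symmetric]) (auto intro: finite_dyadic_freqs dyadic_freqs_mono[OF that, THEN subsetD])
    have "W M \<le> W N" if "M \<le> N" for M N
      using Wdiff[OF that] sum_nonneg[of "dyadic_freqs N - dyadic_freqs M" "\<lambda>(k, l). (norm (c k l))\<^sup>2"] by auto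
    then have "incseq W" by (simp add: incseq_def)
    then obtain L where L: "W \<longlonglongrightarrow> L" "\<And>N. W N \<le> L"
      using incseq_convergent[of W 4] W4 by blast
    obtain r where r: "strict_mono r" "\<And>k. \<bar>W (r k) - L\<bar> < (1/4) ^ k"
      using strict_mono_fast_convergence[OF L(1), of "\<lambda>k. (1/4) ^ k"] by auto
    \<comment> \<open>Consecutive differences along the subsequence, with norms decaying geometrically.\<close>
    define D where "D k z = S (r (Suc k)) z - S (r k) z" for k z
    have Di: "integrable torus (D k)" for k unfolding D_def using Si by auto
    have D2: "(LINT z|torus. (norm (D k z))\<^sup>2) \<le> 4 * pi\<^sup>2 * (1/4) ^ k" for k
    proof -
      have le: "r k \<le> r (Suc k)" using r(1) by (simp add: strict_mono_less_eq)
      define I where "I = dyadic_freqs (r (Suc k)) - dyadic_freqs (r k)"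
      have "D k z = (\<Sum>i\<in>I. c (fst i) (snd i) * torus_char (fst i) (snd i) z)" for z
        unfolding D_def S_def I_def case_prod_beta' 
        by (rule sum_diff[symmetric]) (auto intro: finite_dyadic_freqs dyadic_freqs_mono[OF le, THEN subsetD])
      then have "(LINT z|torus. (norm (D k z))\<^sup>2) = (LINT z|torus. (norm (\<Sum>i\<in>I. c (fst i) (snd i) * torus_char (fst i) (snd i) z))\<^sup>2)"
        by simp
      also have "\<dots> \<le> 4 * pi\<^sup>2 * real 1 * (\<Sum>i\<in>I. (norm (c (fst i) (snd i)))\<^sup>2)"
      proof (rule integral_trig_sum_square_le)
        show "finite I" by (simp add: I_def finite_dyadic_freqs)
        fix i assume "i \<in> I"
        have "{j \<in> I. fst j = fst i \<and> snd j = snd i} \<subseteq> {i}" by (auto simp: prod_eq_iff)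
        from card_mono[OF _ this] show "card {j \<in> I. fst j = fst i \<and> snd j = snd i} \<le> 1" by simp
      qed
      also have "\<dots> = 4 * pi\<^sup>2 * (W (r (Suc k)) - W (r k))"
        unfolding Wdiff[OF le] I_def by (simp add: case_prod_beta')
      also have "\<dots> \<le> 4 * pi\<^sup>2 * (1/4) ^ k"
        using L(2)[of "r (Suc k)"] r(2)[of k] by (intro mult_left_mono) auto
      finally show ?thesis .
    qed
    have D1: "(LINT z|torus. norm (D k z)) \<le> 8 * pi\<^sup>2 * (1/2) ^ k" for k
    proof -
      \<comment> \<open>The \<open>L\<^sub>1\<close> norm is bounded by the \<open>L\<^sub>2\<close> norm through \<open>x \<le> \<eta> + x\<^sup>2 / \<eta>\<close>.\<close>
      define \<eta> :: real where "\<eta> = (1/2) ^ k"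
      have \<eta>: "\<eta> > 0" by (simp add: \<eta>_def)
      have D2i: "integrable torus (\<lambda>z. (norm (D k z))\<^sup>2)"
        unfolding D_def by (intro integrable_continuous_torus continuous_intros Sc)
      have ci: "integrable torus (\<lambda>z. \<eta>)"
        by (rule finite_measure.integrable_const[OF finite_measure_torus])
      have "(LINT z|torus. norm (D k z)) \<le> (LINT z|torus. \<eta> + (norm (D k z))\<^sup>2 / \<eta>)"
      proof (rule integral_mono)
        fix z
        show "norm (D k z) \<le> \<eta> + (norm (D k z))\<^sup>2 / \<eta>"
        proof (cases "norm (D k z) \<le> \<eta>")
          case True
          then show ?thesis using \<eta> by (simp add: add_increasing2)
        next
          case False
          then have "norm (D k z) * \<eta> \<le> norm (D k z) * norm (D k z)" by (intro mult_left_mono) auto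
          then have "norm (D k z) \<le> (norm (D k z))\<^sup>2 / \<eta>" using \<eta> by (simp add: field_simps power2_eq_square)
          then show ?thesis using \<eta> by linarith
        qed
      qed (use Di D2i ci in auto)
      also have "\<dots> = 4 * pi\<^sup>2 * \<eta> + (LINT z|torus. (norm (D k z))\<^sup>2) / \<eta>"
        using D2i ci measure_torus_cell by (simp add: measure_restrict_space)
      also have "\<dots> \<le> 4 * pi\<^sup>2 * \<eta> + (4 * pi\<^sup>2 * (1/4) ^ k) / \<eta>"
        by (intro add_left_mono divide_right_mono D2) (use \<eta> in simp)
      also have "(1/4 :: real) ^ k = \<eta> * \<eta>" by (simp add: \<eta>_def flip: power_mult_distrib)
      finally show ?thesis using \<eta> by (simp add: \<eta>_def)
    qed
    have sumD: "summable (\<lambda>k. LINT z|torus. norm (D k z))"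
      by (rule summable_comparison_test'[where g = "\<lambda>k. 8 * pi\<^sup>2 * (1/2) ^ k" and N = 0])
        (use D1 in \<open>auto intro!: summable_mult summable_geometric\<close>)
    have AE: "AE z in torus. summable (\<lambda>k. norm (D k z))"
    proof -
      have "(\<integral>\<^sup>+z. (\<Sum>k. ennreal (norm (D k z))) \<partial>torus) = (\<Sum>k. \<integral>\<^sup>+z. ennreal (norm (D k z)) \<partial>torus)"
        using Di by (intro nn_integral_suminf) auto
      also have "\<dots> = (\<Sum>k. ennreal (LINT z|torus. norm (D k z)))"
        using Di by (simp add: nn_integral_eq_integral)
      also have "\<dots> \<noteq> \<infinity>" using sumD by (simp add: ennreal_suminf_neq_top)
      finally have "AE z in torus. (\<Sum>k. ennreal (norm (D k z))) \<noteq> \<infinity>"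
        using Di by (intro nn_integral_noteq_infinite) auto
      then show ?thesis by eventually_elim (auto intro: summable_suminf_not_top)
    qed
    define F where "F z = S (r 0) z + (\<Sum>k. D k z)" for z
    have Fi: "integrable torus F"
      unfolding F_def using integrable_suminf[OF Di AE sumD] Si by auto
    have conv: "AE z in torus. (\<lambda>k. S (r k) z) \<longlonglongrightarrow> F z"
      using AE
    proof eventually_elim
      case (elim z)
      then have "(\<lambda>k. D k z) sums (\<Sum>k. D k z)" by (simp add: summable_norm_cancel summable_sums)
      then have "(\<lambda>n. S (r 0) z + (\<Sum>k<n. D k z)) \<longlonglongrightarrow> F z"
        unfolding sums_def F_def by (intro tendsto_intros)
      moreover have "S (r 0) z + (\<Sum>k<n. D k z) = S (r n) z" for n
        using sum_lessThan_telescope[of "\<lambda>k. S (r k) z" n] by (simp add: D_def)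
      ultimately show ?case by simp
    qed
    have Fcoeff: "fourier_coeff F k l = c k l" for k l
    proof -
      let ?h = "torus_char (- k) (- l)"
      have "(\<lambda>n. LINT z|torus. S (r n) z * ?h z) \<longlonglongrightarrow> (LINT z|torus. F z * ?h z)"
      proof -
        have "(\<lambda>i. LINT z|torus. D i z * ?h z) sums (LINT z|torus. (\<Sum>i. D i z * ?h z))"
          by (rule sums_integral) (use AE sumD integrable_mult_torus_char[OF Di] in \<open>auto simp: norm_mult\<close>)
        also have "(LINT z|torus. (\<Sum>i. D i z * ?h z)) = (LINT z|torus. (\<Sum>i. D i z) * ?h z)"
        proof (rule integral_cong_AE)
          show "AE z in torus. (\<Sum>i. D i z * ?h z) = (\<Sum>i. D i z) * ?h z"
            using AE by eventually_elim (simp add: suminf_mult2 summable_norm_cancel)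
          have [measurable]: "D k \<in> borel_measurable torus" for k using Di by auto
          show "(\<lambda>z. (\<Sum>i. D i z * ?h z)) \<in> borel_measurable torus" by measurable
          show "(\<lambda>z. (\<Sum>i. D i z) * ?h z) \<in> borel_measurable torus" by measurable
        qed
        finally have "(\<lambda>n. (LINT z|torus. S (r 0) z * ?h z) + (\<Sum>i<n. LINT z|torus. D i z * ?h z)) \<longlonglongrightarrow>
            (LINT z|torus. S (r 0) z * ?h z) + (LINT z|torus. (\<Sum>i. D i z) * ?h z)"
          unfolding sums_def by (intro tendsto_intros)
        moreover have "(LINT z|torus. S (r 0) z * ?h z) + (\<Sum>i<n. LINT z|torus. D i z * ?h z) = (LINT z|torus. S (r n) z * ?h z)" for n
        proof -
          have "(LINT z|torus. D i z * ?h z) = (LINT z|torus. S (r (Suc i)) z * ?h z) - (LINT z|torus. S (r i) z * ?h z)" for i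
            unfolding D_def left_diff_distrib using integrable_mult_torus_char[OF Si] by simp
          then show ?thesis
            using sum_lessThan_telescope[of "\<lambda>i. LINT z|torus. S (r i) z * ?h z" n] by simp
        qed
        moreover have "(LINT z|torus. S (r 0) z * ?h z) + (LINT z|torus. (\<Sum>i. D i z) * ?h z) = (LINT z|torus. F z * ?h z)"
          unfolding F_def distrib_right
          using integrable_mult_torus_char[OF Si] integrable_mult_torus_char[OF integrable_suminf[OF Di AE sumD]] by simp
        ultimately show ?thesis by simp
      qed
      then have "(\<lambda>n. fourier_coeff (S (r n)) k l) \<longlonglongrightarrow> fourier_coeff F k l"
        unfolding fourier_coeff_eq by (intro tendsto_intros) auto
      moreover have "(\<lambda>n. fourier_coeff (S (r n)) k l) \<longlonglongrightarrow> c k l"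
      proof (cases "\<exists>N. (k, l) \<in> dyadic_freqs N")
        case True
        then obtain N where N: "(k, l) \<in> dyadic_freqs N" by blast
        have "fourier_coeff (S (r n)) k l = c k l" if "n \<ge> N" for n
          using N dyadic_freqs_mono[of N "r n"] that seq_suble[OF r(1), of n] by (auto simp: Scoeff)
        then show ?thesis by (intro tendsto_eventually) (auto simp: eventually_sequentially)
      next
        case False
        then show ?thesis by (simp add: Scoeff c0)
      qed
      ultimately show ?thesis by (rule LIMSEQ_unique)
    qed
    have "AE z in torus. u z - F z = 0"
      by (rule fourier_uniqueness) (use u Fi in \<open>auto simp: fourier_coeff_diff Fcoeff c_def\<close>)
    then have lim: "AE z in torus. ennreal (norm (u z) powr p) = liminf (\<lambda>k. ennreal (norm (S (r k) z) powr p))"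
      using conv
    proof eventually_elim
      case (elim z)
      then have "(\<lambda>k. ennreal (norm (S (r k) z) powr p)) \<longlonglongrightarrow> ennreal (norm (F z) powr p)"
        using p by (intro tendsto_intros tendsto_ennrealI) auto
      from lim_imp_Liminf[OF sequentially_bot this] show ?case using elim by simp
    qed
    have Sp: "(\<integral>\<^sup>+z. ennreal (norm (S N z) powr p) \<partial>torus) \<le> ennreal B" for N
    proof -
      have Smi: "integrable torus (\<lambda>z. norm (S N z) ^ (2 * m))"
        by (intro integrable_continuous_torus continuous_intros Sc)
      have ci: "integrable torus (\<lambda>z. 1 :: real)"
        by (rule finite_measure.integrable_const[OF finite_measure_torus])
      have "(\<integral>\<^sup>+z. ennreal (norm (S N z) powr p) \<partial>torus) \<le> (\<integral>\<^sup>+z. ennreal (1 + norm (S N z) ^ (2 * m)) \<partial>torus)"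
        using p by (intro nn_integral_mono ennreal_leI powr_le_one_plus_power m) auto
      also have "\<dots> = ennreal (LINT z|torus. 1 + norm (S N z) ^ (2 * m))"
        using Smi ci by (intro nn_integral_eq_integral) auto
      also have "(LINT z|torus. 1 + norm (S N z) ^ (2 * m)) = 4 * pi\<^sup>2 + (LINT z|torus. norm (S N z) ^ (2 * m))"
        using Smi ci measure_torus_cell by (simp add: measure_restrict_space)
      also have "\<dots> \<le> B"
        unfolding B_def S_def using integral_lacunary_sum_le[OF K Kpos ca1, of N] by simp
      finally show ?thesis by (simp add: ennreal_leI)
    qed
    have "(\<integral>\<^sup>+z. ennreal (norm (u z) powr p) \<partial>torus) = (\<integral>\<^sup>+z. liminf (\<lambda>k. ennreal (norm (S (r k) z) powr p)) \<partial>torus)"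
      by (rule nn_integral_cong_AE[OF lim])
    also have "\<dots> \<le> liminf (\<lambda>k. \<integral>\<^sup>+z. ennreal (norm (S (r k) z) powr p) \<partial>torus)"
      by (rule nn_integral_liminf) measurable
    also have "\<dots> \<le> liminf (\<lambda>k. ennreal B)"
      by (intro Liminf_mono always_eventually allI Sp)
    also have "\<dots> = ennreal B" by (simp add: Liminf_const)
    finally show ?thesis .
  qed
  then show ?thesis using B1 by blast
qed

text \<open>The squared \<open>l\<^sub>2\<close> norm of a double sequence, possibly infinite.\<close>

definition energy :: "(nat \<Rightarrow> nat \<Rightarrow> real) \<Rightarrow> ennreal" where
  "energy a = (\<Sum>j. \<Sum>k. ennreal ((a j k)\<^sup>2))"

lemma sum_le_energy: "ennreal (\<Sum>(j, k)\<in>{..<N} \<times> {..<N}. (a j k)\<^sup>2) \<le> energy a"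
proof -
  have "ennreal (\<Sum>(j, k)\<in>{..<N} \<times> {..<N}. (a j k)\<^sup>2) = (\<Sum>j<N. \<Sum>k<N. ennreal ((a j k)\<^sup>2))"
    by (subst sum_ennreal[symmetric]) (auto simp: sum.cartesian_product case_prod_beta' simp del: sum_ennreal)
  also have "\<dots> \<le> (\<Sum>j<N. \<Sum>k. ennreal ((a j k)\<^sup>2))"
    by (intro sum_mono sum_le_suminf) auto
  also have "\<dots> \<le> energy a"
    unfolding energy_def by (intro sum_le_suminf) auto
  finally show ?thesis .
qed

lemma energy_le:
  assumes le: "\<And>N. (\<Sum>(j, k)\<in>{..<N} \<times> {..<N}. (a j k)\<^sup>2) \<le> B"
  shows "energy a \<le> ennreal B"
  unfolding energy_def
proof (rule suminf_le_const)
  fix M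
  have "(\<Sum>j<M. \<Sum>k. ennreal ((a j k)\<^sup>2)) = (\<Sum>k. \<Sum>j<M. ennreal ((a j k)\<^sup>2))"
    by (rule suminf_sum[symmetric]) auto
  also have "\<dots> \<le> ennreal B"
  proof (rule suminf_le_const)
    fix L
    have "(\<Sum>k<L. \<Sum>j<M. ennreal ((a j k)\<^sup>2)) = (\<Sum>(k, j)\<in>{..<L} \<times> {..<M}. ennreal ((a j k)\<^sup>2))"
      by (simp add: sum.cartesian_product del: sum_ennreal)
    also have "\<dots> \<le> (\<Sum>(k, j)\<in>{..<max L M} \<times> {..<max L M}. ennreal ((a j k)\<^sup>2))"
      by (intro sum_mono2) auto
    also have "\<dots> = (\<Sum>(j, k)\<in>{..<max L M} \<times> {..<max L M}. ennreal ((a j k)\<^sup>2))"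
      by (simp flip: sum.cartesian_product del: sum_ennreal) (rule sum.swap)
    also have "\<dots> = ennreal (\<Sum>(j, k)\<in>{..<max L M} \<times> {..<max L M}. (a j k)\<^sup>2)"
      by (subst sum_ennreal[symmetric]) (auto simp: case_prod_beta' simp del: sum_ennreal)
    also have "\<dots> \<le> ennreal B" by (intro ennreal_leI le)
    finally show "(\<Sum>k<L. \<Sum>j<M. ennreal ((a j k)\<^sup>2)) \<le> ennreal B" .
  qed auto
  finally show "(\<Sum>j<M. \<Sum>k. ennreal ((a j k)\<^sup>2)) \<le> ennreal B" .
qed auto

lemma ennreal_powr_ennreal: "0 \<le> x \<Longrightarrow> ennreal_powr (ennreal x) a = ennreal (x powr a)"
  by (simp add: ennreal_powr_def)

lemma ennreal_powr_top [simp]: "ennreal_powr top a = top"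
  by (simp add: ennreal_powr_def)

lemma ennreal_powr_mono: "x \<le> y \<Longrightarrow> 0 \<le> a \<Longrightarrow> ennreal_powr x a \<le> ennreal_powr y a"
  by (cases x; cases y) (auto simp: ennreal_powr_ennreal top_unique intro!: ennreal_leI powr_mono2)

lemma ennreal_powr_half_square: "(ennreal_powr x (1 / 2))\<^sup>2 = x"
proof (cases x)
  case (real r)
  then show ?thesis by (simp add: ennreal_powr_ennreal ennreal_power powr_half_sqrt)
qed (simp add: power2_eq_square ennreal_mult_top)

lemma ennreal_powr_square_half: "ennreal_powr (x\<^sup>2) (1 / 2) = x"
proof (cases x)
  case (real r)
  then show ?thesis by (simp add: ennreal_powr_ennreal ennreal_power powr_half_sqrt)
qed (simp add: power2_eq_square ennreal_mult_top)

lemma Lp_norm_eq: "Lp_norm p u = ennreal_powr (\<integral>\<^sup>+z. ennreal (norm (u z) powr p) \<partial>torus) (1 / p)"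
  by (simp add: Lp_norm_def nn_integral_torus)

lemma Lp_norm_scale:
  assumes [measurable]: "u \<in> borel_measurable torus" and t: "0 < t" and p: "0 < p"
  shows "Lp_norm p (\<lambda>z. of_real t * u z) = ennreal t * Lp_norm p u"
proof -
  have "(\<integral>\<^sup>+z. ennreal (norm (of_real t * u z) powr p) \<partial>torus) =
      (\<integral>\<^sup>+z. ennreal (t powr p) * ennreal (norm (u z) powr p) \<partial>torus)"
    using t by (intro nn_integral_cong) (simp add: norm_mult powr_mult ennreal_mult)
  also have "\<dots> = ennreal (t powr p) * (\<integral>\<^sup>+z. ennreal (norm (u z) powr p) \<partial>torus)"
    by (rule nn_integral_cmult) measurable
  finally show ?thesis
    using t p by (cases "\<integral>\<^sup>+z. ennreal (norm (u z) powr p) \<partial>torus")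
      (auto simp: Lp_norm_eq ennreal_powr_ennreal powr_mult powr_powr ennreal_mult_top simp flip: ennreal_mult)
qed

lemma fourier_coeff_scale: "fourier_coeff (\<lambda>z. c * u z) m n = c * fourier_coeff u m n"
  by (simp add: fourier_coeff_eq mult.assoc)

lemma ennreal_le_square_limit:
  assumes "0 \<le> x" and le: "\<And>t. x < t \<Longrightarrow> X \<le> ennreal (K * t\<^sup>2)"
  shows "X \<le> ennreal (K * x\<^sup>2)"
proof -
  have "(\<lambda>n. ennreal (K * (x + inverse (real (Suc n)))\<^sup>2)) \<longlonglongrightarrow> ennreal (K * (x + 0)\<^sup>2)"
    by (intro tendsto_intros tendsto_ennrealI LIMSEQ_inverse_real_of_nat)
  then show ?thesis using le by (intro LIMSEQ_le_const[of _ _ X]) (auto intro!: le)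
qed

text \<open>The normalized bounds above become homogeneous by applying them to \<open>u / t\<close> for all \<open>t\<close> above
  the norm, respectively above the square root of the energy. Both inequalities hold also when
  one of the sides is infinite.\<close>

theorem Lp_norm_energy_equiv:
  assumes p: "1 < p"
  shows "\<exists>K::real. 1 \<le> K \<and> (\<forall>u a. integrable torus u \<longrightarrow> dyadic_spectrum u a \<longrightarrow>
    (Lp_norm p u)\<^sup>2 \<le> ennreal K * energy a \<and> energy a \<le> ennreal K * (Lp_norm p u)\<^sup>2)"
proof -
  obtain K1 where K1: "\<And>u N. u \<in> borel_measurable torus \<Longrightarrow>
    (\<integral>\<^sup>+z. ennreal (norm (u z) powr p) \<partial>torus) \<le> 1 \<Longrightarrow>
    (\<Sum>(j, k)\<in>{..<N} \<times> {..<N}. (norm (fourier_coeff u (2 ^ j) (2 ^ k)))\<^sup>2) \<le> K1"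
    using dyadic_coeffs_bounded[OF p] by blast
  obtain K2 where K2: "1 \<le> K2" "\<And>u a. integrable torus u \<Longrightarrow> dyadic_spectrum u a \<Longrightarrow>
    (\<And>N. (\<Sum>(j, k)\<in>{..<N} \<times> {..<N}. (a j k)\<^sup>2) \<le> 1) \<Longrightarrow>
    (\<integral>\<^sup>+z. ennreal (norm (u z) powr p) \<partial>torus) \<le> ennreal K2"
    using Lp_integral_bounded_of_dyadic_coeffs[OF p] by metis
  define K3 where "K3 = (K2 powr (1 / p))\<^sup>2"
  define K where "K = max 1 (max K1 K3)"
  have "(Lp_norm p u)\<^sup>2 \<le> ennreal K * energy a \<and> energy a \<le> ennreal K * (Lp_norm p u)\<^sup>2"
    if u: "integrable torus u" and spec: "dyadic_spectrum u a" for u a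
  proof
    have um [measurable]: "u \<in> borel_measurable torus" using u by simp
    define v where "v t z = of_real (inverse t) * u z" for t z
    have vi: "integrable torus (v t)" for t unfolding v_def using u by simp
    have vm: "v t \<in> borel_measurable torus" for t using vi by simp
    have vspec: "dyadic_spectrum (v t) (\<lambda>j k. a j k / t)" if "t > 0" for t
      using spec that unfolding dyadic_spectrum_def v_def fourier_coeff_scale
      by (auto simp: norm_mult norm_inverse divide_inverse mult.commute)
    have vnorm: "Lp_norm p u = ennreal t * Lp_norm p (v t)" if "t > 0" for t
      using Lp_norm_scale[OF vm[of t] that] p that by (simp add: v_def field_simps)
    have vnorm': "Lp_norm p (v t) = ennreal (inverse t) * Lp_norm p u" if "t > 0" for t
      unfolding v_def using that p by (intro Lp_norm_scale um) auto
    have asum: "(\<Sum>(j, k)\<in>{..<N} \<times> {..<N}. (a j k / t)\<^sup>2) = (\<Sum>(j, k)\<in>{..<N} \<times> {..<N}. (a j k)\<^sup>2) / t\<^sup>2" for N t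
      by (simp add: power_divide sum_divide_distrib case_prod_beta')
    show "(Lp_norm p u)\<^sup>2 \<le> ennreal K * energy a"
    proof (cases "energy a")
      case top
      then show ?thesis by (simp add: K_def ennreal_mult_top)
    next
      case (real e)
      have *: "(Lp_norm p u)\<^sup>2 \<le> ennreal (K3 * t\<^sup>2)" if t: "sqrt e < t" for t
      proof -
        have t0: "t > 0" using t real(1) by (meson le_less_trans real_sqrt_ge_zero)
        have "e \<le> t\<^sup>2" using t t0 by (metis less_imp_le real_sqrt_le_iff real_sqrt_abs abs_of_pos)
        have "(\<Sum>(j, k)\<in>{..<N} \<times> {..<N}. (a j k / t)\<^sup>2) \<le> 1" for N
        proof -
          have "(\<Sum>(j, k)\<in>{..<N} \<times> {..<N}. (a j k)\<^sup>2) \<le> e"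
            using sum_le_energy[of a N] real by simp
          then show ?thesis unfolding asum using \<open>e \<le> t\<^sup>2\<close> t0 by simp
        qed
        then have "(\<integral>\<^sup>+z. ennreal (norm (v t z) powr p) \<partial>torus) \<le> ennreal K2"
          by (intro K2(2)[OF vi vspec[OF t0]])
        then have "Lp_norm p (v t) \<le> ennreal_powr (ennreal K2) (1 / p)"
          unfolding Lp_norm_eq using p by (intro ennreal_powr_mono) auto
        then have "Lp_norm p u \<le> ennreal t * ennreal (K2 powr (1 / p))"
          unfolding vnorm[OF t0] using K2(1) by (intro mult_left_mono) (auto simp: ennreal_powr_ennreal)
        then have "(Lp_norm p u)\<^sup>2 \<le> (ennreal (t * K2 powr (1 / p)))\<^sup>2"
          using t0 by (intro power_mono) (auto simp: ennreal_mult)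
        also have "\<dots> = ennreal (K3 * t\<^sup>2)"
          using t0 by (simp add: ennreal_power K3_def power_mult_distrib mult.commute)
        finally show ?thesis .
      qed
      have "(Lp_norm p u)\<^sup>2 \<le> ennreal (K3 * (sqrt e)\<^sup>2)"
        by (rule ennreal_le_square_limit[OF _ *]) (use real(1) in simp_all)
      also have "\<dots> \<le> ennreal (K * e)"
        using real(1) by (auto intro!: ennreal_leI mult_right_mono simp: K_def)
      finally show ?thesis using real by (simp add: ennreal_mult K_def)
    qed
    show "energy a \<le> ennreal K * (Lp_norm p u)\<^sup>2"
    proof (cases "Lp_norm p u")
      case top
      then show ?thesis by (simp add: K_def ennreal_mult_top power2_eq_square)
    next
      case (real x)
      have *: "energy a \<le> ennreal (K1 * t\<^sup>2)" if t: "x < t" for t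
      proof (rule energy_le)
        fix N
        have t0: "t > 0" using t real(1) by linarith
        have "Lp_norm p (v t) = ennreal (x / t)"
          unfolding vnorm'[OF t0] real(2) using t0 real(1) by (subst ennreal_mult[symmetric]) (auto simp: divide_inverse mult.commute)
        also have "\<dots> \<le> ennreal 1" using t t0 real(1) by (intro ennreal_leI) simp
        finally have v1: "Lp_norm p (v t) \<le> 1" by simp
        have "(\<integral>\<^sup>+z. ennreal (norm (v t z) powr p) \<partial>torus) \<le> 1"
        proof (cases "\<integral>\<^sup>+z. ennreal (norm (v t z) powr p) \<partial>torus")
          case top
          then show ?thesis using v1 by (simp add: Lp_norm_eq top_unique)
        next
          case (real i)
          then have "i powr (1 / p) \<le> 1" using v1 by (simp add: Lp_norm_eq ennreal_powr_ennreal)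
          then have "(i powr (1 / p)) powr p \<le> 1 powr p" using p by (intro powr_mono2) auto
          then show ?thesis using real p by (simp add: powr_powr)
        qed
        then have "(\<Sum>(j, k)\<in>{..<N} \<times> {..<N}. (norm (fourier_coeff (v t) (2 ^ j) (2 ^ k)))\<^sup>2) \<le> K1"
          by (rule K1[OF vm])
        also have "(\<Sum>(j, k)\<in>{..<N} \<times> {..<N}. (norm (fourier_coeff (v t) (2 ^ j) (2 ^ k)))\<^sup>2) = 
            (\<Sum>(j, k)\<in>{..<N} \<times> {..<N}. (a j k / t)\<^sup>2)"
          using vspec[OF t0] unfolding dyadic_spectrum_def by (intro sum.cong) auto
        finally show "(\<Sum>(j, k)\<in>{..<N} \<times> {..<N}. (a j k)\<^sup>2) \<le> K1 * t\<^sup>2"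
          unfolding asum using t0 by (simp add: field_simps)
      qed
      have "energy a \<le> ennreal (K1 * x\<^sup>2)"
        by (rule ennreal_le_square_limit[OF real(1) *])
      also have "\<dots> \<le> ennreal (K * x\<^sup>2)"
        by (auto intro!: ennreal_leI mult_right_mono simp: K_def)
      finally show ?thesis using real by (simp add: ennreal_mult K_def ennreal_power)
    qed
  qed
  then show ?thesis by (intro exI[of _ K]) (auto simp: K_def)
qed


section \<open>Fourier coefficients of fractional differences\<close>

text \<open>The binomial coefficients are of order at most \<open>n powr (- \<alpha> - 1)\<close>.\<close>

lemma summable_abs_gbinomial:
  fixes \<alpha> :: real
  assumes "0 < \<alpha>"
  shows "summable (\<lambda>n. \<bar>\<alpha> gchoose n\<bar>)"
proof -
  have "Bseq (\<lambda>n. (\<alpha> gchoose n) / ((-1) ^ n / exp ((\<alpha> + 1) * of_real (ln (real n)))))"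
    by (rule convergent_imp_Bseq) (use gbinomial_asymptotic[of \<alpha>] in \<open>auto simp: convergent_def\<close>)
  then obtain B where B: "\<And>n. norm ((\<alpha> gchoose n) / ((-1) ^ n / exp ((\<alpha> + 1) * of_real (ln (real n))))) \<le> B"
    by (auto simp: Bseq_def)
  show ?thesis
  proof (rule summable_comparison_test')
    show "summable (\<lambda>n. B * real n powr (- (\<alpha> + 1)))"
      using assms by (intro summable_mult) (simp add: summable_real_powr_iff)
    fix n :: nat assume "n \<ge> 1"
    then show "norm \<bar>\<alpha> gchoose n\<bar> \<le> B * real n powr (- (\<alpha> + 1))"
    proof -
      define s where "s = (\<alpha> + 1) * ln (real n)"
      have "\<bar>\<alpha> gchoose n\<bar> * exp s \<le> B"
        using B[of n] by (simp add: abs_mult s_def)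
      then have "\<bar>\<alpha> gchoose n\<bar> * exp s * exp (- s) \<le> B * exp (- s)"
        by (intro mult_right_mono) auto
      moreover have "\<bar>\<alpha> gchoose n\<bar> * exp s * exp (- s) = \<bar>\<alpha> gchoose n\<bar>"
        by (simp add: mult.assoc flip: exp_add)
      moreover have "real n powr (- (\<alpha> + 1)) = exp (- s)"
        using \<open>n \<ge> 1\<close> by (simp add: powr_def s_def algebra_simps)
      ultimately show ?thesis by simp
    qed
  qed
qed

text \<open>By absolute convergence, the binomial theorem extends to the boundary of the unit disc.\<close>

lemma norm_binomial_series:
  fixes \<alpha> :: real and z :: complex
  assumes \<alpha>: "0 < \<alpha>" and z: "norm z \<le> 1"
  shows "norm (\<Sum>n. of_real (\<alpha> gchoose n) * z ^ n) = norm (1 + z) powr \<alpha>"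
proof -
  define P where "P z = (\<Sum>n. of_real (\<alpha> gchoose n) * z ^ n)" for z :: complex
  have ofr: "complex_of_real (\<alpha> gchoose n) = of_real \<alpha> gchoose n" for n
    by (simp add: gbinomial_prod_rev)
  have unif: "uniform_limit (cball 0 1) (\<lambda>n z. \<Sum>i<n. of_real (\<alpha> gchoose i) * z ^ i) P sequentially"
    unfolding P_def
  proof (rule Weierstrass_m_test[OF _ summable_abs_gbinomial[OF \<alpha>]])
    fix n and x :: complex assume "x \<in> cball 0 1"
    then have "norm x ^ n \<le> 1" by (intro power_le_one) auto
    then show "norm (of_real (\<alpha> gchoose n) * x ^ n) \<le> \<bar>\<alpha> gchoose n\<bar>"
      by (simp add: norm_mult norm_power mult_left_le)
  qed
  have Pc: "continuous_on (cball 0 1) P"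
    by (rule uniform_limit_theorem[OF _ unif]) (auto intro!: always_eventually continuous_intros)
  have inner: "norm (P x) = norm (1 + x) powr \<alpha>" if "norm x < 1" for x
  proof -
    have "P x = (1 + x) powr of_real \<alpha>"
      unfolding P_def ofr using gen_binomial_complex[OF that] by (simp add: sums_iff)
    then show ?thesis by (simp add: norm_powr_real_powr')
  qed
  define t where "t n = 1 - inverse (real (Suc n))" for n
  have t: "t \<longlonglongrightarrow> 1"
    unfolding t_def using tendsto_diff[OF tendsto_const LIMSEQ_inverse_real_of_nat, of 1] by simp
  have t01: "0 \<le> t n" "t n < 1" for n by (simp_all add: t_def field_simps)
  have small: "norm (of_real (t n) * z) < 1" for n
    using mult_left_le[OF z t01(1)[of n]] t01[of n] by (simp add: norm_mult)
  have lim: "(\<lambda>n. of_real (t n) * z) \<longlonglongrightarrow> z"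
    using tendsto_mult[OF tendsto_of_real[OF t] tendsto_const[of z]] by simp
  have "(\<lambda>n. P (of_real (t n) * z)) \<longlonglongrightarrow> P z"
    by (rule continuous_on_tendsto_compose[OF Pc lim]) (use z small in \<open>auto intro!: always_eventually less_imp_le\<close>)
  then have "(\<lambda>n. norm (P (of_real (t n) * z))) \<longlonglongrightarrow> norm (P z)" by (rule tendsto_norm)
  moreover have "(\<lambda>n. norm (P (of_real (t n) * z))) \<longlonglongrightarrow> norm (1 + z) powr \<alpha>"
    unfolding inner[OF small] using \<alpha> lim by (intro tendsto_intros) auto
  ultimately show ?thesis unfolding P_def by (rule LIMSEQ_unique)
qed

text \<open>The multiplier by which a difference of order \<open>\<alpha>\<close> acts on a character; \<open>t\<close> is the frequency times
  the step.\<close>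

lemma norm_difference_symbol:
  fixes \<alpha> t :: real
  assumes \<alpha>: "0 < \<alpha>"
  shows "norm (\<Sum>\<nu>. ((- 1) ^ \<nu> * complex_of_real (\<alpha> gchoose \<nu>)) * cis ((\<alpha> - real \<nu>) * t)) = \<bar>2 * sin (t / 2)\<bar> powr \<alpha>"
proof -
  have eq: "((- 1) ^ \<nu> * complex_of_real (\<alpha> gchoose \<nu>)) * cis ((\<alpha> - real \<nu>) * t) =
      cis (\<alpha> * t) * (complex_of_real (\<alpha> gchoose \<nu>) * (- cis (- t)) ^ \<nu>)" for \<nu>
  proof -
    have "cis ((\<alpha> - real \<nu>) * t) = cis (\<alpha> * t) * cis (- t) ^ \<nu>"
      by (simp add: Complex.DeMoivre cis_mult algebra_simps)
    then show ?thesis by (simp add: power_minus[of "cis (- t)"])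
  qed
  have sm: "summable (\<lambda>\<nu>. complex_of_real (\<alpha> gchoose \<nu>) * (- cis (- t)) ^ \<nu>)"
    by (rule summable_norm_cancel) (simp add: norm_mult norm_power summable_abs_gbinomial[OF \<alpha>])
  have "norm (\<Sum>\<nu>. ((- 1) ^ \<nu> * complex_of_real (\<alpha> gchoose \<nu>)) * cis ((\<alpha> - real \<nu>) * t)) =
      norm (\<Sum>\<nu>. complex_of_real (\<alpha> gchoose \<nu>) * (- cis (- t)) ^ \<nu>)"
    unfolding eq suminf_mult[OF sm] norm_mult by simp
  also have "\<dots> = norm (1 - cis (- t)) powr \<alpha>"
    using norm_binomial_series[OF \<alpha>, of "- cis (- t)"] by simp
  also have "norm (1 - cis (- t)) = \<bar>2 * sin (t / 2)\<bar>"
  proof -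
    have "(norm (1 - cis (- t)))\<^sup>2 = (1 - cos t)\<^sup>2 + (sin t)\<^sup>2"
      by (simp add: cmod_power2)
    also have "\<dots> = 2 * (1 - cos t)"
      using sin_cos_squared_add[of t] by (simp add: power2_diff)
    also have "\<dots> = (2 * sin (t / 2))\<^sup>2"
      using cos_double_sin[of "t / 2"] by (simp add: power_mult_distrib)
    finally show ?thesis using power2_eq_iff_nonneg[of "norm (1 - cis (- t))" "\<bar>2 * sin (t / 2)\<bar>"] by simp
  qed
  finally show ?thesis .
qed

lemma fourier_coeff_shift:
  assumes F [measurable]: "F \<in> borel_measurable lebesgue" "biperiodic F" "integrable torus F"
  shows "fourier_coeff (\<lambda>z. F (z + w)) m n = torus_char m n w * fourier_coeff F m n"
proof -
  have "(LINT z|torus. F (z + w) * torus_char (- m) (- n) z) =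
      (LINT z|torus. torus_char m n w * (F (z + w) * torus_char (- m) (- n) (z + w)))"
  proof (intro Bochner_Integration.integral_cong refl)
    fix z
    have "torus_char m n w * torus_char (- m) (- n) w = 1"
      by (simp add: torus_char_mult) (simp add: torus_char_def)
    then show "F (z + w) * torus_char (- m) (- n) z =
      torus_char m n w * (F (z + w) * torus_char (- m) (- n) (z + w))"
      by (simp add: torus_char_shift)
  qed
  also have "\<dots> = torus_char m n w * (LINT z|torus. F (z + w) * torus_char (- m) (- n) (z + w))"
    by simp
  also have "(LINT z|torus. F (z + w) * torus_char (- m) (- n) (z + w)) = (LINT z|torus. F z * torus_char (- m) (- n) z)"
  proof (rule integral_torus_shift(2)[of "\<lambda>z. F z * torus_char (- m) (- n) z"])
    show "integrable torus (\<lambda>z. F z * torus_char (- m) (- n) z)"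
      by (rule Bochner_Integration.integrable_bound[OF F(3)]) (auto simp: norm_mult)
  qed (auto intro: biperiodic_mult F biperiodic_torus_char)
  finally show ?thesis by (simp add: fourier_coeff_eq)
qed

text \<open>An absolutely convergent combination of translates acts on Fourier coefficients as a multiplier.\<close>

lemma shift_series:
  fixes a :: "nat \<Rightarrow> complex" and w :: "nat \<Rightarrow> real \<times> real"
  assumes F [measurable]: "F \<in> borel_measurable lebesgue" "biperiodic F" "integrable torus F"
    and a: "summable (\<lambda>i. norm (a i))"
  defines "G \<equiv> \<lambda>z. \<Sum>i. a i * F (z + w i)"
  shows "G \<in> borel_measurable lebesgue" "biperiodic G" "integrable torus G"
    "fourier_coeff G m n = (\<Sum>i. a i * torus_char m n (w i)) * fourier_coeff F m n"
proof -
  have Fs [measurable]: "(\<lambda>z. F (z + w i)) \<in> borel_measurable lebesgue" for i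
    by (rule measurable_shift) fact
  show "G \<in> borel_measurable lebesgue" unfolding G_def by measurable
  show "biperiodic G"
    using biperiodic_shift[OF F(2)] unfolding G_def biperiodic_def by simp
  define T where "T i z = a i * F (z + w i)" for i z
  have Ti: "integrable torus (T i)" for i
    unfolding T_def using integral_torus_shift(1)[OF F] by simp
  have Tn: "(\<integral>\<^sup>+z. ennreal (norm (T i z)) \<partial>torus) = ennreal (norm (a i)) * (\<integral>\<^sup>+z. ennreal (norm (F z)) \<partial>torus)" for i
  proof -
    have "(\<integral>\<^sup>+z. ennreal (norm (T i z)) \<partial>torus) = (\<integral>\<^sup>+z. ennreal (norm (a i)) * ennreal (norm (F (z + w i))) \<partial>torus)"
      by (simp add: T_def norm_mult ennreal_mult)
    also have "\<dots> = ennreal (norm (a i)) * (\<integral>\<^sup>+z. ennreal (norm (F (z + w i))) \<partial>torus)"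
      by (rule nn_integral_cmult) measurable
    also have "(\<integral>\<^sup>+z. ennreal (norm (F (z + w i))) \<partial>torus) = (\<integral>\<^sup>+z. ennreal (norm (F z)) \<partial>torus)"
      by (rule nn_integral_torus_shift[where F = "\<lambda>z. ennreal (norm (F z))"]) 
        (simp_all add: biperiodicD[OF F(2)])
    finally show ?thesis .
  qed
  define I where "I = (LINT z|torus. norm (F z))"
  have Ieq: "(\<integral>\<^sup>+z. ennreal (norm (F z)) \<partial>torus) = ennreal I"
    unfolding I_def using F(3) by (intro nn_integral_eq_integral) auto
  have I0: "0 \<le> I" by (simp add: I_def)
  have TI: "(LINT z|torus. norm (T i z)) = norm (a i) * I" for i
  proof -
    have "ennreal (LINT z|torus. norm (T i z)) = (\<integral>\<^sup>+z. ennreal (norm (T i z)) \<partial>torus)"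
      using Ti by (intro nn_integral_eq_integral[symmetric]) auto
    also have "\<dots> = ennreal (norm (a i) * I)" by (simp add: Tn Ieq ennreal_mult I0)
    finally show ?thesis using I0 by (simp add: ennreal_inj)
  qed
  have sumT: "summable (\<lambda>i. LINT z|torus. norm (T i z))"
    unfolding TI using a by (rule summable_mult2)
  have AE: "AE z in torus. summable (\<lambda>i. norm (T i z))"
  proof -
    have "(\<integral>\<^sup>+z. (\<Sum>k. ennreal (norm (T k z))) \<partial>torus) = (\<Sum>k. \<integral>\<^sup>+z. ennreal (norm (T k z)) \<partial>torus)"
      using Ti by (intro nn_integral_suminf) auto
    also have "\<dots> = (\<Sum>k. ennreal (LINT z|torus. norm (T k z)))"
      using Ti by (simp add: nn_integral_eq_integral)
    also have "\<dots> \<noteq> \<infinity>" using sumT by (simp add: ennreal_suminf_neq_top)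
    finally have "AE z in torus. (\<Sum>k. ennreal (norm (T k z))) \<noteq> \<infinity>"
      using Ti by (intro nn_integral_noteq_infinite) auto
    then show ?thesis by eventually_elim (auto intro: summable_suminf_not_top)
  qed
  show "integrable torus G"
    using integrable_suminf[OF Ti AE sumT] by (simp add: G_def T_def)
  let ?h = "torus_char (- m) (- n)"
  have Th: "integrable torus (\<lambda>z. T i z * ?h z)" for i
    by (rule Bochner_Integration.integrable_bound[OF Ti[of i]]) (use Ti in \<open>auto simp: norm_mult\<close>)
  have "(\<lambda>i. LINT z|torus. T i z * ?h z) sums (LINT z|torus. (\<Sum>i. T i z * ?h z))"
    by (rule sums_integral) (use AE sumT Th in \<open>auto simp: norm_mult\<close>)
  also have "(LINT z|torus. (\<Sum>i. T i z * ?h z)) = (LINT z|torus. G z * ?h z)"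
  proof (rule integral_cong_AE)
    show "AE z in torus. (\<Sum>i. T i z * ?h z) = G z * ?h z"
      using AE by eventually_elim (simp add: suminf_mult2 summable_norm_cancel G_def T_def)
    have [measurable]: "T k \<in> borel_measurable torus" for k using Ti by auto
    have [measurable]: "G \<in> borel_measurable torus" using \<open>integrable torus G\<close> by auto
    show "(\<lambda>z. (\<Sum>i. T i z * ?h z)) \<in> borel_measurable torus" by measurable
    show "(\<lambda>z. G z * ?h z) \<in> borel_measurable torus" by measurable
  qed
  finally have "(\<lambda>i. (LINT z|torus. T i z * ?h z) / (4 * pi\<^sup>2)) sums fourier_coeff G m n"
    unfolding fourier_coeff_eq by (rule sums_divide)
  moreover have "(LINT z|torus. T i z * ?h z) / (4 * pi\<^sup>2) = a i * torus_char m n (w i) * fourier_coeff F m n" for i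
    using fourier_coeff_shift[OF F, of "w i" m n] by (simp add: T_def fourier_coeff_eq mult.assoc)
  ultimately have "(\<lambda>i. a i * torus_char m n (w i) * fourier_coeff F m n) sums fourier_coeff G m n" by simp
  moreover have "summable (\<lambda>i. a i * torus_char m n (w i))"
    by (rule summable_norm_cancel) (simp add: norm_mult a)
  ultimately show "fourier_coeff G m n = (\<Sum>i. a i * torus_char m n (w i)) * fourier_coeff F m n"
    by (simp add: sums_iff suminf_mult2)
qed

lemma
  assumes F: "F \<in> borel_measurable lebesgue" "biperiodic F" "integrable torus F"
    and \<alpha>: "0 < \<alpha>"
  shows diff_x_regular: "diff_x \<alpha> h F \<in> borel_measurable lebesgue" "biperiodic (diff_x \<alpha> h F)"
      "integrable torus (diff_x \<alpha> h F)"
    and norm_fourier_coeff_diff_x: "norm (fourier_coeff (diff_x \<alpha> h F) m n) =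
      \<bar>2 * sin (of_int m * h / 2)\<bar> powr \<alpha> * norm (fourier_coeff F m n)"
proof -
  define a where "a i = (- 1) ^ i * complex_of_real (\<alpha> gchoose i)" for i
  define w where "w i = ((\<alpha> - real i) * h, 0 :: real)" for i
  have a: "summable (\<lambda>i. norm (a i))"
    using summable_abs_gbinomial[OF \<alpha>] by (simp add: a_def norm_mult norm_power)
  have eq: "diff_x \<alpha> h F = (\<lambda>z. \<Sum>i. a i * F (z + w i))"
    by (auto simp: diff_x_def a_def w_def fun_eq_iff)
  note S = shift_series[OF F a, of w]
  show "diff_x \<alpha> h F \<in> borel_measurable lebesgue" "biperiodic (diff_x \<alpha> h F)"
      "integrable torus (diff_x \<alpha> h F)"
    unfolding eq by (rule S)+
  have "torus_char m n (w i) = cis ((\<alpha> - real i) * (of_int m * h))" for i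
    by (simp add: torus_char_def w_def mult_ac)
  then show "norm (fourier_coeff (diff_x \<alpha> h F) m n) =
      \<bar>2 * sin (of_int m * h / 2)\<bar> powr \<alpha> * norm (fourier_coeff F m n)"
    unfolding eq S(4) norm_mult using norm_difference_symbol[OF \<alpha>, of "of_int m * h"] by (simp add: a_def)
qed

lemma
  assumes F: "F \<in> borel_measurable lebesgue" "biperiodic F" "integrable torus F"
    and \<alpha>: "0 < \<alpha>"
  shows diff_y_regular: "diff_y \<alpha> h F \<in> borel_measurable lebesgue" "biperiodic (diff_y \<alpha> h F)"
      "integrable torus (diff_y \<alpha> h F)"
    and norm_fourier_coeff_diff_y: "norm (fourier_coeff (diff_y \<alpha> h F) m n) =
      \<bar>2 * sin (of_int n * h / 2)\<bar> powr \<alpha> * norm (fourier_coeff F m n)"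
proof -
  define a where "a i = (- 1) ^ i * complex_of_real (\<alpha> gchoose i)" for i
  define w where "w i = (0 :: real, (\<alpha> - real i) * h)" for i
  have a: "summable (\<lambda>i. norm (a i))"
    using summable_abs_gbinomial[OF \<alpha>] by (simp add: a_def norm_mult norm_power)
  have eq: "diff_y \<alpha> h F = (\<lambda>z. \<Sum>i. a i * F (z + w i))"
    by (auto simp: diff_y_def a_def w_def fun_eq_iff)
  note S = shift_series[OF F a, of w]
  show "diff_y \<alpha> h F \<in> borel_measurable lebesgue" "biperiodic (diff_y \<alpha> h F)"
      "integrable torus (diff_y \<alpha> h F)"
    unfolding eq by (rule S)+
  have "torus_char m n (w i) = cis ((\<alpha> - real i) * (of_int n * h))" for i
    by (simp add: torus_char_def w_def mult_ac)
  then show "norm (fourier_coeff (diff_y \<alpha> h F) m n) =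
      \<bar>2 * sin (of_int n * h / 2)\<bar> powr \<alpha> * norm (fourier_coeff F m n)"
    unfolding eq S(4) norm_mult using norm_difference_symbol[OF \<alpha>, of "of_int n * h"] by (simp add: a_def)
qed


section \<open>Double series\<close>

text \<open>The sum of a nonnegative double sequence; negative terms count as zero.\<close>

definition dsum :: "(nat \<Rightarrow> nat \<Rightarrow> real) \<Rightarrow> ennreal" where
  "dsum w = (\<Sum>j. \<Sum>k. ennreal (w j k))"

lemma energy_dsum: "energy a = dsum (\<lambda>j k. (a j k)\<^sup>2)"
  by (simp add: energy_def dsum_def)

lemma dsum_mono: "(\<And>j k. v j k \<le> w j k) \<Longrightarrow> dsum v \<le> dsum w"
  unfolding dsum_def by (intro suminf_le ennreal_leI) auto

lemma dsum_cmult: "0 \<le> c \<Longrightarrow> (\<And>j k. 0 \<le> w j k) \<Longrightarrow> dsum (\<lambda>j k. c * w j k) = ennreal c * dsum w"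
  unfolding dsum_def by (simp add: ennreal_mult)

lemma nn_integral_dsum:
  fixes u v :: "nat \<Rightarrow> real \<Rightarrow> real" and b :: "nat \<Rightarrow> nat \<Rightarrow> real"
  assumes [measurable]: "\<And>j. u j \<in> borel_measurable borel" "\<And>k. v k \<in> borel_measurable borel"
      "A \<in> sets borel" "B \<in> sets borel"
    and pos: "\<And>j x. 0 \<le> u j x" "\<And>k y. 0 \<le> v k y" "\<And>j k. 0 \<le> b j k"
  shows "(\<integral>\<^sup>+x\<in>A. (\<integral>\<^sup>+y\<in>B. dsum (\<lambda>j k. u j x * v k y * b j k) \<partial>lborel) \<partial>lborel) =
    (\<Sum>j. \<Sum>k. ennreal (b j k) * ((\<integral>\<^sup>+x\<in>A. ennreal (u j x) \<partial>lborel) * (\<integral>\<^sup>+y\<in>B. ennreal (v k y) \<partial>lborel)))"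
proof -
  define V where "V k = (\<integral>\<^sup>+y\<in>B. ennreal (v k y) \<partial>lborel)" for k
  have "(\<integral>\<^sup>+y\<in>B. dsum (\<lambda>j k. u j x * v k y * b j k) \<partial>lborel) = (\<Sum>j. \<Sum>k. ennreal (b j k) * (ennreal (u j x) * V k))" for x
  proof -
    have "(\<integral>\<^sup>+y\<in>B. dsum (\<lambda>j k. u j x * v k y * b j k) \<partial>lborel) =
        (\<integral>\<^sup>+y. (\<Sum>j. \<Sum>k. (ennreal (b j k) * ennreal (u j x)) * (ennreal (v k y) * indicator B y)) \<partial>lborel)"
      unfolding dsum_def using pos by (intro nn_integral_cong) (simp add: ennreal_mult mult_ac flip: ennreal_suminf_multc)
    also have "\<dots> = (\<Sum>j. \<Sum>k. (\<integral>\<^sup>+y. (ennreal (b j k) * ennreal (u j x)) * (ennreal (v k y) * indicator B y) \<partial>lborel))"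
      by (subst nn_integral_suminf, measurable, subst nn_integral_suminf, measurable)
    also have "\<dots> = (\<Sum>j. \<Sum>k. (ennreal (b j k) * ennreal (u j x)) * V k)"
      unfolding V_def by (intro suminf_cong nn_integral_cmult) measurable
    finally show ?thesis by (simp add: mult.assoc)
  qed
  then have "(\<integral>\<^sup>+x\<in>A. (\<integral>\<^sup>+y\<in>B. dsum (\<lambda>j k. u j x * v k y * b j k) \<partial>lborel) \<partial>lborel) =
      (\<integral>\<^sup>+x. (\<Sum>j. \<Sum>k. (ennreal (b j k) * V k) * (ennreal (u j x) * indicator A x)) \<partial>lborel)"
    by (intro nn_integral_cong) (simp add: mult_ac flip: ennreal_suminf_multc ennreal_suminf_cmult)
  also have "\<dots> = (\<Sum>j. \<Sum>k. (\<integral>\<^sup>+x. (ennreal (b j k) * V k) * (ennreal (u j x) * indicator A x) \<partial>lborel))"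
    by (subst nn_integral_suminf, measurable, subst nn_integral_suminf, measurable)
  also have "\<dots> = (\<Sum>j. \<Sum>k. (ennreal (b j k) * V k) * (\<integral>\<^sup>+x\<in>A. ennreal (u j x) \<partial>lborel))"
    by (intro suminf_cong nn_integral_cmult) measurable
  finally show ?thesis by (simp add: V_def mult_ac)
qed

section \<open>One-dimensional estimates\<close>

lemma abs_two_sin_le: "0 \<le> (N::real) \<Longrightarrow> \<bar>h\<bar> \<le> \<delta> \<Longrightarrow> \<bar>2 * sin (N * h / 2)\<bar> \<le> 2 * min 1 (N * \<delta>)"
proof -
  assume N: "0 \<le> N" and h: "\<bar>h\<bar> \<le> \<delta>"
  have "\<bar>sin (N * h / 2)\<bar> \<le> \<bar>N * h / 2\<bar>" by (rule abs_sin_x_le_abs_x)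
  also have "\<dots> \<le> N * \<delta> / 2" using N h by (simp add: abs_mult mult_left_mono)
  finally have "\<bar>2 * sin (N * h / 2)\<bar> \<le> N * \<delta>" by (simp add: abs_mult)
  moreover have "0 \<le> N * \<delta>" using N h by (intro mult_nonneg_nonneg) auto
  moreover have "\<bar>2 * sin (N * h / 2)\<bar> \<le> 2" using abs_sin_le_one[of "N * h / 2"] by (simp add: abs_mult)
  ultimately show ?thesis by (auto simp: min_def)
qed

lemma half_le_sin:
  fixes x :: real
  assumes "0 \<le> x" "x \<le> 1"
  shows "x / 2 \<le> sin x"
proof -
  have "sin 0 - 0 / 2 \<le> sin x - x / 2"
  proof (rule DERIV_nonneg_imp_nondecreasing[OF assms(1)])
    fix t :: real assume t: "0 \<le> t" "t \<le> x"
    have "cos (pi / 3) \<le> cos t"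
      using t assms pi_gt3 by (intro cos_monotone_0_pi_le) auto
    then have "0 \<le> cos t - 1 / 2" by (simp add: cos_60)
    moreover have "((\<lambda>x. sin x - x / 2) has_real_derivative cos t - 1 / 2) (at t)"
      by (auto intro!: derivative_eq_intros)
    ultimately show "\<exists>y. ((\<lambda>x. sin x - x / 2) has_real_derivative y) (at t) \<and> 0 \<le> y" by blast
  qed
  then show ?thesis by simp
qed

text \<open>Two translates of a sine cannot both be small if their distance is a suitable fraction of the
  wave length. The mean value over \<open>{0<..<\<delta>}\<close> is therefore bounded below in terms of \<open>min 1 (N * \<delta>)\<close> alone.\<close>

lemma nn_integral_sin_powr_ge:
  assumes N: "0 < N" and \<delta>: "0 < \<delta>" and a: "0 < a"
  shows "ennreal (\<delta> / 4 * (min 1 (N * \<delta>) / 8) powr a) \<le>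
    (\<integral>\<^sup>+h\<in>{0<..<\<delta>}. ennreal (\<bar>2 * sin (N * h / 2)\<bar> powr a) \<partial>lborel)"
proof -
  \<comment> \<open>The shift: at most half of the interval, and at most a quarter radian in the argument of the sine.\<close>
  define \<tau> where "\<tau> = min (\<delta> / 2) (1 / (2 * N))"
  define c where "c = (min 1 (N * \<delta>) / 8) powr a"
  define S where "S h = \<bar>2 * sin (N * h / 2)\<bar> powr a" for h
  define X where "X = (\<integral>\<^sup>+h\<in>{0<..<\<delta>}. ennreal (S h) \<partial>lborel)"
  have Sm [measurable]: "S \<in> borel_measurable borel" unfolding S_def by measurable
  have \<tau>: "0 < \<tau>" "\<tau> \<le> \<delta> / 2" using N \<delta> by (auto simp: \<tau>_def)
  have \<eta>: "min 1 (N * \<delta>) / 4 \<le> N * \<tau> / 2"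
    using N \<delta> by (auto simp: \<tau>_def min_def field_simps)
  have \<eta>1: "N * \<tau> / 2 \<le> 1" using N \<delta> by (auto simp: \<tau>_def min_def field_simps)
  have pt: "c \<le> S h + S (h + \<tau>)" for h
  proof -
    define x where "x = N * h / 2"
    define e where "e = N * \<tau> / 2"
    have e: "0 \<le> e" "e \<le> 1" "min 1 (N * \<delta>) / 4 \<le> e" using N \<tau> \<eta> \<eta>1 by (auto simp: e_def)
    \<comment> \<open>One of \<open>\<bar>sin x\<bar>\<close> and \<open>\<bar>sin (x + e)\<bar>\<close> is at least half of \<open>sin e\<close>.\<close>
    have "sin e = sin (x + e) * cos x - cos (x + e) * sin x"
      using sin_diff[of "x + e" x] by simp
    also have "\<dots> \<le> \<bar>sin (x + e)\<bar> * 1 + 1 * \<bar>sin x\<bar>"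
    proof -
      have "\<bar>sin (x + e) * cos x\<bar> \<le> \<bar>sin (x + e)\<bar> * 1" unfolding abs_mult by (intro mult_left_mono) auto
      moreover have "\<bar>cos (x + e) * sin x\<bar> \<le> 1 * \<bar>sin x\<bar>" unfolding abs_mult by (intro mult_right_mono) auto
      ultimately show ?thesis by linarith
    qed
    finally have "sin e \<le> 2 * max \<bar>sin x\<bar> \<bar>sin (x + e)\<bar>" by linarith
    moreover have "e / 2 \<le> sin e" using e by (intro half_le_sin)
    ultimately have "min 1 (N * \<delta>) / 8 \<le> max \<bar>2 * sin x\<bar> \<bar>2 * sin (x + e)\<bar>" using e(3) by (simp add: abs_mult max_def split: if_splits)
    moreover have "0 \<le> min 1 (N * \<delta>) / 8" using N \<delta> by auto
    ultimately have "c \<le> max \<bar>2 * sin x\<bar> \<bar>2 * sin (x + e)\<bar> powr a" unfolding c_def using a by (intro powr_mono2) auto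
    also have "\<dots> \<le> \<bar>2 * sin x\<bar> powr a + \<bar>2 * sin (x + e)\<bar> powr a" by (auto simp: max_def)
    also have "\<dots> = S h + S (h + \<tau>)" by (simp add: S_def x_def e_def distrib_left add_divide_distrib)
    finally show ?thesis .
  qed
  have S0: "0 \<le> S h" for h by (simp add: S_def)
  have "ennreal (\<delta> / 2 * c) = (\<integral>\<^sup>+h\<in>{0<..<\<delta>/2}. ennreal c \<partial>lborel)"
  proof -
    have "(\<integral>\<^sup>+h\<in>{0<..<\<delta>/2}. ennreal c \<partial>lborel) = ennreal c * emeasure lborel {0<..<\<delta>/2}"
      by (rule nn_integral_cmult_indicator) simp
    then show ?thesis using \<delta> by (simp add: c_def mult.commute flip: ennreal_mult)
  qed
  also have "\<dots> \<le> (\<integral>\<^sup>+h. ennreal (S h) * indicator {0<..<\<delta>/2} h + ennreal (S (h + \<tau>)) * indicator {0<..<\<delta>/2} h \<partial>lborel)"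
  proof (rule nn_integral_mono)
    fix h
    have "ennreal c \<le> ennreal (S h) + ennreal (S (h + \<tau>))"
      using pt[of h] S0 by (simp flip: ennreal_plus)
    then show "ennreal c * indicator {0<..<\<delta>/2} h \<le> ennreal (S h) * indicator {0<..<\<delta>/2} h + ennreal (S (h + \<tau>)) * indicator {0<..<\<delta>/2} h"
      by (simp add: indicator_def)
  qed
  also have "\<dots> = (\<integral>\<^sup>+h. ennreal (S h) * indicator {0<..<\<delta>/2} h \<partial>lborel) + (\<integral>\<^sup>+h. ennreal (S (h + \<tau>)) * indicator {0<..<\<delta>/2} h \<partial>lborel)"
    by (rule nn_integral_add) measurable
  also have "(\<integral>\<^sup>+h. ennreal (S (h + \<tau>)) * indicator {0<..<\<delta>/2} h \<partial>lborel) = (\<integral>\<^sup>+h. ennreal (S h) * indicator {\<tau><..<\<tau>+\<delta>/2} h \<partial>lborel)"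
    by (subst nn_integral_real_affine[where c = 1 and t = \<tau>, of "\<lambda>h. ennreal (S h) * indicator {\<tau><..<\<tau>+\<delta>/2} h"])
      (auto simp: add.commute indicator_def intro!: nn_integral_cong)
  also have "\<dots> \<le> X"
    unfolding X_def using \<tau> by (intro nn_integral_mono mult_left_mono) (auto simp: indicator_def)
  also have "(\<integral>\<^sup>+h. ennreal (S h) * indicator {0<..<\<delta>/2} h \<partial>lborel) \<le> X"
    unfolding X_def using \<delta> by (intro nn_integral_mono mult_left_mono) (auto simp: indicator_def)
  finally have *: "ennreal (\<delta> / 2 * c) \<le> X + X" by (simp add: add_mono)
  have "ennreal (\<delta> / 4 * c) \<le> X"
  proof (cases X)
    case (real x)
    then have "\<delta> / 2 * c \<le> x + x" using * by (simp flip: ennreal_plus)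
    then show ?thesis using real by (simp add: ennreal_leI)
  qed simp
  then show ?thesis by (simp add: X_def S_def c_def)
qed

lemma
  assumes N: "0 < N" and \<delta>: "0 < \<delta>" and r: "0 < r" and \<beta>: "0 < \<beta>"
  defines "I \<equiv> (\<integral>\<^sup>+t\<in>{0<..<\<delta>}. ennreal (t powr (- 2 * r - 1) * min 1 (N * t) powr (2 * (r + \<beta>))) \<partial>lborel)"
  shows weight_integral_ge: "ennreal (1 / (2 * \<beta>) * (N powr (2 * r) * min 1 (N * \<delta>) powr (2 * \<beta>))) \<le> I"
    and weight_integral_le: "I \<le> ennreal ((1 / (2 * \<beta>) + 1 / (2 * r)) * (N powr (2 * r) * min 1 (N * \<delta>) powr (2 * \<beta>)))"
proof -
  \<comment> \<open>The point up to which \<open>min 1 (N * t) = N * t\<close>.\<close>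
  define c where "c = min \<delta> (1 / N)"
  have c: "0 < c" "c \<le> \<delta>" "c \<le> 1 / N" using N \<delta> by (auto simp: c_def)
  have Nc: "N * c = min 1 (N * \<delta>)" using N by (auto simp: c_def min_def field_simps)
  define g where "g t = N powr (2 * (r + \<beta>)) * t powr (2 * \<beta> - 1)" for t
  have "((\<lambda>t. t powr (2 * \<beta> - 1)) has_integral c powr (2 * \<beta> - 1 + 1) / (2 * \<beta> - 1 + 1)) {0..c}"
    using \<beta> c by (intro has_integral_powr_from_0) auto
  then have "(g has_integral N powr (2 * (r + \<beta>)) * (c powr (2 * \<beta>) / (2 * \<beta>))) {0..c}"
    unfolding g_def by (intro has_integral_mult_right) simp
  moreover have "N powr (2 * (r + \<beta>)) * (c powr (2 * \<beta>) / (2 * \<beta>)) = 1 / (2 * \<beta>) * (N powr (2 * r) * min 1 (N * \<delta>) powr (2 * \<beta>))"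
    using N c by (simp add: powr_add distrib_left powr_mult flip: Nc)
  ultimately have "(g has_integral 1 / (2 * \<beta>) * (N powr (2 * r) * min 1 (N * \<delta>) powr (2 * \<beta>))) {0..c}"
    by (simp only:)
  then have gI: "(\<integral>\<^sup>+t. ennreal (g t) * indicator {0..c} t \<partial>lborel) =
      ennreal (1 / (2 * \<beta>) * (N powr (2 * r) * min 1 (N * \<delta>) powr (2 * \<beta>)))"
    by (intro nn_integral_has_integral_lebesgue') (simp add: g_def)
  have g_eq: "t powr (- 2 * r - 1) * min 1 (N * t) powr (2 * (r + \<beta>)) = g t" if "0 < t" "t \<le> c" for t
  proof -
    have "N * t \<le> N * c" using that N by simp
    also have "\<dots> \<le> 1" by (simp add: Nc)
    finally have "min 1 (N * t) = N * t" by simp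
    then have "t powr (- 2 * r - 1) * min 1 (N * t) powr (2 * (r + \<beta>)) =
        N powr (2 * (r + \<beta>)) * (t powr (- 2 * r - 1) * t powr (2 * (r + \<beta>)))"
      using that N by (simp add: powr_mult)
    also have "t powr (- 2 * r - 1) * t powr (2 * (r + \<beta>)) = t powr (2 * \<beta> - 1)"
      by (simp flip: powr_add)
    finally show ?thesis by (simp add: g_def)
  qed
  show "ennreal (1 / (2 * \<beta>) * (N powr (2 * r) * min 1 (N * \<delta>) powr (2 * \<beta>))) \<le> I"
    unfolding gI[symmetric] I_def
  proof (rule nn_integral_mono_AE)
    have "AE t in lborel. t \<noteq> 0 \<and> t \<noteq> \<delta>"
      using AE_lborel_singleton[of "0::real"] AE_lborel_singleton[of \<delta>] by eventually_elim simp
    then show "AE t in lborel. ennreal (g t) * indicator {0..c} t \<le>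
        ennreal (t powr (- 2 * r - 1) * min 1 (N * t) powr (2 * (r + \<beta>))) * indicator {0<..<\<delta>} t"
    proof eventually_elim
      case (elim t)
      then show ?case using g_eq[of t] c by (cases "t \<in> {0..c}") auto
    qed
  qed
  show "I \<le> ennreal ((1 / (2 * \<beta>) + 1 / (2 * r)) * (N powr (2 * r) * min 1 (N * \<delta>) powr (2 * \<beta>)))"
  proof (cases "\<delta> \<le> 1 / N")
    case True
    then have "c = \<delta>" by (simp add: c_def)
    have "I \<le> (\<integral>\<^sup>+t. ennreal (g t) * indicator {0..c} t \<partial>lborel)"
      unfolding I_def using g_eq \<open>c = \<delta>\<close> by (intro nn_integral_mono) (auto simp: indicator_def)
    also have "\<dots> \<le> ennreal ((1 / (2 * \<beta>) + 1 / (2 * r)) * (N powr (2 * r) * min 1 (N * \<delta>) powr (2 * \<beta>)))"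
      unfolding gI using \<beta> r by (intro ennreal_leI mult_right_mono) auto
    finally show ?thesis .
  next
    case False
    then have cN: "c = 1 / N" and m1: "min 1 (N * \<delta>) = 1" using N by (auto simp: c_def min_def field_simps)
    have "((\<lambda>t. t powr (- 2 * r - 1)) has_integral - (c powr (- 2 * r - 1 + 1)) / (- 2 * r - 1 + 1)) {c..}"
      using r c by (intro has_integral_powr_to_inf) auto
    moreover have "- (c powr (- 2 * r - 1 + 1)) / (- 2 * r - 1 + 1) = N powr (2 * r) / (2 * r)"
      using N by (simp add: cN powr_divide powr_minus_divide)
    ultimately have hI: "(\<integral>\<^sup>+t. ennreal (t powr (- 2 * r - 1)) * indicator {c..} t \<partial>lborel) = ennreal (N powr (2 * r) / (2 * r))"
      by (intro nn_integral_has_integral_lebesgue') auto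
    have "I \<le> (\<integral>\<^sup>+t. ennreal (g t) * indicator {0..c} t + ennreal (t powr (- 2 * r - 1)) * indicator {c..} t \<partial>lborel)"
      unfolding I_def
    proof (rule nn_integral_mono)
      fix t
      show "ennreal (t powr (- 2 * r - 1) * min 1 (N * t) powr (2 * (r + \<beta>))) * indicator {0<..<\<delta>} t \<le>
         ennreal (g t) * indicator {0..c} t + ennreal (t powr (- 2 * r - 1)) * indicator {c..} t"
      proof (cases "0 < t \<and> t \<le> c")
        case True
        then show ?thesis using g_eq[of t] by (auto simp: indicator_def add_increasing2)
      next
        case False
        show ?thesis
        proof (cases "t > c")
          case True
          have "t powr (- 2 * r - 1) * min 1 (N * t) powr (2 * (r + \<beta>)) \<le> t powr (- 2 * r - 1) * 1"
            using True c N r \<beta> by (intro mult_left_mono powr_le1) auto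
          then show ?thesis using True by (auto simp: indicator_def intro!: ennreal_leI)
        qed (use False in auto)
      qed
    qed
    also have "\<dots> = ennreal (1 / (2 * \<beta>) * (N powr (2 * r) * min 1 (N * \<delta>) powr (2 * \<beta>))) + ennreal (N powr (2 * r) / (2 * r))"
    proof -
      have [measurable]: "g \<in> borel_measurable borel" unfolding g_def by measurable
      show ?thesis unfolding gI[symmetric] hI[symmetric] by (rule nn_integral_add) measurable
    qed
    also have "\<dots> = ennreal ((1 / (2 * \<beta>) + 1 / (2 * r)) * (N powr (2 * r) * min 1 (N * \<delta>) powr (2 * \<beta>)))"
      using \<beta> r by (simp add: m1 distrib_right flip: ennreal_plus)
    finally show ?thesis by simp
  qed
qed

section \<open>Moduli of smoothness as double series\<close>

text \<open>The double series comparable to the square of the mixed modulus of a function with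
  \<open>dyadic_spectrum\<close> \<open>a\<close>.\<close>

definition modulus_series :: "real \<Rightarrow> real \<Rightarrow> (nat \<Rightarrow> nat \<Rightarrow> real) \<Rightarrow> real \<Rightarrow> real \<Rightarrow> ennreal" where
  "modulus_series \<alpha>1 \<alpha>2 a \<delta>1 \<delta>2 =
     dsum (\<lambda>j k. min 1 (2 ^ j * \<delta>1) powr (2 * \<alpha>1) * min 1 (2 ^ k * \<delta>2) powr (2 * \<alpha>2) * (a j k)\<^sup>2)"

lemma mixed_modulus_equiv:
  assumes p: "1 < p" and \<alpha>: "0 < \<alpha>1" "0 < \<alpha>2"
  shows "\<exists>K::real. 1 \<le> K \<and> (\<forall>F a \<delta>1 \<delta>2. F \<in> borel_measurable lebesgue \<longrightarrow> biperiodic F \<longrightarrow>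
    integrable torus F \<longrightarrow> dyadic_spectrum F a \<longrightarrow> 0 < \<delta>1 \<longrightarrow> 0 < \<delta>2 \<longrightarrow>
    (mixed_modulus p \<alpha>1 \<alpha>2 F \<delta>1 \<delta>2)\<^sup>2 \<le> ennreal K * modulus_series \<alpha>1 \<alpha>2 a \<delta>1 \<delta>2 \<and>
    modulus_series \<alpha>1 \<alpha>2 a \<delta>1 \<delta>2 \<le> ennreal K * (mixed_modulus p \<alpha>1 \<alpha>2 F \<delta>1 \<delta>2)\<^sup>2)"
proof -
  obtain K0 where K0: "1 \<le> K0" "\<And>u a. integrable torus u \<Longrightarrow> dyadic_spectrum u a \<Longrightarrow>
    (Lp_norm p u)\<^sup>2 \<le> ennreal K0 * energy a \<and> energy a \<le> ennreal K0 * (Lp_norm p u)\<^sup>2"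
    using Lp_norm_energy_equiv[OF p] by blast
  define C1 where "C1 = K0 * (2 powr (2 * \<alpha>1) * 2 powr (2 * \<alpha>2))"
  define C2 where "C2 = 16 * 8 powr (2 * \<alpha>1) * 8 powr (2 * \<alpha>2) * K0"
  define K where "K = max 1 (max C1 C2)"
  have C: "0 \<le> C1" "0 \<le> C2" using K0(1) by (auto simp: C1_def C2_def)
  have "\<omega>\<^sup>2 \<le> ennreal K * M \<and> M \<le> ennreal K * \<omega>\<^sup>2"
    if F: "F \<in> borel_measurable lebesgue" "biperiodic F" "integrable torus F" and spec: "dyadic_spectrum F a"
      and \<delta>: "0 < \<delta>1" "0 < \<delta>2"
      and M: "M = modulus_series \<alpha>1 \<alpha>2 a \<delta>1 \<delta>2"
      and \<omega>: "\<omega> = mixed_modulus p \<alpha>1 \<alpha>2 F \<delta>1 \<delta>2" for F a \<delta>1 \<delta>2 M \<omega>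
  proof
    define D where "D h1 h2 = diff_x \<alpha>1 h1 (diff_y \<alpha>2 h2 F)" for h1 h2
    define S where "S \<alpha> j h = \<bar>2 * sin (2 ^ j * h / 2)\<bar> powr (2 * \<alpha>)" for \<alpha> h :: real and j :: nat
    define E where "E h1 h2 = dsum (\<lambda>j k. S \<alpha>1 j h1 * S \<alpha>2 k h2 * (a j k)\<^sup>2)" for h1 h2
    have \<omega>2: "\<omega> = (SUP (h1, h2)\<in>{(h1, h2). \<bar>h1\<bar> \<le> \<delta>1 \<and> \<bar>h2\<bar> \<le> \<delta>2}. Lp_norm p (D h1 h2))"
      by (simp add: \<omega> mixed_modulus_def D_def)
    have LE: "(Lp_norm p (D h1 h2))\<^sup>2 \<le> ennreal K0 * E h1 h2" "E h1 h2 \<le> ennreal K0 * (Lp_norm p (D h1 h2))\<^sup>2" for h1 h2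
    proof -
      note y = diff_y_regular[OF F \<alpha>(2), of h2]
      have Di: "integrable torus (D h1 h2)" unfolding D_def by (rule diff_x_regular[OF y \<alpha>(1)])
      have coeff: "norm (fourier_coeff (D h1 h2) m n) =
          \<bar>2 * sin (of_int m * h1 / 2)\<bar> powr \<alpha>1 * (\<bar>2 * sin (of_int n * h2 / 2)\<bar> powr \<alpha>2 * norm (fourier_coeff F m n))" for m n
        unfolding D_def norm_fourier_coeff_diff_x[OF y \<alpha>(1)] norm_fourier_coeff_diff_y[OF F \<alpha>(2)] ..
      have sin_eq: "\<bar>2 * sin (of_int m * h / 2)\<bar> = \<bar>2 * sin (2 ^ j * h / 2)\<bar>" if "\<bar>m\<bar> = 2 ^ j" for m :: int and j and h :: real
      proof -
        have "m = 2 ^ j \<or> m = - (2 ^ j)" using that by linarith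
        then show ?thesis by auto
      qed
      define b where "b j k = \<bar>2 * sin (2 ^ j * h1 / 2)\<bar> powr \<alpha>1 * (\<bar>2 * sin (2 ^ k * h2 / 2)\<bar> powr \<alpha>2 * a j k)" for j k :: nat
      have "dyadic_spectrum (D h1 h2) b"
        unfolding dyadic_spectrum_def
      proof (intro conjI allI impI)
        fix m n :: int and j k assume mn: "\<bar>m\<bar> = 2 ^ j \<and> \<bar>n\<bar> = 2 ^ k"
        then have "norm (fourier_coeff F m n) = a j k" using spec by (auto simp: dyadic_spectrum_def)
        then show "norm (fourier_coeff (D h1 h2) m n) = b j k"
          using mn by (simp only: coeff b_def sin_eq)
      next
        fix m n :: int assume "\<not> (\<exists>j k. \<bar>m\<bar> = 2 ^ j \<and> \<bar>n\<bar> = 2 ^ k)"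
        then have "fourier_coeff F m n = 0" using spec by (auto simp: dyadic_spectrum_def)
        then have "norm (fourier_coeff (D h1 h2) m n) = 0" unfolding coeff by simp
        then show "fourier_coeff (D h1 h2) m n = 0" by simp
      qed
      moreover have "energy b = E h1 h2"
      proof -
        have sq: "(x powr \<alpha>)\<^sup>2 = x powr (2 * \<alpha>)" for x \<alpha> :: real
          by (simp add: power2_eq_square flip: powr_add)
        have "(b j k)\<^sup>2 = S \<alpha>1 j h1 * S \<alpha>2 k h2 * (a j k)\<^sup>2" for j k
          unfolding b_def S_def power_mult_distrib sq by simp
        then show ?thesis by (simp add: energy_dsum E_def)
      qed
      ultimately show "(Lp_norm p (D h1 h2))\<^sup>2 \<le> ennreal K0 * E h1 h2" "E h1 h2 \<le> ennreal K0 * (Lp_norm p (D h1 h2))\<^sup>2"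
        using K0(2)[OF Di, of b] by simp_all
    qed
    have SM: "S \<alpha> j h \<le> 2 powr (2 * \<alpha>) * min 1 (2 ^ j * \<delta>) powr (2 * \<alpha>)" 
      if "\<bar>h\<bar> \<le> \<delta>" "0 < \<alpha>" "0 < \<delta>" for \<alpha> h \<delta> :: real and j
    proof -
      have "S \<alpha> j h \<le> (2 * min 1 (2 ^ j * \<delta>)) powr (2 * \<alpha>)"
        unfolding S_def using that by (intro powr_mono2 abs_two_sin_le) auto
      also have "\<dots> = 2 powr (2 * \<alpha>) * min 1 (2 ^ j * \<delta>) powr (2 * \<alpha>)"
        by (rule powr_mult)
      finally show ?thesis .
    qed
    have S0: "0 \<le> S \<alpha> j h" for \<alpha> j h by (simp add: S_def)
    have EM: "E h1 h2 \<le> ennreal (2 powr (2 * \<alpha>1) * 2 powr (2 * \<alpha>2)) * M" if "\<bar>h1\<bar> \<le> \<delta>1" "\<bar>h2\<bar> \<le> \<delta>2" for h1 h2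
    proof -
      have "E h1 h2 \<le> dsum (\<lambda>j k. (2 powr (2 * \<alpha>1) * 2 powr (2 * \<alpha>2)) *
          (min 1 (2 ^ j * \<delta>1) powr (2 * \<alpha>1) * min 1 (2 ^ k * \<delta>2) powr (2 * \<alpha>2) * (a j k)\<^sup>2))"
        unfolding E_def
      proof (rule dsum_mono)
        fix j k
        have "S \<alpha>1 j h1 * S \<alpha>2 k h2 * (a j k)\<^sup>2 \<le>
            ((2 powr (2 * \<alpha>1) * min 1 (2 ^ j * \<delta>1) powr (2 * \<alpha>1)) * (2 powr (2 * \<alpha>2) * min 1 (2 ^ k * \<delta>2) powr (2 * \<alpha>2))) * (a j k)\<^sup>2"
          by (intro mult_right_mono mult_mono SM that \<alpha> \<delta> S0) auto
        then show "S \<alpha>1 j h1 * S \<alpha>2 k h2 * (a j k)\<^sup>2 \<le> (2 powr (2 * \<alpha>1) * 2 powr (2 * \<alpha>2)) *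
          (min 1 (2 ^ j * \<delta>1) powr (2 * \<alpha>1) * min 1 (2 ^ k * \<delta>2) powr (2 * \<alpha>2) * (a j k)\<^sup>2)"
          by (simp only: mult_ac)
      qed
      also have "\<dots> = ennreal (2 powr (2 * \<alpha>1) * 2 powr (2 * \<alpha>2)) * M"
        unfolding M modulus_series_def by (rule dsum_cmult) auto
      finally show ?thesis .
    qed
    \<comment> \<open>Every admissible pair of steps obeys the same upper bound.\<close>
    have "\<omega> \<le> ennreal_powr (ennreal C1 * M) (1 / 2)"
      unfolding \<omega>2
    proof (rule SUP_least, clarify)
      fix h1 h2 assume h: "\<bar>h1\<bar> \<le> \<delta>1" "\<bar>h2\<bar> \<le> \<delta>2"
      have "(Lp_norm p (D h1 h2))\<^sup>2 \<le> ennreal K0 * E h1 h2" by (rule LE)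
      also have "\<dots> \<le> ennreal K0 * (ennreal (2 powr (2 * \<alpha>1) * 2 powr (2 * \<alpha>2)) * M)"
        by (intro mult_left_mono EM h) simp
      also have "\<dots> = ennreal C1 * M" using K0(1) by (simp add: C1_def ennreal_mult mult.assoc)
      finally have "ennreal_powr ((Lp_norm p (D h1 h2))\<^sup>2) (1 / 2) \<le> ennreal_powr (ennreal C1 * M) (1 / 2)"
        by (rule ennreal_powr_mono) simp
      then show "Lp_norm p (D h1 h2) \<le> ennreal_powr (ennreal C1 * M) (1 / 2)"
        by (simp only: ennreal_powr_square_half)
    qed
    then have "\<omega>\<^sup>2 \<le> (ennreal_powr (ennreal C1 * M) (1 / 2))\<^sup>2" by (rule power_mono) simp
    also have "\<dots> = ennreal C1 * M" by (rule ennreal_powr_half_square)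
    also have "\<dots> \<le> ennreal K * M" by (intro mult_right_mono ennreal_leI) (auto simp: K_def)
    finally show "\<omega>\<^sup>2 \<le> ennreal K * M" .
    \<comment> \<open>For the reverse bound, the supremum over the steps is replaced by a mean value.\<close>
    define G where "G \<alpha> \<delta> j = \<delta> / 4 * (min 1 (2 ^ j * \<delta>) / 8) powr (2 * \<alpha>)" for \<alpha> \<delta> :: real and j :: nat
    have G: "ennreal (G \<alpha> \<delta> j) \<le> (\<integral>\<^sup>+h\<in>{0<..<\<delta>}. ennreal (S \<alpha> j h) \<partial>lborel)" if "0 < \<alpha>" "0 < \<delta>" for \<alpha> \<delta> j
      unfolding G_def S_def using that by (intro nn_integral_sin_powr_ge) auto
    define \<kappa> where "\<kappa> = \<delta>1 * \<delta>2 / (16 * 8 powr (2 * \<alpha>1) * 8 powr (2 * \<alpha>2))"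
    have \<kappa>: "0 < \<kappa>" using \<delta> by (simp add: \<kappa>_def)
    have "ennreal \<kappa> * M = dsum (\<lambda>j k. (a j k)\<^sup>2 * (G \<alpha>1 \<delta>1 j * G \<alpha>2 \<delta>2 k))"
    proof -
      have "ennreal \<kappa> * M = dsum (\<lambda>j k. \<kappa> * (min 1 (2 ^ j * \<delta>1) powr (2 * \<alpha>1) * min 1 (2 ^ k * \<delta>2) powr (2 * \<alpha>2) * (a j k)\<^sup>2))"
        unfolding M modulus_series_def using \<kappa> by (intro dsum_cmult[symmetric]) auto
      also have "(\<lambda>j k. \<kappa> * (min 1 (2 ^ j * \<delta>1) powr (2 * \<alpha>1) * min 1 (2 ^ k * \<delta>2) powr (2 * \<alpha>2) * (a j k)\<^sup>2)) =
          (\<lambda>j k. (a j k)\<^sup>2 * (G \<alpha>1 \<delta>1 j * G \<alpha>2 \<delta>2 k))"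
        using \<delta> by (intro ext) (simp add: \<kappa>_def G_def powr_divide mult_ac)
      finally show ?thesis .
    qed
    also have "\<dots> \<le> (\<Sum>j. \<Sum>k. ennreal ((a j k)\<^sup>2) * 
        ((\<integral>\<^sup>+h\<in>{0<..<\<delta>1}. ennreal (S \<alpha>1 j h) \<partial>lborel) * (\<integral>\<^sup>+h\<in>{0<..<\<delta>2}. ennreal (S \<alpha>2 k h) \<partial>lborel)))"
    proof -
      have "ennreal ((a j k)\<^sup>2 * (G \<alpha>1 \<delta>1 j * G \<alpha>2 \<delta>2 k)) \<le> ennreal ((a j k)\<^sup>2) * 
        ((\<integral>\<^sup>+h\<in>{0<..<\<delta>1}. ennreal (S \<alpha>1 j h) \<partial>lborel) * (\<integral>\<^sup>+h\<in>{0<..<\<delta>2}. ennreal (S \<alpha>2 k h) \<partial>lborel))" for j k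
      proof -
        have "0 \<le> G \<alpha>1 \<delta>1 j" "0 \<le> G \<alpha>2 \<delta>2 k" using \<delta> by (auto simp: G_def)
        then have "ennreal ((a j k)\<^sup>2 * (G \<alpha>1 \<delta>1 j * G \<alpha>2 \<delta>2 k)) =
            ennreal ((a j k)\<^sup>2) * (ennreal (G \<alpha>1 \<delta>1 j) * ennreal (G \<alpha>2 \<delta>2 k))" by (simp add: ennreal_mult)
        also have "\<dots> \<le> ennreal ((a j k)\<^sup>2) * 
           ((\<integral>\<^sup>+h\<in>{0<..<\<delta>1}. ennreal (S \<alpha>1 j h) \<partial>lborel) * (\<integral>\<^sup>+h\<in>{0<..<\<delta>2}. ennreal (S \<alpha>2 k h) \<partial>lborel))"
          by (intro mult_left_mono mult_mono G \<alpha> \<delta>) auto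
        finally show ?thesis .
      qed
      then show ?thesis unfolding dsum_def by (intro suminf_le) auto
    qed
    also have "\<dots> = (\<integral>\<^sup>+h1\<in>{0<..<\<delta>1}. (\<integral>\<^sup>+h2\<in>{0<..<\<delta>2}. E h1 h2 \<partial>lborel) \<partial>lborel)"
      unfolding E_def by (rule nn_integral_dsum[symmetric]) (auto simp: S_def)
    also have "\<dots> \<le> (\<integral>\<^sup>+h1\<in>{0<..<\<delta>1}. (\<integral>\<^sup>+h2\<in>{0<..<\<delta>2}. ennreal K0 * \<omega>\<^sup>2 \<partial>lborel) \<partial>lborel)"
    proof -
      have "E h1 h2 \<le> ennreal K0 * \<omega>\<^sup>2" if "h1 \<in> {0<..<\<delta>1}" "h2 \<in> {0<..<\<delta>2}" for h1 h2
      proof -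
        have "Lp_norm p (D h1 h2) \<le> \<omega>"
          unfolding \<omega>2 using that by (intro SUP_upper2[of "(h1, h2)"]) auto
        then have "ennreal K0 * (Lp_norm p (D h1 h2))\<^sup>2 \<le> ennreal K0 * \<omega>\<^sup>2"
          by (intro mult_left_mono power_mono) auto
        then show ?thesis using LE(2) order_trans by blast
      qed
      then show ?thesis
        by (intro nn_integral_mono) (auto simp: indicator_def intro!: nn_integral_mono)
    qed
    also have "\<dots> = ennreal K0 * \<omega>\<^sup>2 * ennreal \<delta>2 * ennreal \<delta>1"
      using \<delta> by (simp add: nn_integral_cmult_indicator)
    finally have "ennreal \<kappa> * M \<le> ennreal (K0 * \<delta>1 * \<delta>2) * \<omega>\<^sup>2"
      using K0(1) \<delta> by (simp add: ennreal_mult mult_ac)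
    then have "ennreal (1 / \<kappa>) * (ennreal \<kappa> * M) \<le> ennreal (1 / \<kappa>) * (ennreal (K0 * \<delta>1 * \<delta>2) * \<omega>\<^sup>2)"
      by (rule mult_left_mono) simp
    moreover have "ennreal (1 / \<kappa>) * (ennreal \<kappa> * M) = M"
      using \<kappa> by (simp add: mult.assoc[symmetric] flip: ennreal_mult)
    moreover have "ennreal (1 / \<kappa>) * (ennreal (K0 * \<delta>1 * \<delta>2) * \<omega>\<^sup>2) = ennreal C2 * \<omega>\<^sup>2"
    proof -
      have "1 / \<kappa> * (K0 * \<delta>1 * \<delta>2) = C2" using \<delta> by (simp add: \<kappa>_def C2_def)
      moreover have "ennreal (1 / \<kappa>) * ennreal (K0 * \<delta>1 * \<delta>2) = ennreal (1 / \<kappa> * (K0 * \<delta>1 * \<delta>2))"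
        using \<kappa> by (subst ennreal_mult') auto
      ultimately show ?thesis by (simp add: mult.assoc[symmetric])
    qed
    ultimately have "M \<le> ennreal C2 * \<omega>\<^sup>2" by simp
    also have "\<dots> \<le> ennreal K * \<omega>\<^sup>2" by (intro mult_right_mono ennreal_leI) (auto simp: K_def)
    finally show "M \<le> ennreal K * \<omega>\<^sup>2" .
  qed
  then show ?thesis by (intro exI[of _ K]) (auto simp: K_def)
qed

section \<open>Moduli of smoothness of Weyl derivatives\<close>

lemma ennreal_powr_half_cmult: "0 \<le> c \<Longrightarrow> ennreal_powr (ennreal c * x) (1 / 2) = ennreal (sqrt c) * ennreal_powr x (1 / 2)"
proof (cases x)
  case (real r)
  moreover assume "0 \<le> c"
  ultimately show ?thesis
    by (simp add: ennreal_powr_ennreal powr_half_sqrt real_sqrt_mult flip: ennreal_mult)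
next
  case top
  assume "0 \<le> c"
  then show ?thesis using top by (cases "c = 0") (simp_all add: ennreal_mult_top ennreal_powr_def)
qed

lemma ennreal_mult3:
  "0 \<le> x \<Longrightarrow> 0 \<le> y \<Longrightarrow> 0 \<le> z \<Longrightarrow> ennreal x * (ennreal y * ennreal z) = ennreal (x * (y * z))"
  by (simp add: ennreal_mult)

lemma Lp_integrable:
  assumes "1 < p" "f \<in> Lp p"
  shows "f \<in> borel_measurable lebesgue" "biperiodic f" "integrable torus f"
proof -
  show m: "f \<in> borel_measurable lebesgue" and "biperiodic f" using assms by (auto simp: Lp_def)
  have "(\<integral>\<^sup>+z. ennreal (norm (f z) powr p) \<partial>torus) < \<infinity>"
    using assms by (cases "\<integral>\<^sup>+z. ennreal (norm (f z) powr p) \<partial>torus") (auto simp: Lp_def Lp_norm_eq)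
  then show "integrable torus f"
    using assms m by (intro integrable_torus_of_Lp) (auto intro: measurable_torus)
qed

lemma dyadic_spectrum_lacunary:
  assumes "has_lacunary_cosine_series f l"
  shows "dyadic_spectrum f (\<lambda>j k. \<bar>l j k\<bar> / 4)"
proof -
  have "norm (complex_of_real (l j k / 4)) = \<bar>l j k\<bar> / 4" for j k
    unfolding norm_of_real by simp
  then show ?thesis
    using assms unfolding has_lacunary_cosine_series_def dyadic_spectrum_def by metis
qed

lemma dyadic_spectrum_weyl:
  assumes f: "dyadic_spectrum f a" and g: "is_weyl_derivative r1 r2 f g"
  shows "dyadic_spectrum g (\<lambda>j k. (2 ^ j) powr r1 * (2 ^ k) powr r2 * a j k)"
proof -
  have g: "fourier_coeff g m n = (if m = 0 \<or> n = 0 then 0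
      else weyl_factor m r1 * weyl_factor n r2 * fourier_coeff f m n)" for m n
    using g by (simp add: is_weyl_derivative_def)
  have w: "norm (weyl_factor m r) = (2 ^ j) powr r" if "\<bar>m\<bar> = 2 ^ j" for m :: int and j r
  proof -
    have "\<bar>real_of_int m\<bar> = 2 ^ j" using that by (metis of_int_abs of_int_numeral of_int_power)
    then show ?thesis by (simp add: weyl_factor_def norm_mult)
  qed
  show ?thesis
    unfolding dyadic_spectrum_def
  proof (intro conjI allI impI)
    fix m n :: int and j k assume mn: "\<bar>m\<bar> = 2 ^ j \<and> \<bar>n\<bar> = 2 ^ k"
    then have "m \<noteq> 0" "n \<noteq> 0" by auto
    then show "norm (fourier_coeff g m n) = (2 ^ j) powr r1 * (2 ^ k) powr r2 * a j k"
      using mn f by (simp add: g norm_mult w[of _ j] w[of _ k] dyadic_spectrum_def)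
  next
    fix m n :: int assume "\<not> (\<exists>j k. \<bar>m\<bar> = 2 ^ j \<and> \<bar>n\<bar> = 2 ^ k)"
    then show "fourier_coeff g m n = 0" using f by (auto simp: g dyadic_spectrum_def)
  qed
qed

theorem theorem8p3:
  fixes p \<beta>1 \<beta>2 r1 r2 :: real
  assumes "1 < p" and "0 < \<beta>1" and "0 < \<beta>2" and "0 < r1" and "0 < r2"
  shows "\<exists>C::real. C > 0 \<and>
    (\<forall>f g \<delta>1 \<delta>2.
       f \<in> Lambda_class p \<longrightarrow>
       g \<in> Lp p \<longrightarrow> is_weyl_derivative r1 r2 f g \<longrightarrow>
       \<delta>1 \<in> {0<..<1/2} \<longrightarrow> \<delta>2 \<in> {0<..<1/2} \<longrightarrow>
       (let A = mixed_modulus p \<beta>1 \<beta>2 g \<delta>1 \<delta>2;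
            B = ennreal_powr
                  (\<integral>\<^sup>+t1\<in>{0<..<\<delta>1}.
                     (\<integral>\<^sup>+t2\<in>{0<..<\<delta>2}.
                        ennreal (t1 powr (- 2 * r1 - 1) * t2 powr (- 2 * r2 - 1)) *
                        (mixed_modulus p (r1 + \<beta>1) (r2 + \<beta>2) f t1 t2)\<^sup>2
                      \<partial>lborel) \<partial>lborel) (1 / 2)
        in ennreal (inverse C) * B \<le> A \<and> A \<le> ennreal C * B))"
proof -
  obtain K1 where K1: "1 \<le> K1" "\<And>F a \<delta>1 \<delta>2. F \<in> borel_measurable lebesgue \<Longrightarrow> biperiodic F \<Longrightarrow>
    integrable torus F \<Longrightarrow> dyadic_spectrum F a \<Longrightarrow> 0 < \<delta>1 \<Longrightarrow> 0 < \<delta>2 \<Longrightarrow>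
    (mixed_modulus p \<beta>1 \<beta>2 F \<delta>1 \<delta>2)\<^sup>2 \<le> ennreal K1 * modulus_series \<beta>1 \<beta>2 a \<delta>1 \<delta>2 \<and>
    modulus_series \<beta>1 \<beta>2 a \<delta>1 \<delta>2 \<le> ennreal K1 * (mixed_modulus p \<beta>1 \<beta>2 F \<delta>1 \<delta>2)\<^sup>2"
    using mixed_modulus_equiv[OF assms(1-3)] by blast
  have rb: "0 < r1 + \<beta>1" "0 < r2 + \<beta>2" using assms by auto
  obtain K2 where K2: "1 \<le> K2" "\<And>F a \<delta>1 \<delta>2. F \<in> borel_measurable lebesgue \<Longrightarrow> biperiodic F \<Longrightarrow>
    integrable torus F \<Longrightarrow> dyadic_spectrum F a \<Longrightarrow> 0 < \<delta>1 \<Longrightarrow> 0 < \<delta>2 \<Longrightarrow>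
    (mixed_modulus p (r1 + \<beta>1) (r2 + \<beta>2) F \<delta>1 \<delta>2)\<^sup>2 \<le> ennreal K2 * modulus_series (r1 + \<beta>1) (r2 + \<beta>2) a \<delta>1 \<delta>2 \<and>
    modulus_series (r1 + \<beta>1) (r2 + \<beta>2) a \<delta>1 \<delta>2 \<le> ennreal K2 * (mixed_modulus p (r1 + \<beta>1) (r2 + \<beta>2) F \<delta>1 \<delta>2)\<^sup>2"
    using mixed_modulus_equiv[OF assms(1) rb] by blast
  define c1 where "c1 = 1 / (2 * \<beta>1) * (1 / (2 * \<beta>2))"
  define c2 where "c2 = (1 / (2 * \<beta>1) + 1 / (2 * r1)) * (1 / (2 * \<beta>2) + 1 / (2 * r2))"
  have c: "0 < c1" "0 < c2" using assms by (auto simp: c1_def c2_def add_pos_pos)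
  define C0 where "C0 = K1 * K2 * max c2 (1 / c1)"
  have C0: "0 < C0" using K1(1) K2(1) c by (auto simp: C0_def less_max_iff_disj)
  have main: "ennreal (inverse (sqrt C0)) * ennreal_powr I (1 / 2) \<le> A \<and> A \<le> ennreal (sqrt C0) * ennreal_powr I (1 / 2)"
    if f: "f \<in> Lambda_class p" and g: "g \<in> Lp p" "is_weyl_derivative r1 r2 f g"
      and \<delta>: "0 < \<delta>1" "0 < \<delta>2"
      and A: "A = mixed_modulus p \<beta>1 \<beta>2 g \<delta>1 \<delta>2"
      and I: "I = (\<integral>\<^sup>+t1\<in>{0<..<\<delta>1}. (\<integral>\<^sup>+t2\<in>{0<..<\<delta>2}.
                        ennreal (t1 powr (- 2 * r1 - 1) * t2 powr (- 2 * r2 - 1)) *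
                        (mixed_modulus p (r1 + \<beta>1) (r2 + \<beta>2) f t1 t2)\<^sup>2 \<partial>lborel) \<partial>lborel)"
    for f g \<delta>1 \<delta>2 A I
  proof -
    obtain l where l: "has_lacunary_cosine_series f l" and fp: "f \<in> Lp p"
      using f by (auto simp: Lambda_class_def Lp0_def)
    define a where "a j k = \<bar>l j k\<bar> / 4" for j k
    have spec: "dyadic_spectrum f a" unfolding a_def by (rule dyadic_spectrum_lacunary[OF l])
    note fi = Lp_integrable[OF assms(1) fp] and gi = Lp_integrable[OF assms(1) g(1)]
    \<comment> \<open>The common double series to which both sides are compared.\<close>
    define m where "m j k = ((2 ^ j) powr (2 * r1) * min 1 (2 ^ j * \<delta>1) powr (2 * \<beta>1)) *
        ((2 ^ k) powr (2 * r2) * min 1 (2 ^ k * \<delta>2) powr (2 * \<beta>2)) * (a j k)\<^sup>2" for j k :: nat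
    define M where "M = dsum m"
    have AM: "A\<^sup>2 \<le> ennreal K1 * M \<and> M \<le> ennreal K1 * A\<^sup>2"
    proof -
      have sq: "(x powr r)\<^sup>2 = x powr (2 * r)" for x r :: real
        by (simp add: power2_eq_square flip: powr_add)
      have "M = modulus_series \<beta>1 \<beta>2 (\<lambda>j k. (2 ^ j) powr r1 * (2 ^ k) powr r2 * a j k) \<delta>1 \<delta>2"
        unfolding M_def m_def modulus_series_def power_mult_distrib sq by (simp only: mult_ac)
      then show ?thesis
        unfolding A using K1(2)[OF gi dyadic_spectrum_weyl[OF spec g(2)] \<delta>] by simp
    qed
    define u where "u r \<beta> j t = t powr (- 2 * r - 1) * min 1 (2 ^ j * t) powr (2 * (r + \<beta>))" for r \<beta> :: real and j :: nat and t :: real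
    define J where "J = (\<integral>\<^sup>+t1\<in>{0<..<\<delta>1}. (\<integral>\<^sup>+t2\<in>{0<..<\<delta>2}. dsum (\<lambda>j k. u r1 \<beta>1 j t1 * u r2 \<beta>2 k t2 * (a j k)\<^sup>2) \<partial>lborel) \<partial>lborel)"
    have J: "J = (\<Sum>j. \<Sum>k. ennreal ((a j k)\<^sup>2) *
        ((\<integral>\<^sup>+t\<in>{0<..<\<delta>1}. ennreal (u r1 \<beta>1 j t) \<partial>lborel) * (\<integral>\<^sup>+t\<in>{0<..<\<delta>2}. ennreal (u r2 \<beta>2 k t) \<partial>lborel)))"
      unfolding J_def by (rule nn_integral_dsum) (auto simp: u_def)
    have c1M: "ennreal c1 * M \<le> J"
    proof -
      have "ennreal c1 * M = dsum (\<lambda>j k. c1 * m j k)"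
        unfolding M_def using c by (intro dsum_cmult[symmetric]) (auto simp: m_def)
      also have "\<dots> \<le> J"
        unfolding dsum_def J
      proof (intro suminf_le)
        fix j k
        have "ennreal (c1 * m j k) = ennreal ((a j k)\<^sup>2) *
            (ennreal (1 / (2 * \<beta>1) * ((2 ^ j) powr (2 * r1) * min 1 (2 ^ j * \<delta>1) powr (2 * \<beta>1))) *
             ennreal (1 / (2 * \<beta>2) * ((2 ^ k) powr (2 * r2) * min 1 (2 ^ k * \<delta>2) powr (2 * \<beta>2))))"
        proof -
          have "c1 * m j k = (a j k)\<^sup>2 * ((1 / (2 * \<beta>1) * ((2 ^ j) powr (2 * r1) * min 1 (2 ^ j * \<delta>1) powr (2 * \<beta>1))) * (1 / (2 * \<beta>2) * ((2 ^ k) powr (2 * r2) * min 1 (2 ^ k * \<delta>2) powr (2 * \<beta>2))))"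
            by (simp only: c1_def m_def mult_ac)
          moreover have "0 \<le> 1 / (2 * \<beta>1) * ((2 ^ j) powr (2 * r1) * min 1 (2 ^ j * \<delta>1) powr (2 * \<beta>1))" "0 \<le> 1 / (2 * \<beta>2) * ((2 ^ k) powr (2 * r2) * min 1 (2 ^ k * \<delta>2) powr (2 * \<beta>2))"
            using assms by (auto intro!: mult_nonneg_nonneg)
          ultimately show ?thesis by (simp only: ennreal_mult3 zero_le_power2)
        qed
        also have "\<dots> \<le> ennreal ((a j k)\<^sup>2) *
           ((\<integral>\<^sup>+t\<in>{0<..<\<delta>1}. ennreal (u r1 \<beta>1 j t) \<partial>lborel) * (\<integral>\<^sup>+t\<in>{0<..<\<delta>2}. ennreal (u r2 \<beta>2 k t) \<partial>lborel))"
          unfolding u_def using assms \<delta> by (intro mult_left_mono mult_mono weight_integral_ge) auto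
        finally show "ennreal (c1 * m j k) \<le> ennreal ((a j k)\<^sup>2) *
           ((\<integral>\<^sup>+t\<in>{0<..<\<delta>1}. ennreal (u r1 \<beta>1 j t) \<partial>lborel) * (\<integral>\<^sup>+t\<in>{0<..<\<delta>2}. ennreal (u r2 \<beta>2 k t) \<partial>lborel))" .
      qed auto
      finally show ?thesis .
    qed
    have c2M: "J \<le> ennreal c2 * M"
    proof -
      have "J \<le> dsum (\<lambda>j k. c2 * m j k)"
        unfolding dsum_def J
      proof (intro suminf_le)
        fix j k
        have "ennreal ((a j k)\<^sup>2) *
           ((\<integral>\<^sup>+t\<in>{0<..<\<delta>1}. ennreal (u r1 \<beta>1 j t) \<partial>lborel) * (\<integral>\<^sup>+t\<in>{0<..<\<delta>2}. ennreal (u r2 \<beta>2 k t) \<partial>lborel)) \<le>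
           ennreal ((a j k)\<^sup>2) *
            (ennreal ((1 / (2 * \<beta>1) + 1 / (2 * r1)) * ((2 ^ j) powr (2 * r1) * min 1 (2 ^ j * \<delta>1) powr (2 * \<beta>1))) *
             ennreal ((1 / (2 * \<beta>2) + 1 / (2 * r2)) * ((2 ^ k) powr (2 * r2) * min 1 (2 ^ k * \<delta>2) powr (2 * \<beta>2))))"
          unfolding u_def using assms \<delta> by (intro mult_left_mono mult_mono weight_integral_le) auto
        also have "\<dots> = ennreal (c2 * m j k)"
        proof -
          have "c2 * m j k = (a j k)\<^sup>2 * (((1 / (2 * \<beta>1) + 1 / (2 * r1)) * ((2 ^ j) powr (2 * r1) * min 1 (2 ^ j * \<delta>1) powr (2 * \<beta>1))) * ((1 / (2 * \<beta>2) + 1 / (2 * r2)) * ((2 ^ k) powr (2 * r2) * min 1 (2 ^ k * \<delta>2) powr (2 * \<beta>2))))"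
            by (simp only: c2_def m_def mult_ac)
          moreover have "0 \<le> (1 / (2 * \<beta>1) + 1 / (2 * r1)) * ((2 ^ j) powr (2 * r1) * min 1 (2 ^ j * \<delta>1) powr (2 * \<beta>1))" "0 \<le> (1 / (2 * \<beta>2) + 1 / (2 * r2)) * ((2 ^ k) powr (2 * r2) * min 1 (2 ^ k * \<delta>2) powr (2 * \<beta>2))"
            using assms by (auto intro!: mult_nonneg_nonneg)
          ultimately show ?thesis by (simp only: ennreal_mult3 zero_le_power2)
        qed
        finally show "ennreal ((a j k)\<^sup>2) *
           ((\<integral>\<^sup>+t\<in>{0<..<\<delta>1}. ennreal (u r1 \<beta>1 j t) \<partial>lborel) * (\<integral>\<^sup>+t\<in>{0<..<\<delta>2}. ennreal (u r2 \<beta>2 k t) \<partial>lborel)) \<le>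
           ennreal (c2 * m j k)" .
      qed auto
      also have "\<dots> = ennreal c2 * M"
        unfolding M_def using c by (intro dsum_cmult) (auto simp: m_def)
      finally show ?thesis .
    qed
    have E: "dsum (\<lambda>j k. u r1 \<beta>1 j t1 * u r2 \<beta>2 k t2 * (a j k)\<^sup>2) \<le>
          ennreal K2 * (ennreal (t1 powr (- 2 * r1 - 1) * t2 powr (- 2 * r2 - 1)) * (mixed_modulus p (r1 + \<beta>1) (r2 + \<beta>2) f t1 t2)\<^sup>2) \<and>
        ennreal (t1 powr (- 2 * r1 - 1) * t2 powr (- 2 * r2 - 1)) * (mixed_modulus p (r1 + \<beta>1) (r2 + \<beta>2) f t1 t2)\<^sup>2 \<le>
          ennreal K2 * dsum (\<lambda>j k. u r1 \<beta>1 j t1 * u r2 \<beta>2 k t2 * (a j k)\<^sup>2)"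
      if t: "0 < t1" "0 < t2" for t1 t2
    proof -
      define w where "w = t1 powr (- 2 * r1 - 1) * t2 powr (- 2 * r2 - 1)"
      define N where "N = modulus_series (r1 + \<beta>1) (r2 + \<beta>2) a t1 t2"
      define \<omega> where "\<omega> = mixed_modulus p (r1 + \<beta>1) (r2 + \<beta>2) f t1 t2"
      have "\<omega>\<^sup>2 \<le> ennreal K2 * N \<and> N \<le> ennreal K2 * \<omega>\<^sup>2"
        unfolding N_def \<omega>_def by (rule K2(2)[OF fi spec t])
      then have "ennreal w * \<omega>\<^sup>2 \<le> ennreal w * (ennreal K2 * N)" "ennreal w * N \<le> ennreal w * (ennreal K2 * \<omega>\<^sup>2)"
        by (auto intro: mult_left_mono)
      moreover have "dsum (\<lambda>j k. u r1 \<beta>1 j t1 * u r2 \<beta>2 k t2 * (a j k)\<^sup>2) = ennreal w * N"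
      proof -
        have "dsum (\<lambda>j k. u r1 \<beta>1 j t1 * u r2 \<beta>2 k t2 * (a j k)\<^sup>2) = dsum (\<lambda>j k. w *
            (min 1 (2 ^ j * t1) powr (2 * (r1 + \<beta>1)) * min 1 (2 ^ k * t2) powr (2 * (r2 + \<beta>2)) * (a j k)\<^sup>2))"
          unfolding u_def w_def by (simp only: mult_ac)
        also have "\<dots> = ennreal w * N" unfolding N_def modulus_series_def by (rule dsum_cmult) (auto simp: w_def)
        finally show ?thesis .
      qed
      ultimately show ?thesis by (simp add: w_def \<omega>_def mult_ac)
    qed
    \<comment> \<open>The moduli need not be measurable in \<open>(t1, t2)\<close> here: constants are moved only across the double
      series, and the moduli enter by monotonicity alone.\<close>
    have pull: "(\<integral>\<^sup>+t1\<in>{0<..<\<delta>1}. (\<integral>\<^sup>+t2\<in>{0<..<\<delta>2}.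
          ennreal d * dsum (\<lambda>j k. u r1 \<beta>1 j t1 * u r2 \<beta>2 k t2 * (a j k)\<^sup>2) \<partial>lborel) \<partial>lborel) = ennreal d * J"
      if d: "0 \<le> d" for d
    proof -
      have "ennreal d * dsum (\<lambda>j k. u r1 \<beta>1 j t1 * u r2 \<beta>2 k t2 * (a j k)\<^sup>2) =
          dsum (\<lambda>j k. u r1 \<beta>1 j t1 * u r2 \<beta>2 k t2 * (d * (a j k)\<^sup>2))" for t1 t2
        by (subst dsum_cmult[symmetric]) (auto simp: d u_def mult_ac)
      then have "(\<integral>\<^sup>+t1\<in>{0<..<\<delta>1}. (\<integral>\<^sup>+t2\<in>{0<..<\<delta>2}.
          ennreal d * dsum (\<lambda>j k. u r1 \<beta>1 j t1 * u r2 \<beta>2 k t2 * (a j k)\<^sup>2) \<partial>lborel) \<partial>lborel) =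
        (\<integral>\<^sup>+t1\<in>{0<..<\<delta>1}. (\<integral>\<^sup>+t2\<in>{0<..<\<delta>2}.
          dsum (\<lambda>j k. u r1 \<beta>1 j t1 * u r2 \<beta>2 k t2 * (d * (a j k)\<^sup>2)) \<partial>lborel) \<partial>lborel)" by simp
      also have "\<dots> = (\<Sum>j. \<Sum>k. ennreal (d * (a j k)\<^sup>2) *
        ((\<integral>\<^sup>+t\<in>{0<..<\<delta>1}. ennreal (u r1 \<beta>1 j t) \<partial>lborel) * (\<integral>\<^sup>+t\<in>{0<..<\<delta>2}. ennreal (u r2 \<beta>2 k t) \<partial>lborel)))"
        by (rule nn_integral_dsum) (auto simp: u_def d)
      also have "\<dots> = ennreal d * J"
        unfolding J using d by (simp add: ennreal_mult mult.assoc)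
      finally show ?thesis .
    qed
    have JI: "ennreal (1 / K2) * J \<le> I"
    proof -
      have "ennreal (1 / K2) * dsum (\<lambda>j k. u r1 \<beta>1 j t1 * u r2 \<beta>2 k t2 * (a j k)\<^sup>2) \<le>
         ennreal (t1 powr (- 2 * r1 - 1) * t2 powr (- 2 * r2 - 1)) * (mixed_modulus p (r1 + \<beta>1) (r2 + \<beta>2) f t1 t2)\<^sup>2" (is "_ * ?D \<le> ?W")
        if t: "0 < t1" "0 < t2" for t1 t2
      proof -
        have "ennreal (1 / K2) * ?D \<le> ennreal (1 / K2) * (ennreal K2 * ?W)"
          using E[OF t] by (intro mult_left_mono) auto
        also have "\<dots> = ?W"
          using K2(1) by (simp add: mult.assoc[symmetric] flip: ennreal_mult[of "1 / K2" K2])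
        finally show ?thesis .
      qed
      then show ?thesis
        using K2(1) unfolding I
        by (subst pull[symmetric]) (auto simp: indicator_def intro!: nn_integral_mono)
    qed
    have IJ: "I \<le> ennreal K2 * J"
      using E K2(1) unfolding I
      by (subst pull[symmetric]) (auto simp: indicator_def intro!: nn_integral_mono)
    have "A\<^sup>2 \<le> ennreal C0 * I"
    proof -
      have "ennreal K2 * (ennreal (1 / K2) * J) \<le> ennreal K2 * I"
        using JI by (rule mult_left_mono) simp
      moreover have "ennreal K2 * (ennreal (1 / K2) * J) = J"
        using K2(1) by (simp add: mult.assoc[symmetric] flip: ennreal_mult)
      ultimately have "ennreal c1 * M \<le> ennreal K2 * I" using c1M by (metis order_trans)
      then have "ennreal (1 / c1) * (ennreal c1 * M) \<le> ennreal (1 / c1) * (ennreal K2 * I)"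
        by (rule mult_left_mono) simp
      moreover have "ennreal (1 / c1) * (ennreal c1 * M) = M"
        using c by (simp add: mult.assoc[symmetric] flip: ennreal_mult)
      ultimately have "M \<le> ennreal (1 / c1) * (ennreal K2 * I)" by simp
      then have "ennreal K1 * M \<le> ennreal K1 * (ennreal (1 / c1) * (ennreal K2 * I))"
        by (rule mult_left_mono) simp
      also have "\<dots> = ennreal (K1 * K2 * (1 / c1)) * I"
        using K1(1) K2(1) c ennreal_mult[of "K1 * K2" "1 / c1"] ennreal_mult[of K1 K2] by (simp add: mult_ac)
      also have "\<dots> \<le> ennreal C0 * I"
      proof (intro mult_right_mono ennreal_leI)
        show "K1 * K2 * (1 / c1) \<le> C0"
          unfolding C0_def using K1(1) K2(1) by (intro mult_left_mono) auto
      qed simp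
      finally show ?thesis using AM by (meson order_trans)
    qed
    then have "ennreal_powr (A\<^sup>2) (1 / 2) \<le> ennreal_powr (ennreal C0 * I) (1 / 2)"
      by (rule ennreal_powr_mono) simp
    then have upper: "A \<le> ennreal (sqrt C0) * ennreal_powr I (1 / 2)"
      using C0 by (simp only: ennreal_powr_square_half ennreal_powr_half_cmult less_imp_le)
    have "I \<le> ennreal C0 * A\<^sup>2"
    proof -
      have "I \<le> ennreal K2 * (ennreal c2 * (ennreal K1 * A\<^sup>2))"
        using IJ c2M AM by (meson mult_left_mono order_trans zero_le)
      also have "\<dots> = ennreal (K1 * K2 * c2) * A\<^sup>2"
        using K1(1) K2(1) c by (simp add: ennreal_mult mult_ac)
      also have "\<dots> \<le> ennreal C0 * A\<^sup>2"
        using K1(1) K2(1) by (intro mult_right_mono ennreal_leI) (auto simp: C0_def intro!: mult_left_mono)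
      finally show ?thesis .
    qed
    then have "ennreal_powr I (1 / 2) \<le> ennreal_powr (ennreal C0 * A\<^sup>2) (1 / 2)"
      by (rule ennreal_powr_mono) simp
    then have "ennreal_powr I (1 / 2) \<le> ennreal (sqrt C0) * A"
      using C0 by (simp only: ennreal_powr_square_half ennreal_powr_half_cmult less_imp_le)
    then have "ennreal (inverse (sqrt C0)) * ennreal_powr I (1 / 2) \<le> ennreal (inverse (sqrt C0)) * (ennreal (sqrt C0) * A)"
      by (rule mult_left_mono) simp
    also have "\<dots> = A"
      using C0 by (simp add: mult.assoc[symmetric] flip: ennreal_mult)
    finally show ?thesis using upper by blast
  qed
  show ?thesis
  proof (intro exI conjI allI impI)
    show "0 < sqrt C0" using C0 by simp
  qed (unfold Let_def, rule main, auto)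
qed

end
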